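(* Let $Y\sim\mathrm{DCBM}(\theta,\psi,B)$ with $\theta\in[k]^n$ (every community nonempty), $\psi\in(0,1]^n$ with $\max_{i\in C_j}\psi_i=1$ for all $j\in[k]$, $B\in(0,1]^{k\times k}$ symmetric and full rank with smallest absolute eigenvalue $\lambda_B>0$, and $\max B\ge\log n/n$. Let $\varepsilon\in(0,\infty]$, $\gamma\ge0$, and let $\hat\theta_\varepsilon$ be the output of Algorithm B (below) applied to $\mathcal M_\varepsilon(Y)$ (where $\mathcal M_\infty(Y)=Y$) with approximation error $\gamma$. There exists a universal constant $c_2$ such that if $$\frac{(2.5+\gamma)\sqrt{kn\,g_\varepsilon(B)}}{\tilde n_{\min}\lambda_B}<c_2^{-1}\frac{n_{\min}}{\sqrt{\sum_{j=1}^kn_j^2\nu_j}},$$ then with probability at least $1-n^{-1}$, $$L(\theta,\hat\theta_\varepsilon)\le c_2\frac{2.5+\gamma}{\tilde n_{\min}\lambda_B}\sqrt{\frac kn\Big(\sum_{j=1}^kn_j^2\nu_j\Big)g_\varepsilon(B)}.$$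
   Context: $\mathrm{DCBM}(\theta,\psi,B)$: $Y$ symmetric $n\times n$ binary with zero diagonal, entries $Y_{ij}$ ($i<j$) independent $\mathrm{Bernoulli}(\psi_i\psi_jB_{\theta_i\theta_j})$. $C_j=\{i:\theta_i=j\}$, $n_j=|C_j|$, $n_{\min}=\min_jn_j$, $\tilde n_j=\sum_{i\in C_j}\psi_i^2$, $\tilde n_{\min}=\min_j\tilde n_j$, $\nu_j=n_j^{-2}\big(\sum_{i\in C_j}\psi_i^{-2}\big)\big(\sum_{i\in C_j}\psi_i^2\big)$, $\max B=\max_{ij}B_{ij}$. Symmetric edge-flip mechanism $\mathcal M_\varepsilon$ ($\varepsilon<\infty$): given $Y$, $\mathcal M_\varepsilon(Y)$ is the symmetric zero-diagonal binary matrix whose entries $(i<j)$ are, independently given $Y$, $1-Y_{ij}$ w.p. $\frac1{1+e^\varepsilon}$ and $Y_{ij}$ w.p. $\frac{e^\varepsilon}{1+e^\varepsilon}$. $g_\varepsilon(B)=\frac{e^\varepsilon+1}{e^\varepsilon-1}\left(\max B+\frac1{e^\varepsilon-1}\right)$ for $\varepsilon<\infty$, and $g_\infty(B)=\max B$. $(1+\gamma)$-approximate $k$-medians: for a matrix $V\in\mathbb R^{m\times k}$, with $\mathbb G^{m\times k}$ the 0/1 matrices with exactly one 1 per row and $\|A\|_{2,1}=\sum_i\|A_{i*}\|_2$, a pair $(\hat\Theta,\hat X)$, $\hat\Theta\in\mathbb G^{m\times k}$, $\hat X\in\mathbb R^{k\times k}$, is a $(1+\gamma)$-approximate solution if $\|\hat\Theta\hat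 X-V\|_{2,1}\le(1+\gamma)\inf_{\Theta,X}\|\Theta X-V\|_{2,1}$; induced labels are the column index of the 1 in each row. Algorithm B (input: edge-flipped $A$, $k$, $\gamma$, $\varepsilon$): set $A_\downarrow=A$ if $\varepsilon=\infty$ and $A_\downarrow=A-(e^\varepsilon+1)^{-1}(\mathbf 1_n\mathbf 1_n^T-I_n)$ otherwise; let $\hat U_\downarrow\in\mathbb R^{n\times k}$ have as columns orthonormal eigenvectors of $A_\downarrow$ for its $k$ largest eigenvalues in absolute value; let $I_+=\{i:\|(\hat U_\downarrow)_{i*}\|_2>0\}$; form the matrix whose rows are $(\hat U_\downarrow)_{i*}/\|(\hat U_\downarrow)_{i*}\|_2$ for $i\in I_+$ and compute labels of a $(1+\gamma)$-approximate $k$-medians solution on these rows; assign these labels to nodes in $I_+$, and label $1$ to every node not in $I_+$. Misclassification: $L(\theta,\hat\theta)=\min_{\sigma}\frac1n\sum_{i=1}^n\mathbf 1\{\sigma(\hat\theta_i)\ne\theta_i\}$, minimum over permutations $\sigma$ of $[k]$. *)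

theory Defs
  imports "HOL-Probability.Probability" "HOL-Combinatorics.Permutations"
begin

text \<open>Conventions: nodes are 0..<n, community labels and matrix indices of B are 1..k.
  Matrices are functions nat => nat => _ with explicit index ranges.\<close>

definition pairs :: "nat \<Rightarrow> (nat \<times> nat) set" where
  "pairs n = {(i,j). i < j \<and> j < n}"

definition sym_of :: "nat \<Rightarrow> (nat \<times> nat \<Rightarrow> bool) \<Rightarrow> nat \<Rightarrow> nat \<Rightarrow> bool" where
  "sym_of n E i j = (i < n \<and> j < n \<and>
      (if i < j then E (i,j) else if j < i then E (j,i) else False))"

definition dcbm_pmf :: "nat \<Rightarrow> (nat \<Rightarrow> nat) \<Rightarrow> (nat \<Rightarrow> real) \<Rightarrow> (nat \<Rightarrow> nat \<Rightarrow> real)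
    \<Rightarrow> (nat \<Rightarrow> nat \<Rightarrow> bool) pmf" where
  "dcbm_pmf n \<theta> \<psi> B = map_pmf (sym_of n)
     (Pi_pmf (pairs n) False (\<lambda>(i,j). bernoulli_pmf (\<psi> i * \<psi> j * B (\<theta> i) (\<theta> j))))"

definition edge_flip :: "nat \<Rightarrow> ereal \<Rightarrow> (nat \<Rightarrow> nat \<Rightarrow> bool) \<Rightarrow> (nat \<Rightarrow> nat \<Rightarrow> bool) pmf" where
  "edge_flip n \<epsilon> Y = (if \<epsilon> = \<infinity> then return_pmf Y else
     map_pmf (\<lambda>F. sym_of n (\<lambda>(i,j). Y i j \<noteq> F (i,j)))
       (Pi_pmf (pairs n) False (\<lambda>_. bernoulli_pmf (1 / (1 + exp (real_of_ereal \<epsilon>))))))"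

definition maxB :: "nat \<Rightarrow> (nat \<Rightarrow> nat \<Rightarrow> real) \<Rightarrow> real" where
  "maxB k B = Max {B a b | a b. a \<in> {1..k} \<and> b \<in> {1..k}}"

definition g_eps :: "ereal \<Rightarrow> nat \<Rightarrow> (nat \<Rightarrow> nat \<Rightarrow> real) \<Rightarrow> real" where
  "g_eps \<epsilon> k B = (if \<epsilon> = \<infinity> then maxB k B else
     (let e = exp (real_of_ereal \<epsilon>) in (e + 1) / (e - 1) * (maxB k B + 1 / (e - 1))))"

definition comm :: "nat \<Rightarrow> (nat \<Rightarrow> nat) \<Rightarrow> nat \<Rightarrow> nat set" where
  "comm n \<theta> j = {i. i < n \<and> \<theta> i = j}"

definition n_j :: "nat \<Rightarrow> (nat \<Rightarrow> nat) \<Rightarrow> nat \<Rightarrow> nat" where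
  "n_j n \<theta> j = card (comm n \<theta> j)"

definition n_min :: "nat \<Rightarrow> nat \<Rightarrow> (nat \<Rightarrow> nat) \<Rightarrow> nat" where
  "n_min n k \<theta> = Min (n_j n \<theta> ` {1..k})"

definition nt_j :: "nat \<Rightarrow> (nat \<Rightarrow> nat) \<Rightarrow> (nat \<Rightarrow> real) \<Rightarrow> nat \<Rightarrow> real" where
  "nt_j n \<theta> \<psi> j = (\<Sum>i\<in>comm n \<theta> j. (\<psi> i)\<^sup>2)"

definition nt_min :: "nat \<Rightarrow> nat \<Rightarrow> (nat \<Rightarrow> nat) \<Rightarrow> (nat \<Rightarrow> real) \<Rightarrow> real" where
  "nt_min n k \<theta> \<psi> = Min (nt_j n \<theta> \<psi> ` {1..k})"

definition nu_j :: "nat \<Rightarrow> (nat \<Rightarrow> nat) \<Rightarrow> (nat \<Rightarrow> real) \<Rightarrow> nat \<Rightarrow> real" where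
  "nu_j n \<theta> \<psi> j = (\<Sum>i\<in>comm n \<theta> j. 1 / (\<psi> i)\<^sup>2) * (\<Sum>i\<in>comm n \<theta> j. (\<psi> i)\<^sup>2)
      / (real (n_j n \<theta> j))\<^sup>2"

definition eigenvalue_on :: "nat set \<Rightarrow> (nat \<Rightarrow> nat \<Rightarrow> real) \<Rightarrow> real \<Rightarrow> bool" where
  "eigenvalue_on I M lam = (\<exists>v. (\<exists>i\<in>I. v i \<noteq> 0) \<and> (\<forall>i\<in>I. (\<Sum>j\<in>I. M i j * v j) = lam * v i))"

definition full_rank_on :: "nat set \<Rightarrow> (nat \<Rightarrow> nat \<Rightarrow> real) \<Rightarrow> bool" where
  "full_rank_on I M = (\<forall>v. (\<forall>i\<in>I. (\<Sum>j\<in>I. M i j * v j) = 0) \<longrightarrow> (\<forall>i\<in>I. v i = 0))"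

definition lambda_B :: "nat \<Rightarrow> (nat \<Rightarrow> nat \<Rightarrow> real) \<Rightarrow> real" where
  "lambda_B k B = Min {\<bar>lam\<bar> | lam. eigenvalue_on {1..k} B lam}"

definition vnorm :: "nat \<Rightarrow> (nat \<Rightarrow> real) \<Rightarrow> real" where
  "vnorm k x = sqrt (\<Sum>c\<in>{1..k}. (x c)\<^sup>2)"

text \<open>U (rows 0..<n, columns 1..k) has as columns orthonormal eigenvectors of M for its k largest
  eigenvalues in absolute value (counted with multiplicity): every eigenvector of M orthogonal to
  all columns has an eigenvalue of absolute value at most those of the chosen ones.\<close>
definition top_k_eigvecs :: "nat \<Rightarrow> nat \<Rightarrow> (nat \<Rightarrow> nat \<Rightarrow> real) \<Rightarrow> (nat \<Rightarrow> nat \<Rightarrow> real) \<Rightarrow> bool" where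
  "top_k_eigvecs n k M U = (\<exists>\<mu>::nat \<Rightarrow> real.
     (\<forall>c\<in>{1..k}. \<forall>c'\<in>{1..k}. (\<Sum>i<n. U i c * U i c') = (if c = c' then 1 else 0)) \<and>
     (\<forall>c\<in>{1..k}. \<forall>i<n. (\<Sum>j<n. M i j * U j c) = \<mu> c * U i c) \<and>
     (\<forall>lam v. (\<exists>i<n. v i \<noteq> 0) \<and> (\<forall>i<n. (\<Sum>j<n. M i j * v j) = lam * v i) \<and>
            (\<forall>c\<in>{1..k}. (\<Sum>i<n. v i * U i c) = 0)
            \<longrightarrow> (\<forall>c\<in>{1..k}. \<bar>lam\<bar> \<le> \<bar>\<mu> c\<bar>)))"

definition kmed_cost :: "nat \<Rightarrow> nat set \<Rightarrow> (nat \<Rightarrow> nat \<Rightarrow> real) \<Rightarrow> (nat \<Rightarrow> nat) \<Rightarrow> (nat \<Rightarrow> nat \<Rightarrow> real) \<Rightarrow> real" where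
  "kmed_cost k I V l X = (\<Sum>i\<in>I. vnorm k (\<lambda>c. X (l i) c - V i c))"

definition approx_kmedians :: "nat \<Rightarrow> real \<Rightarrow> nat set \<Rightarrow> (nat \<Rightarrow> nat \<Rightarrow> real) \<Rightarrow> (nat \<Rightarrow> nat) \<Rightarrow> bool" where
  "approx_kmedians k \<gamma> I V l = ((\<forall>i\<in>I. l i \<in> {1..k}) \<and>
     (\<exists>X. kmed_cost k I V l X \<le> (1 + \<gamma>) *
        Inf {kmed_cost k I V l' X' | l' X'. \<forall>i\<in>I. l' i \<in> {1..k}}))"

definition algB_output :: "nat \<Rightarrow> nat \<Rightarrow> real \<Rightarrow> ereal \<Rightarrow> (nat \<Rightarrow> nat \<Rightarrow> bool) \<Rightarrow> (nat \<Rightarrow> nat) \<Rightarrow> bool" where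
  "algB_output n k \<gamma> \<epsilon> A \<theta>h = (\<exists>U l.
     (let Ad = (\<lambda>i j. (if A i j then 1 else 0) -
                  (if \<epsilon> = \<infinity> then 0 else (if i = j then 0 else 1 / (exp (real_of_ereal \<epsilon>) + 1))));
          Ip = {i. i < n \<and> vnorm k (\<lambda>c. U i c) > 0};
          V = (\<lambda>i c. U i c / vnorm k (\<lambda>c'. U i c'))
      in top_k_eigvecs n k Ad U \<and> approx_kmedians k \<gamma> Ip V l \<and>
         (\<forall>i<n. \<theta>h i = (if i \<in> Ip then l i else 1))))"

definition misclass :: "nat \<Rightarrow> nat \<Rightarrow> (nat \<Rightarrow> nat) \<Rightarrow> (nat \<Rightarrow> nat) \<Rightarrow> real" where
  "misclass n k \<theta> \<theta>h = Min ((\<lambda>\<sigma>. real (card {i. i < n \<and> \<sigma> (\<theta>h i) \<noteq> \<theta> i}) / real n)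
       ` {\<sigma>. \<sigma> permutes {1..k}})"

end

theory Submission
  imports Defs
begin

text \<open>
  Flipping the edges of a DCBM with probability \<open>f = 1 / (1 + e\<^sup>\<epsilon>)\<close> gives again a graph with independent
  edges, and the debiased matrix has mean \<open>\<tau> P\<close> off the diagonal, where \<open>\<tau> = 1 - 2 f\<close> and
  \<open>P i j = \<psi> i * \<psi> j * B (\<theta> i) (\<theta> j)\<close> has rank \<open>k\<close>. The edge probabilities are at most
  \<open>q = \<tau>\<^sup>2 g\<^sub>\<epsilon>(B)\<close>, and \<open>q \<ge> ln n / (2 n)\<close>.

  The fluctuations have operator norm \<open>O(\<surd>(n q))\<close> without logarithmic loss (the argument of Feige and
  Ofek): on a lattice net of the unit ball the pairs with \<open>\<bar>x\<^sub>i x\<^sub>j\<bar> \<le> \<surd>(n q) / n\<close> are controlled by a Chernoff bound,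
  and the remaining pairs by the discrepancy of edge counts between dyadic level sets of \<open>x\<close>.

  Since the nonzero singular values of \<open>P\<close> are at least \<open>nt_min * lambda_B\<close>, the leading eigenvectors
  almost span the space of the normalised community vectors, so after normalisation the rows of the embedding
  are, on average, close to \<open>k\<close> unit vectors which are pairwise at distance at least 1. Every node
  misclassified by the approximate \<open>k\<close>-medians solution has a row at distance at least 1/2
  from the right one or a zero row, and both contribute to the total deviation.
\<close>

section \<open>Symmetric matrices on finite index sets\<close>

text \<open>The factor \<open>\<tau>\<close> cancels: the spectral gap of the debiased mean is
  \<open>\<tau> * nt_min * lambda_B\<close> and the noise is of order
  \<open>sqrt (n * q) = \<tau> * sqrt (n * g)\<close>, so privacy enters the ratio only through
  \<open>g_eps\<close>. The lower bound on \<open>maxB\<close> keeps all degrees of order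
  \<open>n * q\<close> with high probability; this is why no high-degree node has to be trimmed
  before the spectral step. Eigenvectors and k-medians solutions are not unique, and the claim
  concerns every admissible output. Randomness is therefore confined to one event, an operator norm
  bound simultaneous in all vectors; everything after it is deterministic. No full
  eigendecomposition is formed: an extremal eigenvector on an invariant subspace, found by
  compactness, is enough, and the rotation that usually aligns two bases is replaced by the matrix
  of their inner products. The graph has no loops while the rank-\<open>k\<close> signal has a
  nonzero diagonal; that diagonal is treated as additional noise.\<close>

definition inner_on :: "'a set \<Rightarrow> ('a \<Rightarrow> real) \<Rightarrow> ('a \<Rightarrow> real) \<Rightarrow> real" where
  "inner_on I x y = (\<Sum>i\<in>I. x i * y i)"

definition app_on :: "'a set \<Rightarrow> ('a \<Rightarrow> 'a \<Rightarrow> real) \<Rightarrow> ('a \<Rightarrow> real) \<Rightarrow> 'a \<Rightarrow> real" where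
  "app_on I M x = (\<lambda>i. \<Sum>j\<in>I. M i j * x j)"

abbreviation quad_form :: "'a set \<Rightarrow> ('a \<Rightarrow> 'a \<Rightarrow> real) \<Rightarrow> ('a \<Rightarrow> real) \<Rightarrow> real" where
  "quad_form I M x \<equiv> inner_on I x (app_on I M x)"

abbreviation orth_to :: "'a set \<Rightarrow> 'b set \<Rightarrow> ('b \<Rightarrow> 'a \<Rightarrow> real) \<Rightarrow> ('a \<Rightarrow> real) \<Rightarrow> bool" where
  "orth_to I J U x \<equiv> (\<forall>c\<in>J. inner_on I x (U c) = 0)"

abbreviation orthonormal_on :: "'a set \<Rightarrow> 'b set \<Rightarrow> ('b \<Rightarrow> 'a \<Rightarrow> real) \<Rightarrow> bool" where
  "orthonormal_on I J U \<equiv> (\<forall>c\<in>J. \<forall>c'\<in>J. inner_on I (U c) (U c') = (if c = c' then 1 else 0))"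

lemma inner_on_commute: "inner_on I x y = inner_on I y x"
  by (simp add: inner_on_def mult.commute)

lemma inner_on_add_left: "inner_on I (\<lambda>i. x i + y i) z = inner_on I x z + inner_on I y z"
  by (simp add: inner_on_def sum.distrib algebra_simps)

lemma inner_on_diff_left: "inner_on I (\<lambda>i. x i - y i) z = inner_on I x z - inner_on I y z"
  by (simp add: inner_on_def sum_subtractf algebra_simps)

lemma inner_on_scale_left: "inner_on I (\<lambda>i. a * x i) z = a * inner_on I x z"
  by (simp add: inner_on_def sum_distrib_left algebra_simps)

lemma inner_on_sum_left:
  "inner_on I (\<lambda>i. \<Sum>c\<in>J. a c * x c i) z = (\<Sum>c\<in>J. a c * inner_on I (x c) z)"
  unfolding inner_on_def
  by (subst sum_distrib_right, subst sum.swap)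
    (simp add: sum_distrib_left mult.assoc)

lemma inner_on_add_right: "inner_on I z (\<lambda>i. x i + y i) = inner_on I z x + inner_on I z y"
  by (simp add: inner_on_commute[of I z] inner_on_add_left)

lemma inner_on_diff_right: "inner_on I z (\<lambda>i. x i - y i) = inner_on I z x - inner_on I z y"
  by (simp add: inner_on_commute[of I z] inner_on_diff_left)

lemma inner_on_scale_right: "inner_on I z (\<lambda>i. a * x i) = a * inner_on I z x"
  by (simp add: inner_on_commute[of I z] inner_on_scale_left)

lemma inner_on_sum_right:
  "inner_on I z (\<lambda>i. \<Sum>c\<in>J. a c * x c i) = (\<Sum>c\<in>J. a c * inner_on I z (x c))"
  by (simp add: inner_on_commute[of I z] inner_on_sum_left)

lemmas inner_on_linear =
  inner_on_add_left inner_on_add_right inner_on_diff_left inner_on_diff_right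
  inner_on_scale_left inner_on_scale_right

lemma inner_on_cong:
  "(\<And>i. i \<in> I \<Longrightarrow> x i = x' i) \<Longrightarrow> (\<And>i. i \<in> I \<Longrightarrow> y i = y' i) \<Longrightarrow> inner_on I x y = inner_on I x' y'"
  by (simp add: inner_on_def)

lemma inner_on_self_nonneg [simp]: "0 \<le> inner_on I x x"
  by (simp add: inner_on_def sum_nonneg)

lemma inner_on_self_eq_0:
  "finite I \<Longrightarrow> inner_on I x x = 0 \<longleftrightarrow> (\<forall>i\<in>I. x i = 0)"
  by (simp add: inner_on_def sum_nonneg_eq_0_iff)

lemma inner_on_self_pos:
  assumes "finite I" "\<exists>i\<in>I. x i \<noteq> 0"
  shows "inner_on I x x > 0"
  using assms inner_on_self_nonneg[of I x] inner_on_self_eq_0[of I x] by (metis less_le)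

lemma square_le_inner_on:
  assumes "finite I" "i \<in> I"
  shows "(x i)\<^sup>2 \<le> inner_on I x x"
  unfolding inner_on_def power2_eq_square
  by (rule member_le_sum[where f="\<lambda>i. x i * x i"]) (use assms in auto)

lemma L2_set_eq_inner_on: "L2_set x I = sqrt (inner_on I x x)"
  by (simp add: L2_set_def inner_on_def power2_eq_square)

lemma L2_set_sq: "(L2_set x I)\<^sup>2 = inner_on I x x"
  by (simp add: L2_set_eq_inner_on)

lemma abs_inner_on_le: "\<bar>inner_on I x y\<bar> \<le> L2_set x I * L2_set y I"
proof -
  have "\<bar>inner_on I x y\<bar> \<le> (\<Sum>i\<in>I. \<bar>x i\<bar> * \<bar>y i\<bar>)"
    unfolding inner_on_def abs_mult[symmetric] by (rule sum_abs)
  also have "\<dots> \<le> L2_set x I * L2_set y I" by (rule L2_set_mult_ineq)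
  finally show ?thesis .
qed

lemma app_on_add: "app_on I M (\<lambda>i. x i + y i) = (\<lambda>i. app_on I M x i + app_on I M y i)"
  by (simp add: app_on_def sum.distrib algebra_simps)

lemma app_on_diff: "app_on I M (\<lambda>i. x i - y i) = (\<lambda>i. app_on I M x i - app_on I M y i)"
  by (simp add: app_on_def sum_subtractf algebra_simps)

lemma app_on_scale: "app_on I M (\<lambda>i. a * x i) = (\<lambda>i. a * app_on I M x i)"
  by (simp add: app_on_def sum_distrib_left algebra_simps)

lemma app_on_sum:
  "app_on I M (\<lambda>i. \<Sum>c\<in>J. a c * x c i) = (\<lambda>i. \<Sum>c\<in>J. a c * app_on I M (x c) i)"
  unfolding app_on_def
  by (rule ext, subst sum_distrib_left, subst sum.swap) (simp add: sum_distrib_left algebra_simps)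

lemma app_on_cong: "(\<And>i. i \<in> I \<Longrightarrow> x i = y i) \<Longrightarrow> app_on I M x = app_on I M y"
  by (simp add: app_on_def)

lemma inner_on_app_on_swap:
  assumes "\<forall>i\<in>I. \<forall>j\<in>I. M i j = M j i"
  shows "inner_on I (app_on I M x) y = inner_on I x (app_on I M y)"
proof -
  have "inner_on I (app_on I M x) y = (\<Sum>i\<in>I. \<Sum>j\<in>I. M i j * x j * y i)"
    by (simp add: inner_on_def app_on_def sum_distrib_right)
  also have "\<dots> = (\<Sum>j\<in>I. \<Sum>i\<in>I. M i j * x j * y i)" by (rule sum.swap)
  also have "\<dots> = inner_on I x (app_on I M y)"
    unfolding inner_on_def app_on_def sum_distrib_left
    by (intro sum.cong refl) (use assms in \<open>simp add: algebra_simps\<close>)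
  finally show ?thesis .
qed

text \<open>Compactness of the unit sphere in the subspace orthogonal to \<open>U\<close>, then
  homogeneity to remove the normalisation. The hypothesis \<open>ex\<close> says that this sphere is
  nonempty. Every eigenvector that has to be constructed later comes from this maximiser.\<close>

lemma quadratic_form_attains_max:
  fixes S :: "'a \<Rightarrow> 'a \<Rightarrow> real"
  assumes fin: "finite I"
    and ex: "\<exists>x. (\<exists>i\<in>I. x i \<noteq> 0) \<and> orth_to I J U x"
  shows "\<exists>x. inner_on I x x = 1 \<and> orth_to I J U x \<and>
    (\<forall>y. orth_to I J U y \<longrightarrow>
       quad_form I S y \<le> quad_form I S x * inner_on I y y)"
proof -
  \<comment> \<open>Vectors are functions on the whole type, so compactness is taken in the product
    topology (Tychonoff); coordinates outside \<open>I\<close> are pinned to 0.\<close>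
  define box where "box = PiE UNIV (\<lambda>i::'a. if i \<in> I then {-1..1} else {0::real})"
  have "compactin (product_topology (\<lambda>i::'a. euclidean) UNIV) box"
    unfolding box_def by (auto simp: compactin_PiE)
  hence cbox: "compact box"
    by (simp add: euclidean_product_topology flip: compactin_euclidean_iff)
  define K where "K = box \<inter> ({x. inner_on I x x = 1} \<inter> (\<Inter>c\<in>J. {x. inner_on I x (U c) = 0}))"
  have "closed ({x. inner_on I x x = 1} \<inter> (\<Inter>c\<in>J. {x. inner_on I x (U c) = 0}))"
    unfolding inner_on_def
    by (intro closed_Int closed_INT ballI closed_Collect_eq continuous_intros
        continuous_on_product_coordinates)
  hence cK: "compact K" unfolding K_def using cbox by blast
  have norm_in: "(\<lambda>i. if i \<in> I then y i / sqrt (inner_on I y y) else 0) \<in> K"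
    if y: "\<exists>i\<in>I. y i \<noteq> 0" "orth_to I J U y" for y
  proof -
    let ?a = "1 / sqrt (inner_on I y y)"
    let ?z = "\<lambda>i. if i \<in> I then y i / sqrt (inner_on I y y) else 0"
    have p: "inner_on I y y > 0"
      using y(1) by (rule inner_on_self_pos[OF fin])
    have 1: "inner_on I ?z ?z = inner_on I (\<lambda>i. ?a * y i) (\<lambda>i. ?a * y i)"
      by (intro inner_on_cong) auto
    also have "\<dots> = ?a * ?a * inner_on I y y"
      by (simp only: inner_on_scale_left inner_on_scale_right mult.assoc)
    also have "\<dots> = 1" using p by (simp add: power2_eq_square[symmetric] power_divide)
    finally have n1: "inner_on I ?z ?z = 1" .
    have 2: "inner_on I ?z (U c) = 0" if "c \<in> J" for c
    proof -
      have "inner_on I ?z (U c) = inner_on I (\<lambda>i. ?a * y i) (U c)"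
        by (intro inner_on_cong) auto
      also have "\<dots> = ?a * inner_on I y (U c)" by (rule inner_on_scale_left)
      finally show ?thesis using y(2) that by simp
    qed
    have "\<bar>?z i\<bar> \<le> 1" if "i \<in> I" for i
    proof -
      have "(?z i)\<^sup>2 \<le> inner_on I ?z ?z"
        by (rule square_le_inner_on[OF fin that])
      thus ?thesis using n1 by (metis abs_le_square_iff abs_one one_power2)
    qed
    hence "?z i \<in> (if i \<in> I then {-1..1} else {0})" for i
      by (cases "i \<in> I") (simp_all only: if_True if_False atLeastAtMost_iff abs_le_iff, auto)
    hence "?z \<in> box" unfolding box_def by blast
    thus ?thesis unfolding K_def using n1 2 by auto
  qed
  have ne: "K \<noteq> {}" using ex norm_in by blast
  have "continuous_on K (\<lambda>x. quad_form I S x)"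
    unfolding inner_on_def app_on_def
    by (intro continuous_intros continuous_on_subset[OF continuous_on_product_coordinates]) auto
  from continuous_attains_sup[OF cK ne this] obtain x where
    x: "x \<in> K" and mx: "\<And>y. y \<in> K \<Longrightarrow> quad_form I S y \<le> quad_form I S x"
    by blast
  have "quad_form I S y \<le> quad_form I S x * inner_on I y y"
    if y: "orth_to I J U y" for y
  proof (cases "\<exists>i\<in>I. y i \<noteq> 0")
    case False
    thus ?thesis by (simp add: inner_on_def)
  next
    case True
    let ?a = "1 / sqrt (inner_on I y y)"
    let ?z = "\<lambda>i. if i \<in> I then y i / sqrt (inner_on I y y) else 0"
    have p: "inner_on I y y > 0"
      using True by (rule inner_on_self_pos[OF fin])
    have e: "app_on I S ?z = app_on I S (\<lambda>i. ?a * y i)" by (intro app_on_cong) auto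
    have "inner_on I ?z (app_on I S ?z) = quad_form I S (\<lambda>i. ?a * y i)"
      unfolding e by (intro inner_on_cong) auto
    also have "\<dots> = (?a * ?a) * quad_form I S y"
      by (simp only: inner_on_scale_left inner_on_scale_right app_on_scale mult.assoc)
    also have "?a * ?a = 1 / inner_on I y y" using p by simp
    finally have "quad_form I S y = inner_on I ?z (app_on I S ?z) * inner_on I y y"
      using p by (simp add: field_simps)
    also have "\<dots> \<le> quad_form I S x * inner_on I y y"
      using mx[OF norm_in[OF True y]] p by (intro mult_right_mono) auto
    finally show ?thesis .
  qed
  thus ?thesis using x unfolding K_def by auto
qed

text \<open>One argument serves both ends of the spectrum: \<open>s = 1\<close> gives the eigenvalue
  of largest modulus on the subspace, \<open>s = -1\<close> the one of smallest modulus. Working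
  with \<open>s\<close> times the square of \<open>M\<close> makes the modulus visible to a
  quadratic form; the maximiser is an eigenvector of the square, and factoring the square turns it
  into one of \<open>M\<close>.\<close>

lemma symmetric_extremal_eigenvector:
  fixes M :: "'a \<Rightarrow> 'a \<Rightarrow> real"
  assumes fin: "finite I" and sym: "\<forall>i\<in>I. \<forall>j\<in>I. M i j = M j i"
    and ex: "\<exists>x. (\<exists>i\<in>I. x i \<noteq> 0) \<and> orth_to I J U x"
    and inv': "\<forall>x. orth_to I J U x \<longrightarrow> orth_to I J U (app_on I M x)"
    and s: "s = 1 \<or> s = (-1::real)"
  shows "\<exists>lam v. (\<exists>i\<in>I. v i \<noteq> 0) \<and> orth_to I J U v \<and>
    (\<forall>i\<in>I. app_on I M v i = lam * v i) \<and>
    (\<forall>y. orth_to I J U y \<longrightarrow>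
       s * inner_on I (app_on I M y) (app_on I M y) \<le> s * (lam\<^sup>2 * inner_on I y y))"
proof -
  have inv: "orth_to I J U (app_on I M x)" if "orth_to I J U x" for x
    using inv' that by blast
  define S where "S = (\<lambda>i j. s * (\<Sum>l\<in>I. M i l * M l j))"
  let ?W = "\<lambda>x. orth_to I J U x"
  have Sapp: "app_on I S x = (\<lambda>i. s * app_on I M (app_on I M x) i)" for x
  proof
    fix i
    have "app_on I S x i = (\<Sum>j\<in>I. \<Sum>l\<in>I. s * (M i l * M l j * x j))"
      by (simp add: app_on_def S_def sum_distrib_left sum_distrib_right mult.assoc)
    also have "\<dots> = (\<Sum>l\<in>I. \<Sum>j\<in>I. s * (M i l * M l j * x j))" by (rule sum.swap)
    also have "\<dots> = s * app_on I M (app_on I M x) i"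
      by (simp add: app_on_def sum_distrib_left mult.assoc)
    finally show "app_on I S x i = s * app_on I M (app_on I M x) i" .
  qed
  have Sq: "inner_on I y (app_on I S x) = s * inner_on I (app_on I M y) (app_on I M x)" for x y
    unfolding Sapp inner_on_scale_right by (simp add: inner_on_app_on_swap[OF sym])
  obtain x where x1: "inner_on I x x = 1" and xW: "?W x"
    and xm: "\<And>y. ?W y \<Longrightarrow>
       quad_form I S y \<le> quad_form I S x * inner_on I y y"
    using quadratic_form_attains_max[OF fin ex, of S] by blast
  define m where "m = quad_form I S x"
  \<comment> \<open>The residual of the eigenvalue equation. It is orthogonal to \<open>x\<close>,
    and a move from \<open>x\<close> in its direction would increase the quotient to first order, so
    it has to vanish.\<close>
  define y where "y = (\<lambda>i. app_on I S x i - m * x i)"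
  have yW: "?W y"
    unfolding y_def Sapp using inv[OF inv[OF xW]] xW by (simp add: inner_on_linear)
  have xy: "inner_on I x y = 0" by (simp add: y_def inner_on_linear m_def[symmetric] x1)
  hence yx: "inner_on I y x = 0" by (simp add: inner_on_commute)
  define a where "a = inner_on I y y"
  have a0: "a \<ge> 0" by (simp add: a_def)
  have ySx: "inner_on I y (app_on I S x) = a"
  proof -
    have "a = inner_on I y (app_on I S x) - m * inner_on I y x"
      unfolding a_def by (subst (2) y_def) (simp add: inner_on_linear)
    thus ?thesis using yx by simp
  qed
  have xSy: "inner_on I x (app_on I S y) = a"
    using ySx by (simp add: Sq inner_on_commute)
  define K where "K = m * a - quad_form I S y"
  have key: "2 * t * a \<le> t\<^sup>2 * K" for t
  proof -
    let ?z = "\<lambda>i. x i + t * y i"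
    have "?W ?z" using xW yW by (simp add: inner_on_linear)
    from xm[OF this] have
      "m + 2 * t * a + t\<^sup>2 * quad_form I S y \<le> m * (1 + t\<^sup>2 * a)"
      by (simp add: inner_on_linear app_on_add app_on_scale m_def[symmetric] x1 xy yx xSy ySx
          a_def[symmetric] power2_eq_square algebra_simps)
    thus ?thesis by (simp add: K_def algebra_simps)
  qed
  have "a = 0"
  proof (rule ccontr)
    assume "a \<noteq> 0"
    hence ap: "a > 0" using a0 by simp
    have kp: "\<bar>K\<bar> + 1 > 0" by simp
    \<comment> \<open>Small enough for the second-order term: \<open>t * K \<le> a\<close>, against
      \<open>2 * a\<close> from the first-order term.\<close>
    define t where "t = a / (\<bar>K\<bar> + 1)"
    have tp: "t > 0" using ap kp by (simp add: t_def)
    have "2 * a \<le> t * K" using key[of t] tp by (simp add: power2_eq_square)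
    also have "t * K \<le> t * (\<bar>K\<bar> + 1)" using tp by (intro mult_left_mono) auto
    also have "\<dots> = a" using kp by (simp add: t_def)
    finally show False using ap by simp
  qed
  hence Sx: "\<forall>i\<in>I. app_on I S x i = m * x i"
    using inner_on_self_eq_0[OF fin, of y] by (simp add: a_def y_def)
  define \<rho> where "\<rho> = sqrt (inner_on I (app_on I M x) (app_on I M x))"
  have r2: "\<rho>\<^sup>2 = inner_on I (app_on I M x) (app_on I M x)" by (simp add: \<rho>_def)
  have m: "m = s * \<rho>\<^sup>2" by (simp add: m_def Sq r2)
  have MM: "\<forall>i\<in>I. app_on I M (app_on I M x) i = \<rho>\<^sup>2 * x i"
    using Sx s by (auto simp: Sapp m)
  have bnd: "s * inner_on I (app_on I M y) (app_on I M y) \<le> s * (\<rho>\<^sup>2 * inner_on I y y)" if "?W y" for y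
    using xm[OF that] by (simp add: Sq r2 mult.assoc)
  \<comment> \<open>The product of \<open>M - \<rho>\<close> and \<open>M + \<rho>\<close>
    annihilates \<open>x\<close>. Either \<open>z\<close>, the image of \<open>x\<close> under
    \<open>M + \<rho>\<close>, is an eigenvector for \<open>\<rho>\<close>, or it vanishes and
    \<open>x\<close> itself is one for \<open>-\<rho>\<close>.\<close>
  define z where "z = (\<lambda>i. app_on I M x i + \<rho> * x i)"
  show ?thesis
  proof (cases "\<exists>i\<in>I. z i \<noteq> 0")
    case True
    have "?W z" unfolding z_def using inv[OF xW] xW by (simp add: inner_on_linear)
    moreover have "\<forall>i\<in>I. app_on I M z i = \<rho> * z i"
      using MM by (simp add: z_def app_on_add app_on_scale power2_eq_square algebra_simps)
    ultimately show ?thesis using True bnd by (intro exI[of _ \<rho>] exI[of _ z]) blast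
  next
    case False
    have "\<exists>i\<in>I. x i \<noteq> 0" using x1 inner_on_self_eq_0[OF fin, of x] by force
    moreover have "\<forall>i\<in>I. app_on I M x i = (-\<rho>) * x i" using False by (auto simp: z_def)
    moreover have "\<forall>y. ?W y \<longrightarrow> s * inner_on I (app_on I M y) (app_on I M y) \<le> s * ((-\<rho>)\<^sup>2 * inner_on I y y)"
      using bnd by simp
    ultimately show ?thesis using xW by (intro exI[of _ "-\<rho>"] exI[of _ x]) blast
  qed
qed

text \<open>Gaussian elimination, one row per induction step: a row vanishing on \<open>K\<close> is
  dropped; otherwise an unknown \<open>c0\<close> with nonzero pivot is eliminated from the
  remaining rows and recovered by back substitution.\<close>

lemma underdetermined_system_has_solution:
  fixes M :: "'b \<Rightarrow> 'a \<Rightarrow> real"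
  assumes "finite J" "finite K" "card J < card K"
  shows "\<exists>x. (\<exists>c\<in>K. x c \<noteq> 0) \<and> (\<forall>j\<in>J. (\<Sum>c\<in>K. M j c * x c) = 0)"
  using assms
proof (induction J arbitrary: K M rule: finite_induct)
  case empty
  then obtain c where "c \<in> K" by fastforce
  thus ?case by (intro exI[of _ "\<lambda>_. 1"]) auto
next
  case (insert j J)
  show ?case
  proof (cases "\<forall>c\<in>K. M j c = 0")
    case True
    have "card J < card K" using insert by simp
    from insert.IH[OF insert.prems(1) this, of M] show ?thesis using True by auto
  next
    case False
    then obtain c0 where c0: "c0 \<in> K" "M j c0 \<noteq> 0" by blast
    let ?K = "K - {c0}"
    have "card J < card ?K" using insert c0 by (simp add: card_Diff_singleton)
    from insert.IH[OF _ this, of "\<lambda>j' c. M j' c - M j' c0 * M j c / M j c0"] insert.prems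
    obtain x where x: "\<exists>c\<in>?K. x c \<noteq> 0"
      and eq: "\<forall>j'\<in>J. (\<Sum>c\<in>?K. (M j' c - M j' c0 * M j c / M j c0) * x c) = 0" by auto
    define y where "y = x(c0 := - (\<Sum>c\<in>?K. M j c * x c) / M j c0)"
    have sy: "(\<Sum>c\<in>K. f c * y c) = f c0 * y c0 + (\<Sum>c\<in>?K. f c * x c)" for f
    proof -
      have "(\<Sum>c\<in>K. f c * y c) = f c0 * y c0 + (\<Sum>c\<in>?K. f c * y c)"
        using c0 insert.prems by (simp add: sum.remove)
      also have "(\<Sum>c\<in>?K. f c * y c) = (\<Sum>c\<in>?K. f c * x c)"
        by (intro sum.cong) (auto simp: y_def)
      finally show ?thesis .
    qed
    have "\<exists>c\<in>K. y c \<noteq> 0" using x by (auto simp: y_def)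
    moreover have "(\<Sum>c\<in>K. M j c * y c) = 0"
      unfolding sy using c0 by (simp add: y_def)
    moreover have "(\<Sum>c\<in>K. M j' c * y c) = 0" if "j' \<in> J" for j'
    proof -
      have "(\<Sum>c\<in>?K. M j' c * x c) - M j' c0 / M j c0 * (\<Sum>c\<in>?K. M j c * x c) = 0"
        using eq that by (simp add: left_diff_distrib sum_subtractf sum_distrib_left mult.assoc)
      thus ?thesis unfolding sy by (simp add: y_def)
    qed
    ultimately show ?thesis by (intro exI[of _ y]) auto
  qed
qed

section \<open>Spectral subspaces\<close>

text \<open>\<open>lambda_B\<close> is a \<open>Min\<close> and so needs a finite set. Eigenvectors
  for distinct eigenvalues are orthogonal, whereas \<open>card I + 1\<close> vectors on
  \<open>I\<close> always satisfy a nontrivial linear relation.\<close>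

lemma finite_eigenvalues_on:
  assumes fin: "finite I" and sym: "\<forall>i\<in>I. \<forall>j\<in>I. M i j = M j i"
  shows "finite {lam. eigenvalue_on I M lam}"
proof (rule ccontr)
  assume "infinite {lam. eigenvalue_on I M lam}"
  then obtain E where E: "E \<subseteq> {lam. eigenvalue_on I M lam}" "finite E" "card E = Suc (card I)"
    by (meson infinite_arbitrarily_large)
  have "\<forall>lam\<in>E. \<exists>v. (\<exists>i\<in>I. v i \<noteq> 0) \<and> (\<forall>i\<in>I. app_on I M v i = lam * v i)"
    using E(1) by (auto simp: eigenvalue_on_def app_on_def)
  then obtain v where v: "\<And>lam. lam \<in> E \<Longrightarrow> \<exists>i\<in>I. v lam i \<noteq> 0"
    and ev: "\<And>lam i. lam \<in> E \<Longrightarrow> i \<in> I \<Longrightarrow> app_on I M (v lam) i = lam * v lam i"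
    by metis
  have orth: "inner_on I (v a) (v b) = 0" if ab: "a \<in> E" "b \<in> E" "a \<noteq> b" for a b
  proof -
    have "inner_on I (app_on I M (v a)) (v b) = a * inner_on I (v a) (v b)"
      using ev[OF ab(1)] by (simp add: inner_on_def sum_distrib_left mult.assoc)
    moreover have "inner_on I (v a) (app_on I M (v b)) = b * inner_on I (v a) (v b)"
      using ev[OF ab(2)] by (simp add: inner_on_def sum_distrib_left mult.left_commute)
    ultimately show ?thesis using ab(3) inner_on_app_on_swap[OF sym, of "v a" "v b"] by simp
  qed
  obtain x where x: "\<exists>c\<in>E. x c \<noteq> 0" and x0: "\<forall>i\<in>I. (\<Sum>c\<in>E. v c i * x c) = 0"
    using underdetermined_system_has_solution[OF fin E(2), of "\<lambda>i c. v c i"] E(3) by auto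
  obtain c where c: "c \<in> E" "x c \<noteq> 0" using x by blast
  have "0 = inner_on I (\<lambda>i. \<Sum>b\<in>E. x b * v b i) (v c)"
    using x0 by (simp add: inner_on_def mult.commute)
  also have "\<dots> = (\<Sum>b\<in>E. x b * inner_on I (v b) (v c))" by (rule inner_on_sum_left)
  also have "\<dots> = (\<Sum>b\<in>E. if b = c then x c * inner_on I (v c) (v c) else 0)"
    using orth c(1) by (intro sum.cong) auto
  also have "\<dots> = x c * inner_on I (v c) (v c)" using E(2) c(1) by simp
  finally show False using c inner_on_self_pos[OF fin v[OF c(1)]] by simp
qed

lemma lambda_B_le_abs_eigenvalue:
  assumes "\<forall>a\<in>{1..k}. \<forall>b\<in>{1..k}. B a b = B b a" "eigenvalue_on {1..k} B lam"
  shows "lambda_B k B \<le> \<bar>lam\<bar>"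
proof -
  have "{\<bar>lam\<bar> | lam. eigenvalue_on {1..k} B lam} = abs ` {lam. eigenvalue_on {1..k} B lam}"
    by auto
  thus ?thesis unfolding lambda_B_def
    using finite_eigenvalues_on[OF _ assms(1)] assms(2) by (intro Min_le) auto
qed

text \<open>Without orthogonality constraints and with \<open>s = -1\<close>, the smallest expansion
  factor of \<open>B\<close> is the modulus of a genuine eigenvalue, hence at least
  \<open>lambda_B\<close>.\<close>

lemma lambda_B_lower_bound:
  assumes sym: "\<forall>a\<in>{1..k}. \<forall>b\<in>{1..k}. B a b = B b a" and l0: "lambda_B k B \<ge> 0"
  shows "(lambda_B k B)\<^sup>2 * inner_on {1..k} y y \<le> inner_on {1..k} (app_on {1..k} B y) (app_on {1..k} B y)"
proof (cases "\<exists>i\<in>{1..k}. y i \<noteq> 0")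
  case False
  hence "inner_on {1..k} y y = 0" by (simp add: inner_on_self_eq_0)
  thus ?thesis by (simp only: mult_zero_right inner_on_self_nonneg)
next
  case True
  obtain lam v where v: "\<exists>i\<in>{1..k}. v i \<noteq> 0" "\<forall>i\<in>{1..k}. app_on {1..k} B v i = lam * v i"
    and b: "\<And>y. - 1 * inner_on {1..k} (app_on {1..k} B y) (app_on {1..k} B y) \<le> - 1 * (lam\<^sup>2 * inner_on {1..k} y y)"
    using symmetric_extremal_eigenvector[where J="{}::nat set" and U="\<lambda>_ _. 0" and s="-1" and I="{1..k}" and M=B,
        OF _ sym] True by (simp only: ball_empty simp_thms finite_atLeastAtMost) blast
  have "lambda_B k B \<le> \<bar>lam\<bar>"
    using v by (intro lambda_B_le_abs_eigenvalue[OF sym]) (auto simp: eigenvalue_on_def app_on_def)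
  hence "(lambda_B k B)\<^sup>2 \<le> lam\<^sup>2" using l0 by (metis power2_abs power_mono)
  hence "(lambda_B k B)\<^sup>2 * inner_on {1..k} y y \<le> lam\<^sup>2 * inner_on {1..k} y y"
    by (intro mult_right_mono) simp_all
  thus ?thesis using b[of y] by linarith
qed

text \<open>On the orthogonal complement of the leading eigenvectors of \<open>M\<close> the matrix has norm at most
  \<open>\<Delta>\<close>: otherwise \<open>k + 1\<close> eigenvectors span a space on which \<open>M\<close> expands by more than \<open>\<Delta>\<close>, and
  this space contains a nonzero vector of the kernel of the rank-\<open>k\<close> matrix \<open>P\<close>.\<close>

lemma complement_expansion_le:
  assumes fin: "finite I" and sym: "\<forall>i\<in>I. \<forall>j\<in>I. M i j = M j i"
    and orth: "orthonormal_on I {1..k} U"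
    and ev: "\<forall>c\<in>{1..k::nat}. \<forall>i\<in>I. app_on I M (U c) i = \<mu> c * U c i"
    and v: "\<exists>i\<in>I. v i \<noteq> 0" "orth_to I {1..k} U v"
      "\<forall>i\<in>I. app_on I M v i = \<rho> * v i" "\<forall>c\<in>{1..k}. \<bar>\<rho>\<bar> \<le> \<bar>\<mu> c\<bar>"
    and ker: "\<And>x. (\<forall>j\<in>{1..k}. inner_on I (u j) x = 0) \<Longrightarrow> \<forall>i\<in>I. app_on I P x i = 0"
    and \<Delta>: "\<And>x. L2_set (\<lambda>i. app_on I M x i - app_on I P x i) I \<le> \<Delta> * L2_set x I"
  shows "\<bar>\<rho>\<bar> \<le> \<Delta>"
proof -
  define b where "b = 1 / sqrt (inner_on I v v)"
  have vv: "inner_on I v v > 0" using inner_on_self_pos[OF fin v(1)] .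
  hence bb: "b * (b * inner_on I v v) = 1" by (simp add: b_def)
  \<comment> \<open>The spare index 0 carries the normalised \<open>v\<close>, which makes
    \<open>k + 1\<close> orthonormal eigenvectors indexed by \<open>0..k\<close>.\<close>
  define z where "z = (\<lambda>c. if c = 0 then (\<lambda>i. b * v i) else U c)"
  define \<nu> where "\<nu> = (\<lambda>c. if c = 0 then \<rho> else \<mu> c)"
  let ?K = "{0..k}"
  have zorth: "inner_on I (z c) (z c') = (if c = c' then 1 else 0)" if "c \<in> ?K" "c' \<in> ?K" for c c'
  proof -
    have vU: "inner_on I (U c) v = 0" if "c \<in> {1..k}" for c
      using v(2) that by (simp add: inner_on_commute)
    have c: "c = 0 \<or> c \<in> {1..k}" "c' = 0 \<or> c' \<in> {1..k}" using that by auto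
    show ?thesis
      using c(1)
    proof
      assume c0: "c = 0"
      from c(2) show ?thesis
      proof
        assume "c' = 0" thus ?thesis using c0 bb by (simp add: z_def inner_on_linear)
      next
        assume "c' \<in> {1..k}" thus ?thesis using c0 v(2) by (auto simp: z_def inner_on_linear)
      qed
    next
      assume c1: "c \<in> {1..k}"
      from c(2) show ?thesis
      proof
        assume "c' = 0" thus ?thesis using c1 vU by (auto simp: z_def inner_on_linear)
      next
        assume "c' \<in> {1..k}" thus ?thesis using c1 orth by (auto simp: z_def)
      qed
    qed
  qed
  have zev: "\<forall>i\<in>I. app_on I M (z c) i = \<nu> c * z c i" if "c \<in> ?K" for c
    using that ev v(3) by (cases "c = 0") (auto simp: z_def \<nu>_def app_on_scale)
  have \<nu>: "\<rho>\<^sup>2 \<le> (\<nu> c)\<^sup>2" if "c \<in> ?K" for c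
    using that v(4) by (auto simp: \<nu>_def abs_le_square_iff[symmetric])
  have gram: "inner_on I (\<lambda>i. \<Sum>c\<in>?K. f c * z c i) (\<lambda>i. \<Sum>c\<in>?K. f c * z c i) = (\<Sum>c\<in>?K. (f c)\<^sup>2)" for f
  proof -
    have "inner_on I (\<lambda>i. \<Sum>c\<in>?K. f c * z c i) (\<lambda>i. \<Sum>c\<in>?K. f c * z c i)
      = (\<Sum>c\<in>?K. f c * (\<Sum>c'\<in>?K. f c' * inner_on I (z c) (z c')))"
      by (simp only: inner_on_sum_left inner_on_sum_right)
    also have "\<dots> = (\<Sum>c\<in>?K. f c * (\<Sum>c'\<in>?K. if c' = c then f c' else 0))"
      by (intro sum.cong refl arg_cong[where f="(*) _"]) (auto simp: zorth)
    also have "\<dots> = (\<Sum>c\<in>?K. (f c)\<^sup>2)" by (simp add: power2_eq_square)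
    finally show ?thesis .
  qed
  \<comment> \<open>\<open>k\<close> linear conditions on \<open>k + 1\<close> coefficients: a
    nonzero combination is orthogonal to every \<open>u j\<close>, and \<open>ker\<close> applies to
    it.\<close>
  obtain a where a: "\<exists>c\<in>?K. a c \<noteq> 0"
    and a0: "\<forall>j\<in>{1..k}. (\<Sum>c\<in>?K. inner_on I (u j) (z c) * a c) = 0"
    using underdetermined_system_has_solution[of "{1..k}" ?K "\<lambda>j c. inner_on I (u j) (z c)"] by auto
  define x where "x = (\<lambda>i. \<Sum>c\<in>?K. a c * z c i)"
  have "\<forall>j\<in>{1..k}. inner_on I (u j) x = 0"
    using a0 by (simp add: x_def inner_on_sum_right mult.commute)
  hence Px: "\<forall>i\<in>I. app_on I P x i = 0" by (rule ker)
  have Mx: "\<forall>i\<in>I. app_on I M x i = (\<Sum>c\<in>?K. (a c * \<nu> c) * z c i)"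
    using zev by (simp add: x_def app_on_sum mult.assoc)
  have A: "(\<Sum>c\<in>?K. (a c)\<^sup>2) > 0"
    using a by (metis (no_types, lifting) finite_atLeastAtMost sum_pos2 zero_le_power2 zero_less_power2)
  have nx: "inner_on I x x = (\<Sum>c\<in>?K. (a c)\<^sup>2)" unfolding x_def by (rule gram)
  have "\<rho>\<^sup>2 * (\<Sum>c\<in>?K. (a c)\<^sup>2) \<le> (\<Sum>c\<in>?K. (a c * \<nu> c)\<^sup>2)"
    unfolding sum_distrib_left power_mult_distrib
    by (intro sum_mono) (metis \<nu> mult.commute mult_right_mono zero_le_power2)
  \<comment> \<open>Since \<open>P\<close> annihilates \<open>x\<close>, the image of
    \<open>x\<close> under \<open>M\<close> is also its image under \<open>M - P\<close>, where
    \<open>\<Delta>\<close> applies. The lower bound before it holds because no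
    \<open>\<nu> c\<close> has smaller modulus than \<open>\<rho>\<close>.\<close>
  also have "\<dots> = (L2_set (\<lambda>i. app_on I M x i - app_on I P x i) I)\<^sup>2"
    unfolding L2_set_sq gram[symmetric] using Mx Px by (intro inner_on_cong) auto
  also have "\<dots> \<le> (\<Delta> * L2_set x I)\<^sup>2" using \<Delta>[of x] by (intro power_mono) auto
  also have "\<dots> = \<Delta>\<^sup>2 * (\<Sum>c\<in>?K. (a c)\<^sup>2)" by (simp add: power_mult_distrib L2_set_sq nx)
  finally have r: "\<rho>\<^sup>2 \<le> \<Delta>\<^sup>2" using A by simp
  have "0 \<le> \<Delta> * L2_set x I" using \<Delta>[of x] L2_set_nonneg order_trans by blast
  moreover have "L2_set x I > 0" using A nx by (simp add: L2_set_eq_inner_on)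
  ultimately have "\<Delta> \<ge> 0" by (simp add: zero_le_mult_iff)
  thus ?thesis using r by (metis abs_le_square_iff abs_of_nonneg)
qed

text \<open>A one-sided sin-theta theorem. The extremal eigenvector of \<open>M\<close> on the
  complement of \<open>U\<close> competes with the chosen eigenvectors, so its eigenvalue is at most
  every \<open>\<bar>\<mu> c\<bar>\<close>, and the previous lemma bounds it by
  \<open>\<Delta>\<close>. Replacing \<open>M\<close> by \<open>P\<close> on \<open>w\<close> costs
  a second \<open>\<Delta>\<close>; the lower bound \<open>gap\<close> for \<open>P\<close> then
  gives the claim.\<close>

lemma davis_kahan_complement:
  assumes top: "top_k_eigvecs n k M U"
    and sym: "\<forall>i<n. \<forall>j<n. M i j = M j i"
    and ker: "\<And>x. (\<forall>j\<in>{1..k}. inner_on {..<n} (u j) x = 0) \<Longrightarrow> \<forall>i\<in>{..<n}. app_on {..<n} P x i = 0"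
    and gap: "\<And>x. g * L2_set (\<lambda>j. inner_on {..<n} (u j) x) {1..k} \<le> L2_set (app_on {..<n} P x) {..<n}"
    and \<Delta>: "\<And>x. L2_set (\<lambda>i. app_on {..<n} M x i - app_on {..<n} P x i) {..<n} \<le> \<Delta> * L2_set x {..<n}"
    and w: "orth_to {..<n} {1..k} (\<lambda>c i. U i c) w"
  shows "g * L2_set (\<lambda>j. inner_on {..<n} (u j) w) {1..k} \<le> 2 * \<Delta> * L2_set w {..<n}"
proof -
  let ?I = "{..<n}"
  have orth: "orthonormal_on ?I {1..k} (\<lambda>c i. U i c)"
    using top unfolding top_k_eigvecs_def inner_on_def by (elim exE conjE)
  have Mw: "L2_set (app_on ?I M w) ?I \<le> \<Delta> * L2_set w ?I"
  proof (cases "\<exists>i<n. w i \<noteq> 0")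
    case False
    hence "L2_set w ?I = 0" "app_on ?I M w = (\<lambda>_. 0)" by (auto simp: L2_set_def app_on_def)
    thus ?thesis by (simp add: L2_set_def)
  next
    case True
    have sym': "\<forall>i\<in>?I. \<forall>j\<in>?I. M i j = M j i" using sym by simp
    obtain \<mu> where
      ev0: "\<forall>c\<in>{1..k}. \<forall>i<n. (\<Sum>j<n. M i j * U j c) = \<mu> c * U i c" and
      mx: "\<forall>lam v. (\<exists>i<n. v i \<noteq> 0) \<and> (\<forall>i<n. (\<Sum>j<n. M i j * v j) = lam * v i) \<and>
              (\<forall>c\<in>{1..k}. (\<Sum>i<n. v i * U i c) = 0) \<longrightarrow> (\<forall>c\<in>{1..k}. \<bar>lam\<bar> \<le> \<bar>\<mu> c\<bar>)"
      using top unfolding top_k_eigvecs_def by (elim exE conjE)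
    have ev: "\<forall>c\<in>{1..k}. \<forall>i\<in>?I. app_on ?I M (\<lambda>i. U i c) i = \<mu> c * U i c"
      using ev0 by (simp add: app_on_def)
    have inv: "\<forall>x. orth_to ?I {1..k} (\<lambda>c i. U i c) x \<longrightarrow>
        orth_to ?I {1..k} (\<lambda>c i. U i c) (app_on ?I M x)"
    proof (intro allI impI ballI)
      fix x c assume x: "orth_to ?I {1..k} (\<lambda>c i. U i c) x" and c: "c \<in> {1..k}"
      have "inner_on ?I (app_on ?I M x) (\<lambda>i. U i c) = inner_on ?I x (app_on ?I M (\<lambda>i. U i c))"
        by (rule inner_on_app_on_swap[OF sym'])
      also have "\<dots> = inner_on ?I x (\<lambda>i. \<mu> c * U i c)"
        by (intro inner_on_cong refl) (use ev c in blast)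
      also have "\<dots> = \<mu> c * inner_on ?I x (\<lambda>i. U i c)" by (rule inner_on_scale_right)
      finally show "inner_on ?I (app_on ?I M x) (\<lambda>i. U i c) = 0" using x c by simp
    qed
    have "\<exists>x. (\<exists>i\<in>?I. x i \<noteq> 0) \<and> orth_to ?I {1..k} (\<lambda>c i. U i c) x"
      using True w by (intro exI[of _ w]) auto
    from symmetric_extremal_eigenvector[where I="?I" and M=M and s=1 and J="{1..k}" and U="\<lambda>c i. U i c",
        OF finite_lessThan sym' this inv disjI1[OF refl]]
    obtain \<rho> v where v0: "\<exists>i\<in>?I. v i \<noteq> 0" "orth_to ?I {1..k} (\<lambda>c i. U i c) v"
      "\<forall>i\<in>?I. app_on ?I M v i = \<rho> * v i"
      and b: "\<forall>y. orth_to ?I {1..k} (\<lambda>c i. U i c) y \<longrightarrow>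
         1 * inner_on ?I (app_on ?I M y) (app_on ?I M y) \<le> 1 * (\<rho>\<^sup>2 * inner_on ?I y y)"
      by (elim exE conjE)
    have r: "inner_on ?I (app_on ?I M w) (app_on ?I M w) \<le> \<rho>\<^sup>2 * inner_on ?I w w"
      using b[rule_format, OF w[rule_format]] by simp
    have "\<forall>c\<in>{1..k}. \<bar>\<rho>\<bar> \<le> \<bar>\<mu> c\<bar>"
      using mx[rule_format, of v \<rho>] v0 by (simp add: app_on_def inner_on_def Bex_def Ball_def)
    note v = v0 this
    have "\<bar>\<rho>\<bar> \<le> \<Delta>"
      using complement_expansion_le[where U="\<lambda>c i. U i c" and I="?I" and v=v and u=u and P=P
        and k=k and M=M and \<mu>=\<mu>, OF finite_lessThan sym' orth ev v ker \<Delta>]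
      by blast
    moreover have "L2_set (app_on ?I M w) ?I \<le> \<bar>\<rho>\<bar> * L2_set w ?I"
      using real_sqrt_le_mono[OF r] by (simp add: L2_set_eq_inner_on real_sqrt_mult)
    ultimately show ?thesis by (meson L2_set_nonneg mult_right_mono order_trans)
  qed
  have "L2_set (app_on ?I P w) ?I \<le>
      L2_set (app_on ?I M w) ?I + L2_set (\<lambda>i. app_on ?I P w i - app_on ?I M w i) ?I"
    using L2_set_triangle_ineq[of "app_on ?I M w" "\<lambda>i. app_on ?I P w i - app_on ?I M w i" ?I] by simp
  also have "L2_set (\<lambda>i. app_on ?I P w i - app_on ?I M w i) ?I
     = L2_set (\<lambda>i. app_on ?I M w i - app_on ?I P w i) ?I"
    by (simp add: L2_set_def power2_commute)
  finally show ?thesis using Mw \<Delta>[of w] gap[of w] by simp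
qed

section \<open>Orthogonal projections and the coefficient matrix of two orthonormal systems\<close>

lemma inner_on_orthonormal_expansion:
  assumes orth: "orthonormal_on I A U" and "finite A"
  defines "w x \<equiv> (\<lambda>i. x i - (\<Sum>c\<in>A. inner_on I x (U c) * U c i))"
  shows "orth_to I A U (w x)"
    and "inner_on I (w x) (w x) = inner_on I x x - (\<Sum>c\<in>A. (inner_on I x (U c))\<^sup>2)"
    and "inner_on I x (w x) = inner_on I (w x) (w x)"
proof -
  show 1: "orth_to I A U (w x)"
  proof
    fix c assume c: "c \<in> A"
    have "inner_on I (w x) (U c) = inner_on I x (U c) - (\<Sum>b\<in>A. inner_on I x (U b) * inner_on I (U b) (U c))"
      unfolding w_def by (simp only: inner_on_diff_left inner_on_sum_left)
    also have "(\<Sum>b\<in>A. inner_on I x (U b) * inner_on I (U b) (U c)) =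
        (\<Sum>b\<in>A. if b = c then inner_on I x (U b) else 0)"
      using orth c by (intro sum.cong refl) simp
    also have "\<dots> = inner_on I x (U c)" using \<open>finite A\<close> c by simp
    finally show "inner_on I (w x) (U c) = 0" by simp
  qed
  have "inner_on I (w x) (w x) = inner_on I (w x) x - (\<Sum>b\<in>A. inner_on I x (U b) * inner_on I (w x) (U b))"
    by (subst (2) w_def) (simp only: inner_on_diff_right inner_on_sum_right)
  also have "\<dots> = inner_on I x (w x)" using 1 by (simp add: inner_on_commute)
  finally show 2: "inner_on I x (w x) = inner_on I (w x) (w x)" by simp
  have "inner_on I x (w x) = inner_on I x x - (\<Sum>c\<in>A. (inner_on I x (U c))\<^sup>2)"
    unfolding w_def by (simp add: inner_on_diff_right inner_on_sum_right power2_eq_square)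
  thus "inner_on I (w x) (w x) = inner_on I x x - (\<Sum>c\<in>A. (inner_on I x (U c))\<^sup>2)" using 2 by simp
qed

lemma bessel_inequality:
  assumes "orthonormal_on I A U" and "finite A"
  shows "(\<Sum>c\<in>A. (inner_on I x (U c))\<^sup>2) \<le> inner_on I x x"
  using inner_on_orthonormal_expansion(2)[OF assms, of x]
    inner_on_self_nonneg[of I "\<lambda>i. x i - (\<Sum>c\<in>A. inner_on I x (U c) * U c i)"] by linarith

text \<open>The coefficient matrix \<open>\<langle>u j, U c\<rangle>\<close> is nearly orthogonal when the span of \<open>U\<close> nearly
  contains the span of \<open>u\<close>; it replaces the orthogonal alignment of the two bases.\<close>

lemma almost_orthogonal_coefficients:
  assumes U: "orthonormal_on I A U"
    and u: "orthonormal_on I A u" and fin: "finite A"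
    and near: "\<And>w. orth_to I A U w \<Longrightarrow> L2_set (\<lambda>j. inner_on I (u j) w) A \<le> \<delta> * L2_set w I"
  shows "(1 - \<delta>\<^sup>2) * inner_on A a a \<le> (\<Sum>c\<in>A. (\<Sum>j\<in>A. a j * inner_on I (u j) (U c))\<^sup>2)"
proof -
  define x where "x = (\<lambda>i. \<Sum>j\<in>A. a j * u j i)"
  define w where "w = (\<lambda>i. x i - (\<Sum>c\<in>A. inner_on I x (U c) * U c i))"
  have xU: "inner_on I x (U c) = (\<Sum>j\<in>A. a j * inner_on I (u j) (U c))" for c
    unfolding x_def by (rule inner_on_sum_left)
  have xx: "inner_on I x x = inner_on A a a"
  proof -
    have "inner_on I x x = (\<Sum>c\<in>A. a c * (\<Sum>c'\<in>A. a c' * inner_on I (u c) (u c')))"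
      unfolding x_def by (simp only: inner_on_sum_left inner_on_sum_right)
    also have "\<dots> = (\<Sum>c\<in>A. a c * (\<Sum>c'\<in>A. if c' = c then a c' else 0))"
      by (intro sum.cong refl arg_cong[where f="(*) _"]) (simp add: u)
    also have "\<dots> = inner_on A a a" using fin by (simp add: inner_on_def)
    finally show ?thesis .
  qed
  note ex = inner_on_orthonormal_expansion[OF U fin, of x, folded w_def]
  \<comment> \<open>Testing the residual \<open>w\<close> against \<open>x\<close> itself bounds its
    squared norm by \<open>\<delta>\<close> times the norms of \<open>a\<close> and
    \<open>w\<close>. Cancelling one norm of \<open>w\<close> requires a separate case for a zero
    residual.\<close>
  have "inner_on I w w = inner_on I x w" using ex(3) by simp
  also have "\<dots> = inner_on A a (\<lambda>j. inner_on I (u j) w)"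
    unfolding x_def inner_on_sum_left by (simp add: inner_on_def)
  also have "\<dots> \<le> L2_set a A * L2_set (\<lambda>j. inner_on I (u j) w) A"
    using abs_inner_on_le abs_le_D1 by blast
  also have "\<dots> \<le> L2_set a A * (\<delta> * L2_set w I)"
    using near[OF ex(1)] by (intro mult_left_mono) auto
  finally have "(L2_set w I)\<^sup>2 \<le> (\<delta> * L2_set a A) * L2_set w I"
    by (simp add: L2_set_sq mult_ac)
  hence "L2_set w I = 0 \<or> L2_set w I \<le> \<delta> * L2_set a A"
    using L2_set_nonneg[of w I] by (auto simp del: L2_set_nonneg simp: power2_eq_square mult_le_cancel_right)
  hence "(L2_set w I)\<^sup>2 \<le> (\<delta> * L2_set a A)\<^sup>2"
    using power_mono[OF _ L2_set_nonneg[of w I], of "\<delta> * L2_set a A" 2] by auto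
  hence "inner_on I w w \<le> \<delta>\<^sup>2 * inner_on A a a" by (simp add: power_mult_distrib L2_set_sq)
  thus ?thesis using ex(2) xx by (simp add: xU algebra_simps)
qed

text \<open>Both systems have \<open>card A\<close> members, so the Frobenius norm of the
  coefficient matrix transfers closeness from one side to the other: its rows have squared norm at
  least \<open>1 - \<delta>\<^sup>2\<close> by \<open>almost_orthogonal_coefficients\<close> at unit
  vectors, and by Pythagoras its columns measure how far \<open>U c\<close> lies from the span of
  \<open>u\<close>.\<close>

lemma subspace_distance_bound:
  assumes U: "orthonormal_on I A U"
    and u: "orthonormal_on I A u" and fin: "finite A"
    and near: "\<And>w. orth_to I A U w \<Longrightarrow> L2_set (\<lambda>j. inner_on I (u j) w) A \<le> \<delta> * L2_set w I"
  shows "(\<Sum>i\<in>I. \<Sum>c\<in>A. (U c i - (\<Sum>j\<in>A. u j i * inner_on I (u j) (U c)))\<^sup>2) \<le> real (card A) * \<delta>\<^sup>2"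
proof -
  let ?H = "\<lambda>j c. inner_on I (u j) (U c)"
  have row: "1 - \<delta>\<^sup>2 \<le> (\<Sum>c\<in>A. (?H b c)\<^sup>2)" if b: "b \<in> A" for b
  proof -
    have "inner_on A (\<lambda>j. if j = b then 1 else 0) (\<lambda>j. if j = b then 1 else 0) = 1"
      using fin b by (simp add: inner_on_def if_distrib[where f="\<lambda>x. x * _"] cong: if_cong)
    moreover have "(\<Sum>j\<in>A. (if j = b then 1 else 0) * ?H j c) = ?H b c" for c
      using fin b by (simp add: if_distrib[where f="\<lambda>x. x * _"] cong: if_cong)
    ultimately show ?thesis
      using almost_orthogonal_coefficients[OF U u fin near, of "\<lambda>j. if j = b then 1 else 0"] by simp
  qed
  have col: "(\<Sum>i\<in>I. (U c i - (\<Sum>j\<in>A. u j i * ?H j c))\<^sup>2) = 1 - (\<Sum>j\<in>A. (?H j c)\<^sup>2)" if c: "c \<in> A" for c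
  proof -
    have "(\<Sum>i\<in>I. (U c i - (\<Sum>j\<in>A. u j i * ?H j c))\<^sup>2) =
      inner_on I (\<lambda>i. U c i - (\<Sum>j\<in>A. inner_on I (U c) (u j) * u j i))
        (\<lambda>i. U c i - (\<Sum>j\<in>A. inner_on I (U c) (u j) * u j i))"
      by (simp add: inner_on_def power2_eq_square mult.commute)
    thus ?thesis
      using inner_on_orthonormal_expansion(2)[OF u fin, of "U c"] U c
      by (simp add: inner_on_commute[of I "U c" "u _"])
  qed
  have "(\<Sum>i\<in>I. \<Sum>c\<in>A. (U c i - (\<Sum>j\<in>A. u j i * ?H j c))\<^sup>2) =
      (\<Sum>c\<in>A. \<Sum>i\<in>I. (U c i - (\<Sum>j\<in>A. u j i * ?H j c))\<^sup>2)" by (rule sum.swap)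
  also have "\<dots> = (\<Sum>c\<in>A. 1 - (\<Sum>j\<in>A. (?H j c)\<^sup>2))" using col by simp
  also have "\<dots> = real (card A) - (\<Sum>j\<in>A. \<Sum>c\<in>A. (?H j c)\<^sup>2)"
    by (simp add: sum_subtractf) (rule sum.swap)
  also have "(\<Sum>j\<in>A. \<Sum>c\<in>A. (?H j c)\<^sup>2) \<ge> (\<Sum>j\<in>A. 1 - \<delta>\<^sup>2)" using row by (intro sum_mono)
  ultimately show ?thesis by (simp add: algebra_simps)
qed

text \<open>Polarisation with \<open>y\<close> the image of \<open>x\<close>: the forms at
  \<open>s x + y\<close> and \<open>s x - y\<close> differ by four times \<open>s\<close> times the
  squared norm of \<open>y\<close>, while the parallelogram law adds up their two bounds. Optimising
  \<open>s\<close> gives the constant \<open>D\<close> without loss.\<close>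

lemma operator_norm_le_quadratic_form:
  assumes sym: "\<forall>i\<in>I. \<forall>j\<in>I. W i j = W j i"
    and q: "\<And>x. \<bar>quad_form I W x\<bar> \<le> D * inner_on I x x"
  shows "L2_set (app_on I W x) I \<le> D * L2_set x I"
proof -
  define y where "y = app_on I W x"
  define X where "X = inner_on I x x"
  define Y where "Y = inner_on I y y"
  have XY: "X \<ge> 0" "Y \<ge> 0" by (simp_all add: X_def Y_def)
  have xWy: "inner_on I x (app_on I W y) = Y"
    unfolding Y_def y_def by (simp add: inner_on_app_on_swap[OF sym, symmetric])
  have yWx: "inner_on I y (app_on I W x) = Y" by (simp add: Y_def y_def)
  have key: "2 * s * Y \<le> D * (s\<^sup>2 * X + Y)" for s
  proof -
    define q1 where "q1 = quad_form I W x"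
    define q2 where "q2 = quad_form I W y"
    define r where "r = inner_on I x y"
    have ryx: "inner_on I y x = r" by (simp add: r_def inner_on_commute)
    have "s * s * q1 + 2 * s * Y + q2 \<le> D * (s * s * X + 2 * s * r + Y)"
      using abs_le_D1[OF q[of "\<lambda>i. s * x i + y i"]]
      by (simp add: inner_on_linear app_on_add app_on_scale xWy yWx ryx q1_def[symmetric]
          q2_def[symmetric] r_def[symmetric] X_def[symmetric] Y_def[symmetric] algebra_simps)
    moreover have "- (s * s * q1 - 2 * s * Y + q2) \<le> D * (s * s * X - 2 * s * r + Y)"
      using abs_le_D2[OF q[of "\<lambda>i. s * x i - y i"]]
      by (simp add: inner_on_linear app_on_diff app_on_scale xWy yWx ryx q1_def[symmetric]
          q2_def[symmetric] r_def[symmetric] X_def[symmetric] Y_def[symmetric] algebra_simps)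
    ultimately show ?thesis by (simp add: power2_eq_square algebra_simps)
  qed
  have "sqrt Y \<le> D * sqrt X"
  proof (cases "X = 0 \<or> Y = 0")
    case True
    have "Y = 0"
    proof (rule ccontr)
      assume "Y \<noteq> 0"
      hence X0: "X = 0" and Yp: "Y > 0" using True XY by auto
      \<comment> \<open>No sign of \<open>D\<close> is known here. With \<open>X = 0\<close>,
        evaluating \<open>key\<close> at an \<open>s\<close> larger than \<open>D\<close> rules out
        a positive \<open>Y\<close>.\<close>
      have "2 * ((\<bar>D\<bar> + 1) * Y) \<le> D * Y" using key[of "\<bar>D\<bar> + 1"] X0 by (simp add: algebra_simps)
      hence "2 * (\<bar>D\<bar> + 1) \<le> D" using Yp by (simp add: mult.assoc[symmetric])
      thus False by simp
    qed
    moreover have "0 \<le> D * X" using q[of x] abs_ge_zero order_trans unfolding X_def by blast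
    hence "X = 0 \<or> D \<ge> 0" using XY by (simp add: zero_le_mult_iff) (metis antisym_conv2)
    ultimately show ?thesis using XY by auto
  next
    case False
    hence p: "X > 0" "Y > 0" using XY by auto
    \<comment> \<open>The choice that balances the two terms on the right of
      \<open>key\<close>.\<close>
    define s where "s = sqrt Y / sqrt X"
    have "s\<^sup>2 * X = Y" using p by (simp add: s_def power_divide)
    hence "2 * (s * Y) \<le> 2 * (D * Y)" using key[of s] by (simp add: algebra_simps)
    hence "s \<le> D" using p by simp
    thus ?thesis using p by (simp add: s_def divide_le_eq)
  qed
  thus ?thesis by (simp add: L2_set_eq_inner_on y_def X_def Y_def)
qed

section \<open>A lattice net of the unit ball\<close>

definition lattice_net :: "nat \<Rightarrow> (nat \<Rightarrow> int) set" where
  "lattice_net n = {z \<in> PiE {..<n} (\<lambda>_. UNIV). (\<Sum>i<n. (z i)\<^sup>2) \<le> 16 * int n}"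

text \<open>At mesh width \<open>1 / (4 * sqrt n)\<close>, rounding all \<open>n\<close> coordinates
  moves a vector by at most 1/4 in norm; the bound \<open>16 * n\<close> in
  \<open>lattice_net\<close> is the unit ball at this scale.\<close>

definition lattice_point :: "nat \<Rightarrow> (nat \<Rightarrow> int) \<Rightarrow> nat \<Rightarrow> real" where
  "lattice_point n z = (\<lambda>i. of_int (z i) / (4 * sqrt (real n)))"

lemma abs_le_square_int: "\<bar>a::int\<bar> \<le> a\<^sup>2"
proof (cases "a = 0")
  case False
  hence "\<bar>a\<bar> \<le> \<bar>a\<bar> ^ 2" by (intro self_le_power) auto
  thus ?thesis by simp
qed simp

lemma sum_half_powers_le: "(\<Sum>m\<in>{-int N..int N}. (1/2::real) ^ nat \<bar>m\<bar>) = 3 - 2 * (1/2) ^ N"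
proof (induction N)
  case (Suc N)
  have "{-int (Suc N)..int (Suc N)} = insert (int (Suc N)) (insert (-int (Suc N)) {-int N..int N})"
    by auto
  moreover have "nat \<bar>int (Suc N)\<bar> = Suc N" "nat \<bar>- int (Suc N)\<bar> = Suc N" by simp_all
  ultimately show ?case using Suc by (simp del: of_nat_Suc)
qed simp

lemma lattice_net_subset: "lattice_net n \<subseteq> PiE {..<n} (\<lambda>_. {-int (16 * n)..int (16 * n)})"
proof
  fix z assume z: "z \<in> lattice_net n"
  have "\<bar>z i\<bar> \<le> int (16 * n)" if "i < n" for i
  proof -
    have "\<bar>z i\<bar> \<le> (z i)\<^sup>2" by (rule abs_le_square_int)
    also have "\<dots> \<le> (\<Sum>i<n. (z i)\<^sup>2)" using that by (intro member_le_sum) auto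
    finally show ?thesis using z by (simp add: lattice_net_def)
  qed
  thus "z \<in> PiE {..<n} (\<lambda>_. {-int (16 * n)..int (16 * n)})"
    using z by (auto simp: lattice_net_def PiE_iff abs_le_iff minus_le_iff)
qed

lemma finite_lattice_net: "finite (lattice_net n)"
  by (rule finite_subset[OF lattice_net_subset]) (intro finite_PiE, auto)

text \<open>Counting by an exponential weight. For integers the sum of absolute values is at most
  the sum of squares, hence at most \<open>16 * n\<close>, so each net point has weight at least 1
  under 2^(16n) times the product of the 2^(-|z_i|). Summed over a box this factorises into
  \<open>n\<close> geometric sums, each below 4.\<close>

lemma card_lattice_net: "real (card (lattice_net n)) \<le> 2 ^ (18 * n)"
proof -
  let ?P = "PiE {..<n} (\<lambda>_. {-int (16 * n)..int (16 * n)})"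
  have 1: "1 \<le> 2 ^ (16 * n) * (\<Prod>i<n. (1/2::real) ^ nat \<bar>z i\<bar>)" if z: "z \<in> lattice_net n" for z
  proof -
    have "int (\<Sum>i<n. nat \<bar>z i\<bar>) = (\<Sum>i<n. \<bar>z i\<bar>)" by simp
    also have "\<dots> \<le> (\<Sum>i<n. (z i)\<^sup>2)"
      by (intro sum_mono abs_le_square_int)
    also have "\<dots> \<le> int (16 * n)" using z by (simp add: lattice_net_def)
    finally have "(\<Sum>i<n. nat \<bar>z i\<bar>) \<le> 16 * n" by linarith
    hence "(2::real) ^ (\<Sum>i<n. nat \<bar>z i\<bar>) \<le> 2 ^ (16 * n)" by (intro power_increasing) auto
    moreover have "(\<Prod>i<n. (1/2::real) ^ nat \<bar>z i\<bar>) = 1 / 2 ^ (\<Sum>i<n. nat \<bar>z i\<bar>)"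
      by (simp add: power_sum power_one_over prod_dividef)
    ultimately show ?thesis by simp
  qed
  have "real (card (lattice_net n)) = (\<Sum>z\<in>lattice_net n. 1)" by simp
  also have "\<dots> \<le> (\<Sum>z\<in>lattice_net n. 2 ^ (16 * n) * (\<Prod>i<n. (1/2::real) ^ nat \<bar>z i\<bar>))"
    using 1 by (intro sum_mono)
  also have "\<dots> \<le> (\<Sum>z\<in>?P. 2 ^ (16 * n) * (\<Prod>i<n. (1/2::real) ^ nat \<bar>z i\<bar>))"
  proof (rule sum_mono2)
    show "finite ?P" by (intro finite_PiE) simp_all
    show "lattice_net n \<subseteq> ?P" by (rule lattice_net_subset)
  qed (intro mult_nonneg_nonneg prod_nonneg, simp_all)
  also have "\<dots> = 2 ^ (16 * n) * (\<Prod>i<n. \<Sum>m\<in>{-int (16 * n)..int (16 * n)}. (1/2::real) ^ nat \<bar>m\<bar>)"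
    by (subst prod_sum_PiE) (simp_all only: sum_distrib_left finite_lessThan finite_atLeastAtMost_int)
  also have "\<dots> = 2 ^ (16 * n) * (3 - 2 * (1/2) ^ (16 * n)) ^ n"
    unfolding sum_half_powers_le by (simp only: prod_constant card_lessThan)
  also have "\<dots> \<le> 2 ^ (16 * n) * 4 ^ n"
  proof -
    have "0 \<le> (1/2::real) ^ (16 * n)" "(1/2::real) ^ (16 * n) \<le> 1" by (auto intro: power_le_one)
    hence "0 \<le> 3 - 2 * (1/2::real) ^ (16 * n)" "3 - 2 * (1/2::real) ^ (16 * n) \<le> 4" by linarith+
    thus ?thesis by (intro mult_left_mono power_mono) simp_all
  qed
  also have "\<dots> = 2 ^ (18 * n)"
    by (simp add: power_mult power_mult_distrib[symmetric])
  finally show ?thesis .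
qed

lemma lattice_net_approximates:
  assumes n: "n \<ge> 1" and x: "inner_on {..<n} x x \<le> 1"
  shows "\<exists>z\<in>lattice_net n. inner_on {..<n} (lattice_point n z) (lattice_point n z) \<le> 1 \<and>
     L2_set (\<lambda>i. x i - lattice_point n z i) {..<n} \<le> 1 / 4"
proof -
  define s where "s = 4 * sqrt (real n)"
  have s: "s > 0" "s\<^sup>2 = 16 * real n" using n by (auto simp: s_def power_mult_distrib)
  \<comment> \<open>Rounding towards 0, so that the net point is no longer than \<open>x\<close>.
    Outside the range the value is \<open>undefined\<close>, as \<open>PiE\<close> demands.\<close>
  define z where "z = (\<lambda>i. if i < n then (if x i \<ge> 0 then \<lfloor>x i * s\<rfloor> else - \<lfloor>- x i * s\<rfloor>) else undefined)"
  have le: "\<bar>of_int (z i)\<bar> \<le> \<bar>x i * s\<bar>" and ap: "\<bar>x i * s - of_int (z i)\<bar> \<le> 1" if "i < n" for i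
  proof -
    have "x i * s \<ge> 0 \<longleftrightarrow> x i \<ge> 0" using s by (simp add: zero_le_mult_iff)
    thus "\<bar>of_int (z i)\<bar> \<le> \<bar>x i * s\<bar>" "\<bar>x i * s - of_int (z i)\<bar> \<le> 1"
      using that by (auto simp: z_def) linarith+
  qed
  have zi: "lattice_point n z i = of_int (z i) / s" for i by (simp add: lattice_point_def s_def)
  have z1: "inner_on {..<n} (lattice_point n z) (lattice_point n z) \<le> inner_on {..<n} x x"
    unfolding inner_on_def
  proof (intro sum_mono)
    fix i assume "i \<in> {..<n}"
    hence "\<bar>lattice_point n z i\<bar> \<le> \<bar>x i\<bar>" using le[of i] s by (simp add: zi abs_mult divide_le_eq)
    thus "lattice_point n z i * lattice_point n z i \<le> x i * x i"
      by (metis abs_le_square_iff power2_eq_square)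
  qed
  have "(\<Sum>i<n. (of_int (z i))\<^sup>2) = s\<^sup>2 * inner_on {..<n} (lattice_point n z) (lattice_point n z)"
    using s by (simp add: inner_on_def zi sum_distrib_left power2_eq_square)
  also have "\<dots> \<le> s\<^sup>2 * 1" using order_trans[OF z1 x] by (intro mult_left_mono) auto
  also have "\<dots> = real_of_int (16 * int n)" using s by simp
  finally have "real_of_int (\<Sum>i<n. (z i)\<^sup>2) \<le> real_of_int (16 * int n)" by simp
  hence "(\<Sum>i<n. (z i)\<^sup>2) \<le> 16 * int n" by (simp only: of_int_le_iff)
  moreover have "z \<in> PiE {..<n} (\<lambda>_. UNIV)" by (simp add: PiE_iff extensional_def) (simp add: z_def)
  ultimately have zT: "z \<in> lattice_net n" by (simp add: lattice_net_def)
  define d where "d = (\<lambda>i. x i - lattice_point n z i)"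
  have d: "d i * d i \<le> 1 / s\<^sup>2" if "i < n" for i
  proof -
    have "d i = (x i * s - of_int (z i)) / s" using s(1) by (simp add: d_def zi diff_divide_distrib)
    hence "d i * d i = (x i * s - of_int (z i))\<^sup>2 / s\<^sup>2" by (simp add: power2_eq_square)
    also have "\<dots> \<le> 1 / s\<^sup>2" using ap[OF that] s
      by (intro divide_right_mono) (simp_all add: abs_square_le_1)
    finally show ?thesis .
  qed
  have "inner_on {..<n} d d \<le> (\<Sum>i<n. 1 / s\<^sup>2)"
    unfolding inner_on_def using d by (intro sum_mono) simp
  also have "\<dots> = (1 / 4)\<^sup>2" using n s by (simp add: power2_eq_square)
  finally have "L2_set d {..<n} \<le> 1 / 4" unfolding L2_set_eq_inner_on by (rule real_le_lsqrt[rotated]) simp_all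
  thus ?thesis using zT order_trans[OF z1 x] unfolding d_def by blast
qed

text \<open>A self-bounding supremum: with \<open>M\<close> the supremum of the form on the unit
  ball, the forms at \<open>x\<close> and at its net point \<open>y\<close> differ by the inner
  product of \<open>x - y\<close> with the image of \<open>x + y\<close>, which is at most (1/4) * 2
  * \<open>M\<close>. Hence \<open>M \<le> m + M / 2\<close>.\<close>

lemma quadratic_form_le_on_lattice:
  assumes n: "n \<ge> 1" and sym: "\<forall>i<n. \<forall>j<n. W i j = W j i"
    and m: "\<And>z. z \<in> lattice_net n \<Longrightarrow> inner_on {..<n} (lattice_point n z) (lattice_point n z) \<le> 1 \<Longrightarrow>
      \<bar>quad_form {..<n} W (lattice_point n z)\<bar> \<le> m"
  shows "\<bar>quad_form {..<n} W x\<bar> \<le> 2 * m * inner_on {..<n} x x"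
proof -
  let ?I = "{..<n}"
  let ?Q = "\<lambda>x. quad_form ?I W x"
  have sym': "\<forall>i\<in>?I. \<forall>j\<in>?I. W i j = W j i" using sym by simp
  define S where "S = (\<lambda>x. \<bar>?Q x\<bar>) ` {x. inner_on ?I x x \<le> 1}"
  \<comment> \<open>Absorbing \<open>M / 2\<close> requires a finite supremum; a crude entrywise
    estimate supplies it.\<close>
  have bdd: "bdd_above S"
  proof (rule bdd_aboveI)
    fix y assume "y \<in> S"
    then obtain x where x: "y = \<bar>?Q x\<bar>" "inner_on ?I x x \<le> 1" unfolding S_def by auto
    have x1: "\<bar>x i\<bar> \<le> 1" if "i < n" for i
      using order_trans[OF square_le_inner_on[of ?I i x] x(2)] that by (simp add: abs_square_le_1)
    have "y = \<bar>\<Sum>i<n. \<Sum>j<n. x i * (W i j * x j)\<bar>"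
      by (simp add: x(1) inner_on_def app_on_def sum_distrib_left)
    also have "\<dots> \<le> (\<Sum>i<n. \<bar>\<Sum>j<n. x i * (W i j * x j)\<bar>)" by (rule sum_abs)
    also have "\<dots> \<le> (\<Sum>i<n. \<Sum>j<n. \<bar>x i * (W i j * x j)\<bar>)" by (intro sum_mono sum_abs)
    also have "\<dots> \<le> (\<Sum>i<n. \<Sum>j<n. \<bar>W i j\<bar>)"
    proof (intro sum_mono)
      fix i j assume "i \<in> ?I" "j \<in> ?I"
      hence "\<bar>x i\<bar> * (\<bar>W i j\<bar> * \<bar>x j\<bar>) \<le> 1 * (\<bar>W i j\<bar> * 1)"
        using x1 by (intro mult_mono) auto
      thus "\<bar>x i * (W i j * x j)\<bar> \<le> \<bar>W i j\<bar>" by (simp add: abs_mult)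
    qed
    finally show "y \<le> (\<Sum>i<n. \<Sum>j<n. \<bar>W i j\<bar>)" .
  qed
  have ne: "S \<noteq> {}" unfolding S_def by (auto intro!: exI[of _ "\<lambda>_. 0"] simp: inner_on_def)
  define M where "M = Sup S"
  have SM: "\<bar>?Q x\<bar> \<le> M" if "inner_on ?I x x \<le> 1" for x
    unfolding M_def using that by (intro cSup_upper bdd) (auto simp: S_def)
  have M0: "M \<ge> 0" using SM[of "\<lambda>_. 0"] by (simp add: inner_on_def)
  have hom: "\<bar>?Q x\<bar> \<le> M * inner_on ?I x x" for x
  proof (cases "inner_on ?I x x = 0")
    case True
    thus ?thesis using inner_on_self_eq_0[of ?I x] by (simp add: inner_on_def)
  next
    case False
    hence p: "inner_on ?I x x > 0" using inner_on_self_nonneg[of ?I x] by linarith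
    define a where "a = 1 / sqrt (inner_on ?I x x)"
    have aa: "a * (a * inner_on ?I x x) = 1" and aa': "a * a = 1 / inner_on ?I x x" using p by (auto simp: a_def)
    have "\<bar>?Q (\<lambda>i. a * x i)\<bar> \<le> M" using aa by (intro SM) (simp add: inner_on_linear)
    hence "\<bar>(a * a) * ?Q x\<bar> \<le> M" by (simp add: inner_on_linear app_on_scale mult.assoc)
    thus ?thesis using p unfolding aa' by (simp add: divide_le_eq)
  qed
  have op: "L2_set (app_on ?I W y) ?I \<le> M * L2_set y ?I" for y
    by (rule operator_norm_le_quadratic_form[OF sym' hom])
  have "\<bar>?Q x\<bar> \<le> m + M / 2" if x: "inner_on ?I x x \<le> 1" for x
  proof -
    obtain z where z: "z \<in> lattice_net n" "inner_on ?I (lattice_point n z) (lattice_point n z) \<le> 1"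
      "L2_set (\<lambda>i. x i - lattice_point n z i) ?I \<le> 1 / 4"
      using lattice_net_approximates[OF n x] by blast
    define y where "y = lattice_point n z"
    have "?Q x - ?Q y = inner_on ?I (\<lambda>i. x i - y i) (app_on ?I W (\<lambda>i. x i + y i))"
      using inner_on_app_on_swap[OF sym', of y x] inner_on_commute[of ?I x "app_on ?I W y"]
      by (simp add: inner_on_linear app_on_add)
    also have "\<bar>\<dots>\<bar> \<le> L2_set (\<lambda>i. x i - y i) ?I * L2_set (app_on ?I W (\<lambda>i. x i + y i)) ?I"
      by (rule abs_inner_on_le)
    also have "\<dots> \<le> (1 / 4) * (M * 2)"
    proof (intro mult_mono)
      have "L2_set (\<lambda>i. x i + y i) ?I \<le> L2_set x ?I + L2_set y ?I" by (rule L2_set_triangle_ineq)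
      also have "\<dots> \<le> 1 + 1" using x z by (intro add_mono) (simp_all add: L2_set_eq_inner_on y_def)
      finally show "L2_set (app_on ?I W (\<lambda>i. x i + y i)) ?I \<le> M * 2"
        using op[of "\<lambda>i. x i + y i"] mult_left_mono[OF _ M0, of "L2_set (\<lambda>i. x i + y i) ?I" 2] by simp
    qed (use z in \<open>auto simp: y_def\<close>)
    finally have "\<bar>?Q x - ?Q y\<bar> \<le> M / 2" by simp
    moreover have "\<bar>?Q y\<bar> \<le> m" using m[OF z(1,2)] by (simp add: y_def)
    ultimately show ?thesis by linarith
  qed
  hence "M \<le> m + M / 2" unfolding M_def using ne by (intro cSup_least) (auto simp: S_def)
  hence "M \<le> 2 * m" by simp
  thus ?thesis using hom[of x] by (meson inner_on_self_nonneg mult_right_mono order_trans)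
qed

section \<open>Heavy pairs: dyadic level sets\<close>

text \<open>The exponents are distinct integers, so a truncated dyadic sum is at most twice its
  largest term. This keeps the number of levels, and with it any logarithm, out of the final
  bound.\<close>

lemma sum_powers_of_two_le:
  assumes "finite S" "K \<ge> 0"
  shows "(\<Sum>s\<in>S. if 2 powr real_of_int s \<le> K then 2 powr real_of_int s else 0) \<le> 2 * K"
proof -
  have geo: "finite T \<Longrightarrow> T \<noteq> {} \<Longrightarrow> (\<Sum>s\<in>T. 2 powr real_of_int s) \<le> 2 * 2 powr real_of_int (Max T)"
    for T
  proof (induction T rule: finite_linorder_max_induct)
    case (insert b A)
    have mx: "Max (insert b A) = b" using insert by (intro Max_eqI) auto
    show ?case
    proof (cases "A = {}")
      case False
      have "Max A < b" using insert False by simp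
      hence "2 powr real_of_int (Max A) \<le> 2 powr (real_of_int b - 1)" by (intro powr_mono) linarith+
      also have "\<dots> = 2 powr real_of_int b / 2" by (simp add: powr_diff)
      finally have "(\<Sum>s\<in>A. 2 powr real_of_int s) \<le> 2 powr real_of_int b" using insert.IH[OF False] by simp
      moreover have "b \<notin> A" using insert by auto
      ultimately show ?thesis using mx insert.hyps(1) by simp
    qed simp
  qed simp
  let ?T = "{s \<in> S. 2 powr real_of_int s \<le> K}"
  have "(\<Sum>s\<in>S. if 2 powr real_of_int s \<le> K then 2 powr real_of_int s else 0) = (\<Sum>s\<in>?T. 2 powr real_of_int s)"
    using assms(1) by (simp add: sum.inter_filter)
  also have "\<dots> \<le> 2 * K"
  proof (cases "?T = {}")
    case True
    thus ?thesis using assms by (simp only: sum.empty)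
  next
    case False
    have fT: "finite ?T" using assms by simp
    have "Max ?T \<in> ?T" using Max_in[OF fT False] .
    thus ?thesis using geo[OF fT False] by auto
  qed
  finally show ?thesis .
qed

lemma sum_negative_powers_of_two_le:
  assumes "finite S" "K \<ge> 0"
  shows "(\<Sum>s\<in>S. if 1 / 2 powr real_of_int s \<le> K then 1 / 2 powr real_of_int s else 0) \<le> 2 * K"
proof -
  have "(\<Sum>s\<in>uminus ` S. if 2 powr real_of_int s \<le> K then 2 powr real_of_int s else 0) \<le> 2 * K"
    using assms by (intro sum_powers_of_two_le) auto
  thus ?thesis by (subst (asm) sum.reindex) (auto simp: powr_minus_divide cong: if_cong)
qed

text \<open>\<open>a\<close> and \<open>b\<close> are the magnitudes of two level sets of sizes \<open>I\<close> and \<open>J\<close> with \<open>e\<close> edges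
  between them; each alternative is summable over the dyadic levels.\<close>

lemma dyadic_pair_cases:
  fixes n q D a b I J e c :: real
  assumes pos: "n > 0" "q > 0" "a > 0" "b > 0" "I > 0" "J > 0" "e \<ge> 0" "c \<ge> 0"
    and D: "D > 0" "D\<^sup>2 = n * q"
    and \<alpha>: "\<alpha> = I * a\<^sup>2 / n" "\<alpha> \<le> 1" and \<beta>: "\<beta> = J * b\<^sup>2 / n" "\<beta> \<le> 1"
    and heavy: "D \<le> 4 * a * b"
    and deg: "e \<le> exp 4 * (I * (n * q))"
    and disc: "e \<le> exp 4 * (I * J * q) \<or> e * ln (e / (I * J * q)) \<le> c * J * (1 + ln (n / J))"
  defines "F \<equiv> a * b * e / (n * D)"
  shows "F \<le> 4 * exp 4 * (\<alpha> * \<beta>) \<or> (b * D \<le> a \<and> F \<le> exp 4 * (\<alpha> * (b * D / a))) \<or>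
    (a \<le> b * D \<and> F \<le> 5 * c * (\<beta> * (a / (b * D)))) \<or> (4 * a \<le> D \<and> F \<le> 3 * c * (\<beta> * (a / D))) \<or>
    F \<le> \<alpha> * (D / (a * b))"
proof -
  \<comment> \<open>The excess of the edge count over its nominal size \<open>I * J * q\<close>. In
    this notation \<open>F\<close> equals \<open>r * (\<alpha> * \<beta>) * (D / (a * b))\<close>,
    and heaviness bounds the last factor by 4.\<close>
  define r where "r = e / (I * J * q)"
  have ab: "\<alpha> > 0" "\<beta> > 0" using pos \<alpha> \<beta> by auto
  have e: "e = r * (I * J * q)" using pos by (simp add: r_def)
  have q: "q = D\<^sup>2 / n" using D pos by (simp add: field_simps)
  have Fr: "F = r * (\<alpha> * \<beta>) * (D / (a * b))"
    using pos D(1) unfolding F_def e \<alpha>(1) \<beta>(1) q by (simp add: field_simps power2_eq_square)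
  have h: "D / (a * b) \<le> 4" using heavy pos by (simp add: divide_le_eq mult.assoc)
  have r0: "r \<ge> 0" using pos by (simp add: r_def)
  show ?thesis
  proof (cases "r \<le> exp 4")
    case True
    have "F \<le> (exp 4 * (\<alpha> * \<beta>)) * 4"
      unfolding Fr using True ab h r0 pos D(1) by (intro mult_mono mult_nonneg_nonneg divide_nonneg_nonneg) auto
    thus ?thesis by (intro disjI1) simp
  next
    case False
    hence r4: "r > exp 4" by simp
    hence r1: "r > 1" using one_less_exp_iff[of "4::real"] by linarith
    have "ln (exp 4) < ln r" using r4 r1 by (subst ln_less_cancel_iff) auto
    hence lr: "ln r > 4" by simp
    have IJq: "I * J * q > 0" using pos by simp
    have "\<not> e \<le> exp 4 * (I * J * q)" using r4 IJq unfolding e by (simp add: mult_le_cancel_right)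
    hence dd: "e * ln r \<le> c * J * (1 + ln (n / J))" using disc by (simp add: r_def)
    show ?thesis
    \<comment> \<open>The negation is needed only in the last case, where together with
      \<open>r < b\<close> it yields \<open>4 * a \<le> D\<close>.\<close>
    proof (cases "r * D \<le> 4 * (a * b)")
      case True
      have "r * (D / (a * b)) \<le> 4" using True pos by (simp add: divide_le_eq)
      hence "F \<le> (\<alpha> * \<beta>) * 4" unfolding Fr using ab
        by (metis (no_types, opaque_lifting) less_imp_le mult.assoc mult.commute mult_left_mono mult_nonneg_nonneg)
      also have "\<dots> \<le> 4 * exp 4 * (\<alpha> * \<beta>)" using ab by simp
      finally show ?thesis by blast
    next
      case rD: False
      show ?thesis
      proof (cases "b * D \<le> a")
        case True
        have "F \<le> a * b * (exp 4 * (I * (n * q))) / (n * D)"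
          unfolding F_def using deg pos D(1) by (intro divide_right_mono mult_left_mono) auto
        also have "\<dots> = exp 4 * (\<alpha> * (b * D / a))"
          using pos D(1) unfolding \<alpha>(1) q by (simp add: field_simps power2_eq_square)
        finally show ?thesis using True by blast
      next
        case bD: False
        show ?thesis
        proof (cases "r\<^sup>2 * \<beta> \<le> 1")
          case True
          have "(r * \<beta>)\<^sup>2 \<le> 1"
          proof -
            have "(r * \<beta>)\<^sup>2 = (r\<^sup>2 * \<beta>) * \<beta>" by (simp add: power2_eq_square)
            also have "\<dots> \<le> 1 * 1" using True ab \<beta>(2) by (intro mult_mono) auto
            finally show ?thesis by simp
          qed
          hence "r * \<beta> \<le> 1" by (simp add: abs_square_le_1)
          hence "(r * \<beta>) * (\<alpha> * (D / (a * b))) \<le> 1 * (\<alpha> * (D / (a * b)))"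
            using ab pos D(1) by (intro mult_right_mono) auto
          thus ?thesis unfolding Fr by (simp add: mult_ac)
        next
          case False
          hence "1 / \<beta> \<le> r\<^sup>2" using ab by (simp add: divide_le_eq)
          hence "ln (1 / \<beta>) \<le> ln (r\<^sup>2)" using ab r1 by (subst ln_le_cancel_iff) auto
          hence lb: "ln (1 / \<beta>) \<le> 2 * ln r" using r1 by (simp add: ln_realpow)
          \<comment> \<open>The entropy term splits into \<open>2 * ln b\<close> and
            \<open>ln (1 / \<beta>)\<close>. The latter is already at most \<open>2 * ln r\<close>,
            so it remains to compare \<open>b\<close> with \<open>r\<close>.\<close>
          have "n / J = b\<^sup>2 * (1 / \<beta>)" using pos unfolding \<beta>(1) by simp
          hence "ln (n / J) = ln (b\<^sup>2) + ln (1 / \<beta>)" using pos ab by (simp only: ln_mult_pos zero_less_power zero_less_divide_1_iff)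
          hence lnJ: "ln (n / J) = 2 * ln b + ln (1 / \<beta>)" using pos by (simp add: ln_realpow)
          define L where "L = (1 + 2 * ln b + ln (1 / \<beta>)) / ln r"
          have ex: "e \<le> c * J * L"
            using dd lr unfolding lnJ L_def by (simp add: pos_le_divide_eq algebra_simps)
          have FL: "F \<le> (c * \<beta> * (a / (b * D))) * L'" if "L \<le> L'" for L'
          proof -
            have "F \<le> a * b * (c * J * L') / (n * D)"
              unfolding F_def using order_trans[OF ex mult_left_mono[OF that, of "c * J"]] pos D(1)
              by (intro divide_right_mono mult_left_mono) auto
            also have "\<dots> = (c * \<beta> * (a / (b * D))) * L'"
              using pos D(1) unfolding \<beta>(1) by (simp add: field_simps power2_eq_square)
            finally show ?thesis .
          qed
          show ?thesis
          proof (cases "ln b \<le> ln r")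
            case True
            have "1 + 2 * ln b + ln (1 / \<beta>) \<le> 5 * ln r" using lb True lr by linarith
            hence "L \<le> 5" using lr by (simp add: L_def divide_le_eq)
            from FL[OF this] show ?thesis using bD by (simp add: mult_ac)
          next
            case False
            hence rb: "r < b" using r1 pos by simp
            have "r * D \<le> b * D" using rb D by simp
            hence "4 * (a * b) \<le> D * b" using rD by (simp add: mult.commute)
            hence aD: "4 * a \<le> D" using pos by (simp add: mult.assoc[symmetric])
            have lb0: "ln b > 0" using rb r1 by simp
            have "1 + 2 * ln b + ln (1 / \<beta>) \<le> (3 * b) * ln r"
            proof -
              have "ln b \<le> b - 1" using pos by (simp add: ln_le_minus_one)
              hence "4 + 8 * ln b + 8 * ln r \<le> 8 * b + 8 * ln r" by linarith
              also have "\<dots> \<le> 2 * b * ln r + 8 * (b * ln r)"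
              proof -
                have "8 * b \<le> 2 * b * ln r" using pos lr by simp
                moreover have "1 * ln r \<le> b * ln r" using rb r1 lr by (intro mult_right_mono) auto
                ultimately show ?thesis by linarith
              qed
              also have "\<dots> = 10 * (b * ln r)" by simp
              finally have "1 + 2 * ln b + 2 * ln r \<le> 10 / 4 * (b * ln r)" by linarith
              also have "\<dots> \<le> (3 * b) * ln r" using pos lr by simp
              finally show ?thesis using lb by linarith
            qed
            hence "L \<le> 3 * b" using lr by (simp add: L_def divide_le_eq)
            from FL[OF this] have "F \<le> 3 * c * (\<beta> * (a / D))" using pos by (simp add: mult_ac)
            thus ?thesis using aD by blast
          qed
        qed
      qed
    qed
  qed
qed

definition edge_sum :: "('a \<Rightarrow> 'a \<Rightarrow> real) \<Rightarrow> 'a set \<Rightarrow> 'a set \<Rightarrow> real" where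
  "edge_sum a I J = (\<Sum>i\<in>I. \<Sum>j\<in>J. a i j)"

text \<open>The factor \<open>1 + ln (n / card J)\<close> is the entropy, per element of
  \<open>J\<close>, of choosing a subset of that size, which is the amount a union bound over all
  pairs of sets can afford. The larger set pays for both, hence the condition on
  cardinalities.\<close>

definition discrepancy_property :: "real \<Rightarrow> nat \<Rightarrow> real \<Rightarrow> (nat \<Rightarrow> nat \<Rightarrow> real) \<Rightarrow> bool" where
  "discrepancy_property c n q a = (\<forall>I J. I \<subseteq> {..<n} \<longrightarrow> J \<subseteq> {..<n} \<longrightarrow> I \<noteq> {} \<longrightarrow> card I \<le> card J \<longrightarrow>
     edge_sum a I J \<le> exp 4 * (real (card I) * real (card J) * q) \<or>
     edge_sum a I J * ln (edge_sum a I J / (real (card I) * real (card J) * q))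
       \<le> c * real (card J) * (1 + ln (real n / real (card J))))"

text \<open>Entries are grouped by the dyadic level of \<open>x i * sqrt n\<close>. The factor 8 is
  4 for rounding both entries up by at most 2, times 2 for the two orders of a pair of levels. Each
  of the five alternatives of \<open>dyadic_pair_cases\<close> is, for one level fixed, a geometric
  series in the other, weighted by masses \<open>\<alpha>\<close> of total at most 1.\<close>

lemma heavy_pairs_bound:
  fixes a :: "nat \<Rightarrow> nat \<Rightarrow> real" and x :: "nat \<Rightarrow> real"
  assumes n: "n \<ge> 1" and q: "q > 0" and c: "c \<ge> 0"
    and a0: "\<And>i j. 0 \<le> a i j" and sym: "\<And>i j. a i j = a j i"
    and deg: "\<And>i. i < n \<Longrightarrow> (\<Sum>j<n. a i j) \<le> exp 4 * (real n * q)"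
    and disc: "discrepancy_property c n q a"
    and x0: "\<And>i. 0 \<le> x i" and x1: "(\<Sum>i<n. (x i)\<^sup>2) \<le> 1"
  shows "(\<Sum>i<n. \<Sum>j<n. if x i * x j > sqrt (real n * q) / real n then x i * x j * a i j else 0)
    \<le> 8 * (6 * exp 4 + 16 * c + 8) * sqrt (real n * q)"
proof -
  define D where "D = sqrt (real n * q)"
  have D: "D > 0" "D\<^sup>2 = real n * q" using n q by (auto simp: D_def)
  define N where "N = {i. i < n \<and> x i > 0}"
  define lev where "lev = (\<lambda>i. \<lfloor>log 2 (x i * sqrt (real n))\<rfloor>)"
  define p where "p = (\<lambda>s::int. 2 powr real_of_int s)"
  have p0: "p s > 0" for s by (simp add: p_def)
  have sn: "sqrt (real n) > 0" using n by simp
  have lev: "p (lev i) \<le> x i * sqrt (real n)" "x i * sqrt (real n) \<le> 2 * p (lev i)" if "i \<in> N" for i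
  proof -
    let ?y = "x i * sqrt (real n)"
    have y: "?y > 0" using that sn by (simp add: N_def)
    have "2 powr real_of_int (lev i) \<le> 2 powr (log 2 ?y)"
      unfolding lev_def by (intro powr_mono) auto
    thus "p (lev i) \<le> ?y" using y by (simp add: p_def)
    have "2 powr (log 2 ?y) \<le> 2 powr (real_of_int (lev i) + 1)"
      unfolding lev_def by (intro powr_mono) linarith+
    thus "?y \<le> 2 * p (lev i)" using y by (simp add: p_def powr_add)
  qed
  have fN: "finite N" by (simp add: N_def)
  define S where "S = lev ` N"
  have fS: "finite S" using fN by (simp add: S_def)
  define I where "I = (\<lambda>s. {i \<in> N. lev i = s})"
  have I: "finite (I s)" "I s \<subseteq> {..<n}" for s using fN by (auto simp: I_def N_def)
  have Ine: "I s \<noteq> {}" if "s \<in> S" for s using that by (auto simp: I_def S_def)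
  have cI: "real (card (I s)) > 0" if "s \<in> S" for s using I Ine[OF that] by (simp add: card_gt_0_iff)
  have group: "(\<Sum>i\<in>N. h i) = (\<Sum>s\<in>S. \<Sum>i\<in>I s. h i)" for h :: "nat \<Rightarrow> real"
    unfolding I_def S_def using fN by (intro sum.group[symmetric]) auto
  define \<alpha> where "\<alpha> = (\<lambda>s. real (card (I s)) * (p s)\<^sup>2 / real n)"
  have \<alpha>0: "\<alpha> s \<ge> 0" for s by (simp add: \<alpha>_def)
  have \<alpha>S: "(\<Sum>s\<in>S. \<alpha> s) \<le> 1"
  proof -
    have "(\<Sum>s\<in>S. \<alpha> s) = (\<Sum>s\<in>S. \<Sum>i\<in>I s. (p s)\<^sup>2 / real n)" by (simp add: \<alpha>_def)
    also have "\<dots> = (\<Sum>s\<in>S. \<Sum>i\<in>I s. (p (lev i))\<^sup>2 / real n)" by (intro sum.cong) (auto simp: I_def)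
    also have "\<dots> = (\<Sum>i\<in>N. (p (lev i))\<^sup>2 / real n)" by (rule group[symmetric])
    also have "\<dots> \<le> (\<Sum>i\<in>N. (x i)\<^sup>2)"
    proof (intro sum_mono)
      fix i assume "i \<in> N"
      have "(p (lev i))\<^sup>2 \<le> (x i * sqrt (real n))\<^sup>2"
        using lev(1)[OF \<open>i \<in> N\<close>] p0[of "lev i"] by (intro power_mono) auto
      thus "(p (lev i))\<^sup>2 / real n \<le> (x i)\<^sup>2" using n by (simp add: power_mult_distrib divide_le_eq)
    qed
    also have "\<dots> \<le> (\<Sum>i<n. (x i)\<^sup>2)" by (intro sum_mono2) (auto simp: N_def)
    finally show ?thesis using x1 by simp
  qed
  have \<alpha>1: "\<alpha> s \<le> 1" if "s \<in> S" for s
    using member_le_sum[of s S \<alpha>] that fS \<alpha>0 \<alpha>S by fastforce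
  define F where "F = (\<lambda>s t. p s * p t * edge_sum a (I s) (I t) / (real n * D))"
  \<comment> \<open>Since \<open>x i * x j * n\<close> is at most four times the product of the two
    level magnitudes, only level pairs passing this test can contain a heavy pair.\<close>
  define h where "h = (\<lambda>s t. if D \<le> 4 * p s * p t then F s t else 0)"
  define g2 where "g2 = (\<lambda>s t. if p t * D \<le> p s then p t * D / p s else 0)"
  define g3 where "g3 = (\<lambda>s t. if p s \<le> p t * D then p s / (p t * D) else 0)"
  define g4 where "g4 = (\<lambda>s. if 4 * p s \<le> D then p s / D else 0)"
  define g5 where "g5 = (\<lambda>s t. if D \<le> 4 * p s * p t then D / (p s * p t) else 0)"
  have g0: "0 \<le> g2 s t" "0 \<le> g3 s t" "0 \<le> g4 s" "0 \<le> g5 s t" for s t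
    using p0 D(1) by (auto simp: g2_def g3_def g4_def g5_def intro!: divide_nonneg_nonneg mult_nonneg_nonneg less_imp_le[OF p0])
  \<comment> \<open>The sum of all five bounds, so that the alternative valid for a given pair need
    not be recorded.\<close>
  define G where "G = (\<lambda>s t. 4 * exp 4 * (\<alpha> s * \<alpha> t) + exp 4 * (\<alpha> s * g2 s t)
     + 5 * c * (\<alpha> t * g3 s t) + 3 * c * (\<alpha> t * g4 s) + \<alpha> s * g5 s t)"
  have esym: "edge_sum a A B = edge_sum a B A" for A B
    unfolding edge_sum_def by (subst sum.swap) (simp add: sym)
  have e0: "edge_sum a A B \<ge> 0" for A B unfolding edge_sum_def by (intro sum_nonneg a0)
  have G0: "G s t \<ge> 0" for s t
    unfolding G_def using \<alpha>0 g0 c by (intro add_nonneg_nonneg mult_nonneg_nonneg) auto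
  have FG: "F s t \<le> G s t" if st: "s \<in> S" "t \<in> S" and le: "card (I s) \<le> card (I t)" and hv: "D \<le> 4 * p s * p t" for s t
  proof -
    have dg: "edge_sum a (I s) (I t) \<le> exp 4 * (real (card (I s)) * (real n * q))"
    proof -
      have "edge_sum a (I s) (I t) \<le> (\<Sum>i\<in>I s. \<Sum>j<n. a i j)"
        unfolding edge_sum_def using I a0 by (intro sum_mono sum_mono2) auto
      also have "\<dots> \<le> (\<Sum>i\<in>I s. exp 4 * (real n * q))" using I(2) deg by (intro sum_mono) auto
      finally show ?thesis by (simp add: mult_ac)
    qed
    have ds: "edge_sum a (I s) (I t) \<le> exp 4 * (real (card (I s)) * real (card (I t)) * q) \<or>
       edge_sum a (I s) (I t) * ln (edge_sum a (I s) (I t) / (real (card (I s)) * real (card (I t)) * q))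
       \<le> c * real (card (I t)) * (1 + ln (real n / real (card (I t))))"
      using disc I(2) Ine[OF st(1)] le unfolding discrepancy_property_def by blast
    have "F s t \<le> 4 * exp 4 * (\<alpha> s * \<alpha> t) \<or>
      (p t * D \<le> p s \<and> F s t \<le> exp 4 * (\<alpha> s * (p t * D / p s))) \<or>
      (p s \<le> p t * D \<and> F s t \<le> 5 * c * (\<alpha> t * (p s / (p t * D)))) \<or>
      (4 * p s \<le> D \<and> F s t \<le> 3 * c * (\<alpha> t * (p s / D))) \<or> F s t \<le> \<alpha> s * (D / (p s * p t))"
      unfolding F_def
      by (rule dyadic_pair_cases[where I="real (card (I s))" and J="real (card (I t))" and q=q])
        (use n q c p0 D cI st e0 dg ds \<alpha>1 hv in \<open>auto simp: \<alpha>_def\<close>)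
    hence "F s t \<le> 4 * exp 4 * (\<alpha> s * \<alpha> t) \<or> F s t \<le> exp 4 * (\<alpha> s * g2 s t) \<or>
      F s t \<le> 5 * c * (\<alpha> t * g3 s t) \<or> F s t \<le> 3 * c * (\<alpha> t * g4 s) \<or> F s t \<le> \<alpha> s * g5 s t"
      using hv by (auto simp: g2_def g3_def g4_def g5_def)
    moreover have "0 \<le> 4 * exp 4 * (\<alpha> s * \<alpha> t)" "0 \<le> exp 4 * (\<alpha> s * g2 s t)" "0 \<le> 5 * c * (\<alpha> t * g3 s t)"
      "0 \<le> 3 * c * (\<alpha> t * g4 s)" "0 \<le> \<alpha> s * g5 s t"
      using \<alpha>0 g0 c by (auto intro!: mult_nonneg_nonneg)
    ultimately show ?thesis unfolding G_def by linarith
  qed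
  \<comment> \<open>The alternatives require the smaller level set first. \<open>F\<close> is
    symmetric, so one of the two orders always qualifies.\<close>
  have hG: "h s t \<le> G s t + G t s" if st: "s \<in> S" "t \<in> S" for s t
  proof (cases "D \<le> 4 * p s * p t")
    case False
    thus ?thesis using G0[of s t] G0[of t s] by (simp add: h_def)
  next
    case True
    have Fs: "F s t = F t s" by (simp add: F_def esym[of "I s" "I t"] mult_ac)
    show ?thesis
    proof (cases "card (I s) \<le> card (I t)")
      case True
      thus ?thesis using FG[OF st True] \<open>D \<le> 4 * p s * p t\<close> G0[of t s] by (simp add: h_def)
    next
      case False
      hence "F t s \<le> G t s" using FG[of t s] st True by (simp add: mult_ac)
      thus ?thesis using True Fs G0[of s t] by (simp add: h_def)
    qed
  qed
  have GS: "(\<Sum>s\<in>S. \<Sum>t\<in>S. G s t) \<le> 6 * exp 4 + 16 * c + 8"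
  proof -
    have w: "(\<Sum>s\<in>S. \<alpha> s * f s) \<le> K" if "\<And>s. s \<in> S \<Longrightarrow> f s \<le> K" "K \<ge> 0" for f and K :: real
    proof -
      have "(\<Sum>s\<in>S. \<alpha> s * f s) \<le> (\<Sum>s\<in>S. \<alpha> s * K)" using that \<alpha>0 by (intro sum_mono mult_left_mono) auto
      also have "\<dots> = (\<Sum>s\<in>S. \<alpha> s) * K" by (simp add: sum_distrib_right)
      also have "\<dots> \<le> 1 * K" using \<alpha>S that(2) by (intro mult_right_mono) auto
      finally show ?thesis by simp
    qed
    have pw: "(\<Sum>s\<in>S. if p s \<le> K then p s else 0) \<le> 2 * K" if "K \<ge> 0" for K
      using sum_powers_of_two_le[OF fS that] unfolding p_def .
    have pn: "(\<Sum>s\<in>S. if 1 / p s \<le> K then 1 / p s else 0) \<le> 2 * K" if "K \<ge> 0" for K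
      using sum_negative_powers_of_two_le[OF fS that] unfolding p_def .
    have T1: "(\<Sum>s\<in>S. \<Sum>t\<in>S. \<alpha> s * \<alpha> t) \<le> 1"
      unfolding sum_distrib_left[symmetric] by (intro w) (use \<alpha>S in auto)
    have T2: "(\<Sum>s\<in>S. \<Sum>t\<in>S. \<alpha> s * g2 s t) \<le> 2"
      unfolding sum_distrib_left[symmetric]
    proof (intro w)
      fix s assume "s \<in> S"
      have "(\<Sum>t\<in>S. g2 s t) =
          (D / p s) * (\<Sum>t\<in>S. if p t \<le> p s / D then p t else 0)"
        unfolding sum_distrib_left g2_def using D(1) by (intro sum.cong) (auto simp: pos_le_divide_eq)
      also have "\<dots> \<le> (D / p s) * (2 * (p s / D))"
        using D(1) p0[of s] by (intro mult_left_mono pw) auto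
      also have "\<dots> = 2" using D(1) p0[of s] by simp
      finally show "(\<Sum>t\<in>S. g2 s t) \<le> 2" .
    qed simp
    have T3: "(\<Sum>s\<in>S. \<Sum>t\<in>S. \<alpha> t * g3 s t) \<le> 2"
    proof (subst sum.swap, unfold sum_distrib_left[symmetric], intro w)
      fix t assume "t \<in> S"
      have "(\<Sum>s\<in>S. g3 s t) =
          (1 / (p t * D)) * (\<Sum>s\<in>S. if p s \<le> p t * D then p s else 0)"
        unfolding sum_distrib_left g3_def by (intro sum.cong) auto
      also have "\<dots> \<le> (1 / (p t * D)) * (2 * (p t * D))"
        using D(1) p0[of t] by (intro mult_left_mono pw) auto
      also have "\<dots> = 2" using D(1) p0[of t] by simp
      finally show "(\<Sum>s\<in>S. g3 s t) \<le> 2" .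
    qed simp
    have T4: "(\<Sum>s\<in>S. \<Sum>t\<in>S. \<alpha> t * g4 s) \<le> 2"
    proof (subst sum.swap, unfold sum_distrib_left[symmetric], intro w)
      fix t assume "t \<in> S"
      have "(\<Sum>s\<in>S. g4 s) = (1 / D) * (\<Sum>s\<in>S. if p s \<le> D / 4 then p s else 0)"
        unfolding sum_distrib_left g4_def by (intro sum.cong) auto
      also have "\<dots> \<le> (1 / D) * (2 * (D / 4))"
        using D(1) by (intro mult_left_mono pw) auto
      also have "\<dots> \<le> 2" using D(1) by simp
      finally show "(\<Sum>s\<in>S. g4 s) \<le> 2" .
    qed simp
    \<comment> \<open>Here the series in \<open>t\<close> runs downwards: its terms are multiples of
      \<open>1 / p t\<close>, cut off by the heaviness condition.\<close>
    have T5: "(\<Sum>s\<in>S. \<Sum>t\<in>S. \<alpha> s * g5 s t) \<le> 8"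
      unfolding sum_distrib_left[symmetric]
    proof (intro w)
      fix s assume "s \<in> S"
      have "(\<Sum>t\<in>S. g5 s t) =
          (D / p s) * (\<Sum>t\<in>S. if 1 / p t \<le> 4 * p s / D then 1 / p t else 0)"
        unfolding sum_distrib_left
      proof (intro sum.cong refl)
        fix t
        have "1 / p t \<le> 4 * p s / D \<longleftrightarrow> D \<le> 4 * p s * p t"
          using D(1) p0[of t] by (simp add: field_simps)
        thus "g5 s t = D / p s * (if 1 / p t \<le> 4 * p s / D then 1 / p t else 0)" by (auto simp: g5_def)
      qed
      also have "\<dots> \<le> (D / p s) * (2 * (4 * p s / D))"
        using D(1) p0[of s] by (intro mult_left_mono pn) auto
      also have "\<dots> = 8" using D(1) p0[of s] by simp
      finally show "(\<Sum>t\<in>S. g5 s t) \<le> 8" .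
    qed simp
    have "(\<Sum>s\<in>S. \<Sum>t\<in>S. G s t) = 4 * exp 4 * (\<Sum>s\<in>S. \<Sum>t\<in>S. \<alpha> s * \<alpha> t)
     + exp 4 * (\<Sum>s\<in>S. \<Sum>t\<in>S. \<alpha> s * g2 s t)
     + 5 * c * (\<Sum>s\<in>S. \<Sum>t\<in>S. \<alpha> t * g3 s t)
     + 3 * c * (\<Sum>s\<in>S. \<Sum>t\<in>S. \<alpha> t * g4 s)
     + (\<Sum>s\<in>S. \<Sum>t\<in>S. \<alpha> s * g5 s t)"
      unfolding G_def by (simp only: sum.distrib sum_distrib_left)
    also have "\<dots> \<le> 4 * exp 4 * 1 + exp 4 * 2 + 5 * c * 2 + 3 * c * 2 + 8"
      using T1 T2 T3 T4 T5 c by (intro add_mono mult_left_mono) auto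
    finally show ?thesis by simp
  qed
  let ?g = "\<lambda>i j. if x i * x j > D / real n then x i * x j * a i j else 0"
  have z: "?g i j = 0" if "i \<notin> N \<or> j \<notin> N" "i < n" "j < n" for i j
  proof -
    have "x i = 0 \<or> x j = 0" using that x0[of i] x0[of j] by (auto simp: N_def)
    thus ?thesis by auto
  qed
  have gN: "(\<Sum>i<n. \<Sum>j<n. ?g i j) = (\<Sum>i\<in>N. \<Sum>j<n. ?g i j)"
    by (rule sum.mono_neutral_right) (use z in \<open>auto simp: N_def intro!: sum.neutral\<close>)
  have gNN: "(\<Sum>i\<in>N. \<Sum>j<n. ?g i j) = (\<Sum>i\<in>N. \<Sum>j\<in>N. ?g i j)"
    by (rule sum.cong[OF refl], rule sum.mono_neutral_right) (use z in \<open>auto simp: N_def\<close>)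
  let ?lv = "\<lambda>i j. if D \<le> 4 * p (lev i) * p (lev j) then 4 * (p (lev i) * p (lev j)) / real n else 0"
  have "(\<Sum>i\<in>N. \<Sum>j\<in>N. ?g i j) \<le> (\<Sum>i\<in>N. \<Sum>j\<in>N. ?lv i j * a i j)"
  proof (intro sum_mono)
    fix i j assume ij: "i \<in> N" "j \<in> N"
    have "(x i * sqrt (real n)) * (x j * sqrt (real n)) \<le> (2 * p (lev i)) * (2 * p (lev j))"
      by (rule mult_mono) (use lev[OF ij(1)] lev[OF ij(2)] x0 p0 in \<open>auto intro: less_imp_le\<close>)
    hence "x i * x j * real n \<le> 4 * (p (lev i) * p (lev j))" using n by (simp add: mult_ac)
    hence b: "x i * x j \<le> 4 * (p (lev i) * p (lev j)) / real n" using n by (simp add: pos_le_divide_eq)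
    show "?g i j \<le> ?lv i j * a i j"
    proof (cases "x i * x j > D / real n")
      case True
      hence "D / real n \<le> 4 * (p (lev i) * p (lev j)) / real n" using b by linarith
      hence "D \<le> 4 * p (lev i) * p (lev j)" using n by (simp add: divide_le_cancel mult.assoc)
      thus ?thesis using True mult_right_mono[OF b a0[of i j]] by simp
    next
      case False
      thus ?thesis using a0[of i j] p0[of "lev i"] p0[of "lev j"] by simp
    qed
  qed
  also have "\<dots> = (\<Sum>s\<in>S. \<Sum>i\<in>I s. \<Sum>t\<in>S. \<Sum>j\<in>I t. ?lv i j * a i j)"
    by (simp only: group)
  also have "\<dots> = (\<Sum>s\<in>S. \<Sum>t\<in>S. \<Sum>i\<in>I s. \<Sum>j\<in>I t. ?lv i j * a i j)"
    by (intro sum.cong refl sum.swap)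
  also have "\<dots> = (\<Sum>s\<in>S. \<Sum>t\<in>S. 4 * D * h s t)"
  proof (intro sum.cong refl)
    fix s t
    have "(\<Sum>i\<in>I s. \<Sum>j\<in>I t. ?lv i j * a i j)
      = (\<Sum>i\<in>I s. \<Sum>j\<in>I t. (if D \<le> 4 * p s * p t then 4 * (p s * p t) / real n else 0) * a i j)"
      by (intro sum.cong refl) (auto simp: I_def)
    also have "\<dots> = (if D \<le> 4 * p s * p t then 4 * (p s * p t) / real n else 0) * edge_sum a (I s) (I t)"
      by (simp only: edge_sum_def sum_distrib_left)
    also have "\<dots> = 4 * D * h s t" using D(1) by (auto simp: h_def F_def)
    finally show "(\<Sum>i\<in>I s. \<Sum>j\<in>I t. ?lv i j * a i j)
      = 4 * D * h s t" .
  qed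
  also have "\<dots> \<le> (\<Sum>s\<in>S. \<Sum>t\<in>S. 4 * D * (G s t + G t s))"
    using hG D(1) by (intro sum_mono mult_left_mono) auto
  also have "\<dots> = 4 * D * ((\<Sum>s\<in>S. \<Sum>t\<in>S. G s t) + (\<Sum>s\<in>S. \<Sum>t\<in>S. G t s))"
    by (simp only: sum_distrib_left[symmetric] sum.distrib)
  also have "(\<Sum>s\<in>S. \<Sum>t\<in>S. G t s) = (\<Sum>s\<in>S. \<Sum>t\<in>S. G s t)" by (rule sum.swap)
  also have "4 * D * ((\<Sum>s\<in>S. \<Sum>t\<in>S. G s t) + (\<Sum>s\<in>S. \<Sum>t\<in>S. G s t)) \<le>
      4 * D * ((6 * exp 4 + 16 * c + 8) + (6 * exp 4 + 16 * c + 8))"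
    using GS D(1) by (intro mult_left_mono add_mono) auto
  finally show ?thesis unfolding gN[unfolded gNN, unfolded D_def] by (simp add: D_def algebra_simps)
qed

section \<open>Concentration of the centred adjacency matrix\<close>

text \<open>Markov's inequality for the exponential, with the tilt absorbed into the weights
  \<open>c\<close>. Independence turns the moment generating function into a product, and
  \<open>1 + y \<le> exp y\<close> is applied factor by factor.\<close>

lemma bernoulli_sum_chernoff:
  assumes fin: "finite A" and p: "\<And>e. e \<in> A \<Longrightarrow> 0 \<le> p e \<and> p e \<le> 1"
  shows "measure_pmf.prob (Pi_pmf A False (\<lambda>e. bernoulli_pmf (p e))) {E. u \<le> (\<Sum>e\<in>A. c e * of_bool (E e))}
    \<le> exp ((\<Sum>e\<in>A. p e * (exp (c e) - 1)) - u)"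
proof -
  let ?M = "Pi_pmf A False (\<lambda>e. bernoulli_pmf (p e))"
  let ?S = "{E. u \<le> (\<Sum>e\<in>A. c e * of_bool (E e))}"
  have "finite (PiE_dflt A False (\<lambda>_. UNIV :: bool set))" using fin by (intro finite_PiE_dflt) auto
  moreover have "set_pmf ?M \<subseteq> PiE_dflt A False (\<lambda>_. UNIV)"
    using set_Pi_pmf_subset'[OF fin, of False "\<lambda>e. bernoulli_pmf (p e)"] by (auto simp: PiE_dflt_def)
  ultimately have fs: "finite (set_pmf ?M)" by (rule finite_subset[rotated])
  have int: "integrable ?M f" for f :: "_ \<Rightarrow> real" using fs by (rule integrable_measure_pmf_finite)
  have "measure_pmf.prob ?M ?S = measure_pmf.expectation ?M (indicator ?S)" by simp
  also have "\<dots> \<le> measure_pmf.expectation ?M (\<lambda>E. exp (- u) * (\<Prod>e\<in>A. exp (c e * of_bool (E e))))"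
  proof (intro integral_mono int)
    fix E
    have "exp (- u) * (\<Prod>e\<in>A. exp (c e * of_bool (E e))) = exp ((\<Sum>e\<in>A. c e * of_bool (E e)) - u)"
      using fin by (simp only: exp_sum[symmetric] exp_add[symmetric]) simp
    thus "indicator ?S E \<le> exp (- u) * (\<Prod>e\<in>A. exp (c e * of_bool (E e)))"
      by (auto simp: indicator_def)
  qed
  also have "\<dots> = exp (- u) * (\<Prod>e\<in>A. measure_pmf.expectation (bernoulli_pmf (p e)) (\<lambda>b. exp (c e * of_bool b)))"
    using fin by (subst integral_mult_right_zero, subst expectation_prod_Pi_pmf)
      (auto intro!: integrable_measure_pmf_finite)
  also have "\<dots> = exp (- u) * (\<Prod>e\<in>A. 1 + p e * (exp (c e) - 1))"
    using p by (intro arg_cong2[where f="(*)"] refl prod.cong) (simp_all add: algebra_simps)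
  also have "\<dots> \<le> exp (- u) * (\<Prod>e\<in>A. exp (p e * (exp (c e) - 1)))"
  proof (intro mult_left_mono prod_mono conjI)
    fix e assume e: "e \<in> A"
    have "0 \<le> (1 - p e) + p e * exp (c e)" using p[OF e] by simp
    also have "\<dots> = 1 + p e * (exp (c e) - 1)" by (simp add: algebra_simps)
    finally show "0 \<le> 1 + p e * (exp (c e) - 1)" .
    show "1 + p e * (exp (c e) - 1) \<le> exp (p e * (exp (c e) - 1))" by (rule exp_ge_add_one_self)
  qed simp
  also have "\<dots> = exp ((\<Sum>e\<in>A. p e * (exp (c e) - 1)) - u)"
    using fin by (simp add: exp_sum exp_diff exp_minus field_simps)
  finally show ?thesis .
qed

lemma exp_le_quadratic:
  assumes "\<bar>y\<bar> \<le> (1::real)"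
  shows "exp y - 1 \<le> y + y\<^sup>2"
proof (cases "y \<ge> 0")
  case True
  thus ?thesis using exp_bound[of y] assms by simp
next
  case False
  define z where "z = - y"
  have z: "z > 0" using False by (simp add: z_def)
  \<comment> \<open>The product on the right is 1 + z^3.\<close>
  have "1 * 1 \<le> (1 - z + z\<^sup>2) * (1 + z)"
    using z by (simp add: algebra_simps power2_eq_square)
  also have "\<dots> \<le> (1 - z + z\<^sup>2) * exp z"
  proof (intro mult_left_mono)
    have "0 \<le> (1 - z)\<^sup>2 + z" using z by simp
    also have "(1 - z)\<^sup>2 + z = 1 - z + z\<^sup>2" by (simp add: power2_eq_square algebra_simps)
    finally show "0 \<le> 1 - z + z\<^sup>2" .
  qed (simp add: exp_ge_add_one_self)
  finally have "exp (- z) \<le> 1 - z + z\<^sup>2"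
    by (simp add: exp_minus divide_le_eq inverse_eq_divide)
  thus ?thesis by (simp add: z_def)
qed

lemma finite_pairs [simp]: "finite (pairs n)"
  by (rule finite_subset[of _ "{..<n} \<times> {..<n}"]) (auto simp: pairs_def)

text \<open>Matrix forms sum over ordered pairs, whereas the independent edge variables are indexed
  by \<open>i < j\<close>; this passes from one to the other.\<close>

lemma sum_square_eq_sum_pairs:
  fixes F :: "nat \<Rightarrow> nat \<Rightarrow> real"
  assumes "\<And>i. i < n \<Longrightarrow> F i i = 0"
  shows "(\<Sum>i<n. \<Sum>j<n. F i j) = (\<Sum>(i,j)\<in>pairs n. F i j + F j i)"
proof -
  let ?D = "{(i,j). i = j \<and> i < n}"
  have U: "{..<n} \<times> {..<n} = (pairs n \<union> prod.swap ` pairs n) \<union> ?D"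
    by (auto simp: pairs_def image_iff)
  have fD: "finite ?D" by (rule finite_subset[of _ "{..<n} \<times> {..<n}"]) auto
  have "(\<Sum>i<n. \<Sum>j<n. F i j) = (\<Sum>(i,j)\<in>{..<n} \<times> {..<n}. F i j)" by (simp add: sum.cartesian_product)
  also have "\<dots> = (\<Sum>(i,j)\<in>pairs n \<union> prod.swap ` pairs n. F i j) + (\<Sum>(i,j)\<in>?D. F i j)"
    unfolding U by (intro sum.union_disjoint finite_UnI finite_imageI finite_pairs fD) (auto simp: pairs_def)
  also have "(\<Sum>(i,j)\<in>?D. F i j) = 0" using assms by (intro sum.neutral) auto
  also have "(\<Sum>(i,j)\<in>pairs n \<union> prod.swap ` pairs n. F i j) =
      (\<Sum>(i,j)\<in>pairs n. F i j) + (\<Sum>(i,j)\<in>prod.swap ` pairs n. F i j)"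
    by (intro sum.union_disjoint finite_imageI finite_pairs) (auto simp: pairs_def)
  also have "(\<Sum>(i,j)\<in>prod.swap ` pairs n. F i j) = (\<Sum>(i,j)\<in>pairs n. F j i)"
    by (subst sum.reindex) (auto simp: case_prod_unfold)
  finally show ?thesis by (simp add: sum.distrib case_prod_unfold)
qed

lemma edge_sum_as_square_sum:
  fixes n :: nat
  assumes "I \<subseteq> {..<n}" "J \<subseteq> {..<n}"
  shows "edge_sum a I J = (\<Sum>i<n. \<Sum>j<n. of_bool (i \<in> I \<and> j \<in> J) * a i j)"
proof -
  have "(\<Sum>i<n. \<Sum>j<n. of_bool (i \<in> I \<and> j \<in> J) * a i j) = (\<Sum>i\<in>I. \<Sum>j<n. of_bool (i \<in> I \<and> j \<in> J) * a i j)"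
    using assms by (intro sum.mono_neutral_right) auto
  also have "\<dots> = (\<Sum>i\<in>I. \<Sum>j\<in>J. of_bool (i \<in> I \<and> j \<in> J) * a i j)"
    using assms by (intro sum.cong refl sum.mono_neutral_right) auto
  also have "\<dots> = edge_sum a I J" unfolding edge_sum_def by (intro sum.cong refl) auto
  finally show ?thesis by simp
qed

definition adj :: "nat \<Rightarrow> (nat \<times> nat \<Rightarrow> bool) \<Rightarrow> nat \<Rightarrow> nat \<Rightarrow> real" where
  "adj n E i j = of_bool (sym_of n E i j)"

lemma adj_sym: "adj n E i j = adj n E j i" by (auto simp: adj_def sym_of_def)
lemma adj_nonneg: "0 \<le> adj n E i j" by (simp add: adj_def)
lemma adj_diag: "adj n E i i = 0" by (simp add: adj_def sym_of_def)
lemma adj_pair: "(i, j) \<in> pairs n \<Longrightarrow> adj n E i j = of_bool (E (i,j)) \<and> adj n E j i = of_bool (E (i,j))"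
  by (auto simp: adj_def sym_of_def pairs_def)

definition centered_adj :: "nat \<Rightarrow> (nat \<times> nat \<Rightarrow> real) \<Rightarrow> (nat \<times> nat \<Rightarrow> bool) \<Rightarrow> nat \<Rightarrow> nat \<Rightarrow> real" where
  "centered_adj n p E i j = adj n E i j - (if i < j then p (i,j) else if j < i then p (j,i) else 0)"

lemma centered_adj_sym: "centered_adj n p E i j = centered_adj n p E j i"
  by (auto simp: centered_adj_def adj_sym)

lemma quadratic_form_centered_adj:
  "quad_form {..<n} (centered_adj n p E) x =
    (\<Sum>(i,j)\<in>pairs n. 2 * x i * x j * (of_bool (E (i,j)) - p (i,j)))"
proof -
  have "quad_form {..<n} (centered_adj n p E) x =
      (\<Sum>i<n. \<Sum>j<n. x i * (centered_adj n p E i j * x j))"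
    by (simp add: inner_on_def app_on_def sum_distrib_left)
  also have "\<dots> = (\<Sum>(i,j)\<in>pairs n. x i * (centered_adj n p E i j * x j) + x j * (centered_adj n p E j i * x i))"
    by (rule sum_square_eq_sum_pairs) (simp add: centered_adj_def adj_diag)
  also have "\<dots> = (\<Sum>(i,j)\<in>pairs n. 2 * x i * x j * (of_bool (E (i,j)) - p (i,j)))"
  proof (rule sum.cong[OF refl])
    fix e assume "e \<in> pairs n"
    then obtain i j where e: "e = (i, j)" "(i, j) \<in> pairs n" by (cases e) auto
    have "centered_adj n p E i j = of_bool (E (i,j)) - p (i,j)"
      using adj_pair[OF e(2), of E] e(2) by (simp add: centered_adj_def pairs_def)
    hence w: "centered_adj n p E i j = of_bool (E (i,j)) - p (i,j)" "centered_adj n p E j i = of_bool (E (i,j)) - p (i,j)"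
      by (simp_all only: centered_adj_sym[of n p E j i])
    show "(case e of (i, j) \<Rightarrow> x i * (centered_adj n p E i j * x j) + x j * (centered_adj n p E j i * x i)) =
      (case e of (i, j) \<Rightarrow> 2 * x i * x j * (of_bool (E (i,j)) - p (i,j)))"
      unfolding e(1) prod.case w by (simp add: algebra_simps)
  qed
  finally show ?thesis .
qed

lemma sum_pairs_squares_le:
  fixes x :: "nat \<Rightarrow> real"
  assumes "(\<Sum>i<n. (x i)\<^sup>2) \<le> 1"
  shows "(\<Sum>(i,j)\<in>pairs n. 2 * (x i)\<^sup>2 * (x j)\<^sup>2) \<le> 1"
proof -
  let ?F = "\<lambda>i j. if i = j then 0 else (x i)\<^sup>2 * (x j)\<^sup>2"
  have "(\<Sum>(i,j)\<in>pairs n. 2 * (x i)\<^sup>2 * (x j)\<^sup>2) = (\<Sum>(i,j)\<in>pairs n. ?F i j + ?F j i)"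
    by (intro sum.cong refl) (auto simp: pairs_def)
  also have "\<dots> = (\<Sum>i<n. \<Sum>j<n. ?F i j)"
    by (rule sum_square_eq_sum_pairs[symmetric]) simp
  also have "\<dots> \<le> (\<Sum>i<n. \<Sum>j<n. (x i)\<^sup>2 * (x j)\<^sup>2)" by (intro sum_mono) auto
  also have "\<dots> = (\<Sum>i<n. (x i)\<^sup>2) * (\<Sum>i<n. (x i)\<^sup>2)" by (simp add: sum_product)
  also have "\<dots> \<le> 1 * 1" using assms by (intro mult_mono) (auto intro: sum_nonneg)
  finally show ?thesis by simp
qed

text \<open>The factor 2 counts both orientations of an edge. The cutoff at \<open>D / n\<close> is
  the largest that keeps the exponents of the Chernoff bound in the range of
  \<open>exp_le_quadratic\<close> at the tilt used for light pairs.\<close>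

definition light_coeff :: "nat \<Rightarrow> real \<Rightarrow> (nat \<Rightarrow> real) \<Rightarrow> nat \<times> nat \<Rightarrow> real" where
  "light_coeff n D x = (\<lambda>(i,j). if \<bar>x i * x j\<bar> \<le> D / real n then 2 * x i * x j else 0)"

abbreviation edge_pmf :: "nat \<Rightarrow> (nat \<times> nat \<Rightarrow> real) \<Rightarrow> (nat \<times> nat \<Rightarrow> bool) pmf" where
  "edge_pmf n p \<equiv> Pi_pmf (pairs n) False (\<lambda>e. bernoulli_pmf (p e))"

abbreviation light_form ::
  "nat \<Rightarrow> real \<Rightarrow> (nat \<times> nat \<Rightarrow> real) \<Rightarrow> (nat \<Rightarrow> real) \<Rightarrow> (nat \<times> nat \<Rightarrow> bool) \<Rightarrow> real" where
  "light_form n D p x E \<equiv> (\<Sum>e\<in>pairs n. light_coeff n D x e * (of_bool (E e) - p e))"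

locale bounded_edges =
  fixes n :: nat and p :: "nat \<times> nat \<Rightarrow> real" and q :: real
  assumes n: "n \<ge> 1" and p: "\<And>e. e \<in> pairs n \<Longrightarrow> 0 \<le> p e \<and> p e \<le> q" and q: "0 < q" "q \<le> 1"
begin

abbreviation pr :: "(nat \<times> nat \<Rightarrow> bool) set \<Rightarrow> real" where
  "pr \<equiv> measure_pmf.prob (edge_pmf n p)"

text \<open>Chernoff with tilt \<open>ln r / 2\<close>, where \<open>r\<close> is the ratio of
  \<open>m\<close> to the nominal size. The half is there because an edge with both endpoints in
  both sets is counted twice: weights up to 2 then produce at most \<open>r\<close>. The mean term
  is at most \<open>m\<close>, and \<open>ln r \<ge> 4\<close> lets half of the exponent absorb
  it.\<close>

lemma edge_count_tail:
  assumes IJ: "I \<subseteq> {..<n}" "J \<subseteq> {..<n}" "I \<noteq> {}" "J \<noteq> {}"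
    and m: "m \<ge> exp 4 * (real (card I) * real (card J) * q)"
  shows "pr {E. m \<le> edge_sum (adj n E) I J}
    \<le> exp (- m * ln (m / (real (card I) * real (card J) * q)) / 4)"
proof -
  define \<mu> where "\<mu> = real (card I) * real (card J) * q"
  have fin: "finite I" "finite J" using IJ finite_subset by blast+
  have \<mu>: "\<mu> > 0" using fin IJ q by (simp add: \<mu>_def card_gt_0_iff)
  define r where "r = m / \<mu>"
  have m0: "m > 0" using m \<mu> exp_gt_zero[of "4::real"] unfolding \<mu>_def[symmetric]
    by (meson less_le_trans mult_pos_pos)
  have r4: "r \<ge> exp 4" using m \<mu> unfolding r_def \<mu>_def[symmetric] by (simp add: pos_le_divide_eq)
  hence r1: "r > 1" using one_less_exp_iff[of "4::real"] by linarith
  have "ln (exp 4) \<le> ln r" using r4 r1 by (subst ln_le_cancel_iff) auto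
  hence lr: "ln r \<ge> 4" by simp
  define w where "w = (\<lambda>(i,j). of_bool (i \<in> I \<and> j \<in> J) + of_bool (j \<in> I \<and> i \<in> J) :: real)"
  have es: "edge_sum (adj n E) I J = (\<Sum>e\<in>pairs n. w e * of_bool (E e))" for E
    unfolding edge_sum_as_square_sum[OF IJ(1,2)]
  proof (subst sum_square_eq_sum_pairs, simp add: adj_diag, rule sum.cong[OF refl])
    fix e assume "e \<in> pairs n"
    then obtain i j where e: "e = (i, j)" "(i, j) \<in> pairs n" by (cases e) auto
    show "(case e of (i, j) \<Rightarrow> of_bool (i \<in> I \<and> j \<in> J) * adj n E i j + of_bool (j \<in> I \<and> i \<in> J) * adj n E j i)
        = w e * of_bool (E e)"
      using adj_pair[OF e(2), of E] unfolding e(1) w_def prod.case by (simp only: distrib_right)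
  qed
  have ws: "(\<Sum>e\<in>pairs n. w e) \<le> real (card I) * real (card J)"
  proof -
    have "(\<Sum>e\<in>pairs n. w e) = edge_sum (adj n (\<lambda>_. True)) I J" by (simp add: es)
    also have "\<dots> \<le> (\<Sum>i\<in>I. \<Sum>j\<in>J. 1)" unfolding edge_sum_def by (intro sum_mono) (simp add: adj_def)
    finally show ?thesis by simp
  qed
  have "pr {E. m \<le> edge_sum (adj n E) I J}
      = pr
        {E. ln r / 2 * m \<le> (\<Sum>e\<in>pairs n. (ln r / 2 * w e) * of_bool (E e))}"
  proof -
    have "(m \<le> edge_sum (adj n E) I J) = (ln r / 2 * m \<le> (\<Sum>e\<in>pairs n. (ln r / 2 * w e) * of_bool (E e)))" for E
    proof -
      have "(\<Sum>e\<in>pairs n. (ln r / 2 * w e) * of_bool (E e)) = ln r / 2 * edge_sum (adj n E) I J"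
        unfolding es sum_distrib_left by (simp only: mult.assoc)
      moreover have "ln r / 2 > 0" using lr by simp
      ultimately show ?thesis by (simp only: mult_le_cancel_left_pos)
    qed
    thus ?thesis by simp
  qed
  also have "\<dots> \<le> exp ((\<Sum>e\<in>pairs n. p e * (exp (ln r / 2 * w e) - 1)) - ln r / 2 * m)"
    using p q by (intro bernoulli_sum_chernoff) (auto intro: order_trans)
  also have "\<dots> \<le> exp (m - ln r / 2 * m)"
  proof -
    have "(\<Sum>e\<in>pairs n. p e * (exp (ln r / 2 * w e) - 1)) \<le> (\<Sum>e\<in>pairs n. q * (r * w e))"
    proof (intro sum_mono mult_mono)
      fix e assume e: "e \<in> pairs n"
      have "w e = 0 \<or> w e = 1 \<or> w e = 2" by (auto simp: w_def split: prod.splits)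
      moreover have "exp (ln r / 2) \<le> exp (ln r)" using lr by simp
      ultimately show "exp (ln r / 2 * w e) - 1 \<le> r * w e" using r1 by auto
      show "0 \<le> exp (ln r / 2 * w e) - 1" using lr by (simp add: w_def split: prod.splits)
    qed (use p q in auto)
    also have "\<dots> = q * r * (\<Sum>e\<in>pairs n. w e)" by (simp add: sum_distrib_left mult.assoc)
    also have "\<dots> \<le> q * r * (real (card I) * real (card J))" using ws q r1 by (intro mult_left_mono) auto
    also have "\<dots> = r * \<mu>" by (simp add: \<mu>_def)
    also have "\<dots> = m" using \<mu> by (simp add: r_def)
    finally show ?thesis by simp
  qed
  also have "\<dots> \<le> exp (- m * ln r / 4)"
  proof -
    have "m * 4 \<le> m * ln r" using lr m0 by (intro mult_left_mono) auto
    thus ?thesis by (simp add: algebra_simps)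
  qed
  finally show ?thesis by (simp add: r_def \<mu>_def)
qed

text \<open>Weight each subset by \<open>c ^ card I\<close> with \<open>c = y / n\<close>: subsets
  of size at most \<open>y\<close> have weight at least \<open>c ^ y\<close>, and all subsets
  together weigh \<open>(1 + c) ^ n\<close>, at most \<open>exp y\<close>.\<close>

lemma card_small_subsets_le:
  assumes "1 \<le> y" "y \<le> n"
  shows "real (card {I. I \<subseteq> {..<n} \<and> card I \<le> y}) \<le> exp (real y * (1 + ln (real n / real y)))"
proof -
  define c where "c = real y / real n"
  have c: "c > 0" "c \<le> 1" using assms by (auto simp: c_def)
  let ?S = "{I. I \<subseteq> {..<n} \<and> card I \<le> y}"
  have "real (card ?S) = (\<Sum>I\<in>?S. 1)" by simp
  also have "\<dots> \<le> (\<Sum>I\<in>?S. (1 / c) ^ y * c ^ card I)"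
  proof (intro sum_mono)
    fix I assume "I \<in> ?S"
    hence "c ^ y \<le> c ^ card I" using c by (intro power_decreasing) auto
    thus "1 \<le> (1 / c) ^ y * c ^ card I" using c by (simp add: power_one_over divide_simps)
  qed
  also have "\<dots> \<le> (\<Sum>I\<in>Pow {..<n}. (1 / c) ^ y * c ^ card I)"
    using c by (intro sum_mono2) auto
  also have "\<dots> = (1 / c) ^ y * (\<Sum>I\<in>Pow {..<n}. (\<Prod>i\<in>I. c) * (\<Prod>i\<in>{..<n} - I. 1))"
    by (simp add: sum_distrib_left)
  also have "(\<Sum>I\<in>Pow {..<n}. (\<Prod>i\<in>I. c) * (\<Prod>i\<in>{..<n} - I. 1)) = (\<Prod>i<n. c + 1)"
    by (rule prod_add[symmetric]) simp
  also have "(1 / c) ^ y * (\<Prod>i<n. c + 1) \<le> (1 / c) ^ y * exp (real y)"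
  proof (intro mult_left_mono)
    have "(c + 1) ^ n \<le> exp c ^ n"
      using c exp_ge_add_one_self[of c] by (intro power_mono) (auto simp: add.commute)
    also have "\<dots> = exp (real n * c)" by (simp add: exp_of_nat_mult)
    also have "real n * c = real y" using assms by (simp add: c_def)
    finally show "(\<Prod>i<n. c + 1) \<le> exp (real y)" by simp
  qed (use c in simp)
  also have "(1 / c) ^ y = exp (real y * ln (1 / c))" using c by (simp add: exp_of_nat_mult)
  also have "\<dots> * exp (real y) = exp (real y * (1 + ln (1 / c)))"
    by (simp add: exp_add[symmetric] algebra_simps)
  finally show ?thesis by (simp add: c_def)
qed

text \<open>The entropy is smallest at \<open>y = 1\<close>. Hence each unit of entropy left over
  after the union bounds is a factor at most 1/n in probability.\<close>

lemma entropy_term_ge: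
  assumes "1 \<le> y" "y \<le> n"
  shows "1 + ln (real n) \<le> real y * (1 + ln (real n / real y))"
proof -
  have y: "real y \<ge> 1" "real n \<ge> real y" using assms by auto
  have "ln (real y) \<le> real y - 1" using y by (intro ln_le_minus_one) auto
  moreover have "(real y - 1) * ln (real y) \<le> (real y - 1) * ln (real n)"
    using y by (intro mult_left_mono) auto
  ultimately have "1 + ln (real n) \<le> real y * (1 + (ln (real n) - ln (real y)))"
    by (simp add: algebra_simps)
  also have "ln (real n) - ln (real y) = ln (real n / real y)" using y by (simp add: ln_div)
  finally show ?thesis .
qed

text \<open>Edge counts are natural numbers, so the failure event lies in the upper tail starting at
  the least natural number \<open>m\<close> that fails. The tail bound at this \<open>m\<close>
  suffices, without inverting the function of \<open>m\<close> on the left of the discrepancy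
  inequality.\<close>

lemma discrepancy_failure_single:
  assumes IJ: "I \<subseteq> {..<n}" "J \<subseteq> {..<n}" "I \<noteq> {}" "J \<noteq> {}"
  shows "pr
     {E. edge_sum (adj n E) I J > exp 4 * (real (card I) * real (card J) * q) \<and>
         edge_sum (adj n E) I J * ln (edge_sum (adj n E) I J / (real (card I) * real (card J) * q)) > K}
    \<le> exp (- K / 4)"
proof -
  define \<mu> where "\<mu> = real (card I) * real (card J) * q"
  define P where "P = (\<lambda>m::nat. real m > exp 4 * \<mu> \<and> real m * ln (real m / \<mu>) > K)"
  have nat: "\<exists>m. edge_sum (adj n E) I J = real m" for E
    unfolding edge_sum_def adj_def
    by (intro exI[of _ "\<Sum>i\<in>I. \<Sum>j\<in>J. of_bool (sym_of n E i j)"]) simp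
  let ?S = "{E. edge_sum (adj n E) I J > exp 4 * \<mu> \<and>
         edge_sum (adj n E) I J * ln (edge_sum (adj n E) I J / \<mu>) > K}"
  show ?thesis
  proof (cases "\<exists>m. P m")
    case False
    hence "?S = {}" using nat unfolding P_def by (auto, metis)
    hence "pr ?S = 0" by (simp only: measure_empty)
    thus ?thesis by (simp add: \<mu>_def)
  next
    case True
    define m where "m = (LEAST m. P m)"
    have Pm: "P m" using True unfolding m_def by (metis LeastI)
    have "?S \<subseteq> {E. real m \<le> edge_sum (adj n E) I J}"
    proof
      fix E assume E: "E \<in> ?S"
      obtain l where l: "edge_sum (adj n E) I J = real l" using nat by blast
      hence "P l" using E by (simp add: P_def)
      hence "m \<le> l" unfolding m_def by (rule Least_le)
      thus "E \<in> {E. real m \<le> edge_sum (adj n E) I J}" using l by simp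
    qed
    hence "pr ?S \<le> pr {E. real m \<le> edge_sum (adj n E) I J}"
      by (intro measure_pmf.finite_measure_mono) auto
    also have "\<dots> \<le> exp (- real m * ln (real m / \<mu>) / 4)"
      unfolding \<mu>_def using IJ Pm by (intro edge_count_tail) (auto simp: P_def \<mu>_def)
    also have "\<dots> \<le> exp (- K / 4)" using Pm by (simp add: P_def)
    finally show ?thesis by (simp add: \<mu>_def)
  qed
qed

text \<open>Origin of the constant 20: a single pair fails with probability at most
  \<open>exp (- 5 * h)\<close>, the choices of \<open>I\<close> and of \<open>J\<close> cost
  \<open>exp h\<close> each, and the remaining \<open>exp (- 3 * h)\<close> is at most
  \<open>exp (-3) / n ^ 3\<close>, which survives the sum over the \<open>n\<close> sizes of
  \<open>J\<close>.\<close>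

lemma discrepancy_failure_bound:
  "pr
     {E. \<not> discrepancy_property 20 n q (adj n E)} \<le> exp (-3) / (real n)\<^sup>2"
proof -
  define h where "h = (\<lambda>y. real y * (1 + ln (real n / real y)))"
  define T where "T = (SIGMA J : Pow {..<n} - {{}}. {I. I \<subseteq> {..<n} \<and> I \<noteq> {} \<and> card I \<le> card J})"
  define bad where "bad = (\<lambda>(J, I). {E. edge_sum (adj n E) I J > exp 4 * (real (card I) * real (card J) * q) \<and>
         edge_sum (adj n E) I J * ln (edge_sum (adj n E) I J / (real (card I) * real (card J) * q)) > 20 * h (card J)})"
  have fI: "finite {I. I \<subseteq> {..<n} \<and> I \<noteq> {} \<and> card I \<le> y}" for y
    by (rule finite_subset[of _ "Pow {..<n}"]) auto
  have fS: "finite {I. I \<subseteq> {..<n} \<and> card I \<le> y}" for y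
    by (rule finite_subset[of _ "Pow {..<n}"]) auto
  have fT: "finite T" unfolding T_def by (intro finite_SigmaI fI) auto
  have sub: "{E. \<not> discrepancy_property 20 n q (adj n E)} \<subseteq> (\<Union>t\<in>T. bad t)"
  proof
    fix E assume "E \<in> {E. \<not> discrepancy_property 20 n q (adj n E)}"
    then obtain I J where IJ: "I \<subseteq> {..<n}" "J \<subseteq> {..<n}" "I \<noteq> {}" "card I \<le> card J"
      "edge_sum (adj n E) I J > exp 4 * (real (card I) * real (card J) * q)"
      "edge_sum (adj n E) I J * ln (edge_sum (adj n E) I J / (real (card I) * real (card J) * q)) > 20 * h (card J)"
      unfolding discrepancy_property_def h_def by (auto simp: not_le mult.assoc)
    have "J \<noteq> {}" using IJ(1,3,4) finite_subset[OF IJ(1)] by auto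
    hence "(J, I) \<in> T" "E \<in> bad (J, I)" using IJ by (auto simp: T_def bad_def)
    thus "E \<in> (\<Union>t\<in>T. bad t)" by blast
  qed
  have cardJ: "1 \<le> card J \<and> card J \<le> n" if "J \<in> Pow {..<n} - {{}}" for J
    using that card_mono[of "{..<n}" J] finite_subset[of J "{..<n}"] by (auto simp: card_gt_0_iff Suc_le_eq)
  have "pr {E. \<not> discrepancy_property 20 n q (adj n E)} \<le> pr (\<Union>t\<in>T. bad t)"
    using sub by (intro measure_pmf.finite_measure_mono) auto
  also have "\<dots> \<le> (\<Sum>t\<in>T. pr (bad t))"
    using fT by (intro measure_pmf.finite_measure_subadditive_finite) auto
  also have "\<dots> \<le> (\<Sum>(J, I)\<in>T. exp (- 5 * h (card J)))"
  proof (intro sum_mono)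
    fix t assume t: "t \<in> T"
    obtain J I where t': "t = (J, I)" by (cases t)
    have "pr (bad t) \<le> exp (- (20 * h (card J)) / 4)"
      unfolding bad_def t' prod.case using t t' by (intro discrepancy_failure_single) (auto simp: T_def)
    thus "pr (bad t) \<le> (case t of (J, I) \<Rightarrow> exp (- 5 * h (card J)))" by (simp add: t')
  qed
  also have "\<dots> = (\<Sum>J\<in>Pow {..<n} - {{}}. \<Sum>I\<in>{I. I \<subseteq> {..<n} \<and> I \<noteq> {} \<and> card I \<le> card J}. exp (- 5 * h (card J)))"
    unfolding T_def using fI by (intro sum.Sigma[symmetric]) auto
  also have "\<dots> \<le> (\<Sum>J\<in>Pow {..<n} - {{}}. exp (- 4 * h (card J)))"
  proof (intro sum_mono)
    fix J assume J: "J \<in> Pow {..<n} - {{}}"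
    have "real (card {I. I \<subseteq> {..<n} \<and> I \<noteq> {} \<and> card I \<le> card J}) \<le> real (card {I. I \<subseteq> {..<n} \<and> card I \<le> card J})"
      by (intro of_nat_mono card_mono fS) auto
    also have "\<dots> \<le> exp (h (card J))"
      unfolding h_def using cardJ[OF J] by (intro card_small_subsets_le) auto
    finally have "real (card {I. I \<subseteq> {..<n} \<and> I \<noteq> {} \<and> card I \<le> card J}) * exp (- 5 * h (card J))
        \<le> exp (h (card J)) * exp (- 5 * h (card J))" by (intro mult_right_mono) auto
    also have "\<dots> = exp (- 4 * h (card J))" by (simp add: exp_add[symmetric])
    finally show "(\<Sum>I\<in>{I. I \<subseteq> {..<n} \<and> I \<noteq> {} \<and> card I \<le> card J}. exp (- 5 * h (card J))) \<le> exp (- 4 * h (card J))"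
      by simp
  qed
  also have "\<dots> = (\<Sum>y\<in>{1..n}. \<Sum>J\<in>{J \<in> Pow {..<n} - {{}}. card J = y}. exp (- 4 * h (card J)))"
  proof (rule sum.group[symmetric])
    show "card ` (Pow {..<n} - {{}}) \<subseteq> {1..n}" using cardJ by (simp add: image_subset_iff)
  qed simp_all
  also have "\<dots> \<le> (\<Sum>y\<in>{1..n}. exp (- 3 * (1 + ln (real n))))"
  proof (intro sum_mono)
    fix y assume y: "y \<in> {1..n}"
    have "real (card {J \<in> Pow {..<n} - {{}}. card J = y}) \<le> real (card {I. I \<subseteq> {..<n} \<and> card I \<le> y})"
      by (intro of_nat_mono card_mono fS) auto
    also have "\<dots> \<le> exp (h y)" unfolding h_def using y by (intro card_small_subsets_le) auto
    finally have "real (card {J \<in> Pow {..<n} - {{}}. card J = y}) * exp (- 4 * h y) \<le> exp (h y) * exp (- 4 * h y)"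
      by (intro mult_right_mono) auto
    also have "exp (h y) * exp (- 4 * h y) = exp (- 3 * h y)" by (simp add: exp_add[symmetric])
    also have "exp (- 3 * h y) \<le> exp (- 3 * (1 + ln (real n)))"
      using entropy_term_ge[of y] y by (simp add: h_def)
    moreover have "(\<Sum>J\<in>{J \<in> Pow {..<n} - {{}}. card J = y}. exp (- 4 * h (card J)))
       = (\<Sum>J\<in>{J \<in> Pow {..<n} - {{}}. card J = y}. exp (- 4 * h y))" by (intro sum.cong) auto
    ultimately show "(\<Sum>J\<in>{J \<in> Pow {..<n} - {{}}. card J = y}. exp (- 4 * h (card J))) \<le> exp (- 3 * (1 + ln (real n)))"
      by (simp only: sum_constant)
  qed
  also have "\<dots> = exp (-3) / (real n)\<^sup>2"
  proof -
    have "exp (- 3 * (1 + ln (real n))) = exp (-3) * exp (- (real 3 * ln (real n)))" by (simp add: exp_add[symmetric] algebra_simps)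
    also have "exp (- (real 3 * ln (real n))) = 1 / (real n) ^ 3"
      unfolding exp_minus exp_of_nat_mult using n by (simp add: inverse_eq_divide)
    finally show ?thesis using n by (simp add: power2_eq_square power3_eq_cube)
  qed
  finally show ?thesis .
qed

text \<open>The tilt \<open>n / (2 * D)\<close> makes every exponent at most 1 in modulus, so the
  quadratic bound for \<open>exp\<close> applies. The variance term is then at most
  \<open>n / 2\<close>, and a deviation \<open>t * D\<close> contributes \<open>t * n / 2\<close>.
  The sign \<open>s'\<close> covers both tails.\<close>

lemma light_pairs_tail:
  fixes s' :: real
  assumes x: "(\<Sum>i<n. (x i)\<^sup>2) \<le> 1" and s': "s' = 1 \<or> s' = -1"
  defines "D \<equiv> sqrt (real n * q)"
  shows "pr
     {E. t * D \<le> s' * light_form n D p x E}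
    \<le> exp (real n / 2 - t * real n / 2)"
proof -
  have D: "D > 0" "D\<^sup>2 = real n * q" using n q by (auto simp: D_def)
  define s where "s = real n / (2 * D)"
  have s: "s > 0" using n D by (simp add: s_def)
  define c where "c = (\<lambda>e. s * (s' * light_coeff n D x e))"
  define u where "u = s * (t * D) + (\<Sum>e\<in>pairs n. c e * p e)"
  have eq: "(t * D \<le> s' * light_form n D p x E) \<longleftrightarrow>
      u \<le> (\<Sum>e\<in>pairs n. c e * of_bool (E e))" for E
  proof -
    have "(t * D \<le> s' * light_form n D p x E) \<longleftrightarrow>
      s * (t * D) \<le> s * (s' * light_form n D p x E)"
      using s by (simp only: mult_le_cancel_left_pos)
    also have "s * (s' * light_form n D p x E)
       = (\<Sum>e\<in>pairs n. c e * of_bool (E e)) - (\<Sum>e\<in>pairs n. c e * p e)"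
      unfolding sum_subtractf[symmetric] sum_distrib_left by (intro sum.cong refl) (simp only: c_def algebra_simps)
    finally show ?thesis by (auto simp: u_def)
  qed
  have "pr {E. t * D \<le> s' * light_form n D p x E}
     = pr {E. u \<le> (\<Sum>e\<in>pairs n. c e * of_bool (E e))}" by (simp only: eq)
  also have "\<dots> \<le> exp ((\<Sum>e\<in>pairs n. p e * (exp (c e) - 1)) - u)"
    using p q by (intro bernoulli_sum_chernoff) (auto intro: order_trans)
  also have "\<dots> \<le> exp (real n / 2 - t * real n / 2)"
  proof -
    have lc: "\<bar>light_coeff n D x e\<bar> \<le> 2 * D / real n" for e
      by (cases e) (use D in \<open>auto simp: light_coeff_def abs_mult\<close>)
    have c1: "\<bar>c e\<bar> \<le> 1" for e
    proof -
      have "\<bar>c e\<bar> = s * \<bar>light_coeff n D x e\<bar>" using s s' by (auto simp: c_def abs_mult)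
      also have "\<dots> \<le> s * (2 * D / real n)" using s lc by (intro mult_left_mono) auto
      also have "\<dots> = 1" using n D by (simp add: s_def)
      finally show ?thesis .
    qed
    have "(\<Sum>e\<in>pairs n. p e * (exp (c e) - 1)) \<le> (\<Sum>e\<in>pairs n. c e * p e + q * (c e)\<^sup>2)"
    proof (intro sum_mono)
      fix e assume e: "e \<in> pairs n"
      have "p e * (exp (c e) - 1) \<le> p e * (c e + (c e)\<^sup>2)"
        using exp_le_quadratic[OF c1] p[OF e] by (intro mult_left_mono) auto
      also have "\<dots> = c e * p e + p e * (c e)\<^sup>2" by (simp add: algebra_simps)
      also have "\<dots> \<le> c e * p e + q * (c e)\<^sup>2" using p[OF e] by (intro add_left_mono mult_right_mono) auto
      finally show "p e * (exp (c e) - 1) \<le> c e * p e + q * (c e)\<^sup>2" .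
    qed
    also have "\<dots> = (\<Sum>e\<in>pairs n. c e * p e) + q * (\<Sum>e\<in>pairs n. (c e)\<^sup>2)"
      by (simp add: sum.distrib sum_distrib_left)
    also have "q * (\<Sum>e\<in>pairs n. (c e)\<^sup>2) \<le> q * (2 * s\<^sup>2)"
    proof (intro mult_left_mono)
      have "(\<Sum>e\<in>pairs n. (c e)\<^sup>2) \<le> (\<Sum>e\<in>pairs n. (2 * s\<^sup>2) * (case e of (i,j) \<Rightarrow> 2 * (x i)\<^sup>2 * (x j)\<^sup>2))"
        by (intro sum_mono) (use s' in \<open>auto simp: c_def light_coeff_def power_mult_distrib\<close>)
      also have "\<dots> = (2 * s\<^sup>2) * (\<Sum>(i,j)\<in>pairs n. 2 * (x i)\<^sup>2 * (x j)\<^sup>2)" by (simp only: sum_distrib_left)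
      also have "\<dots> \<le> (2 * s\<^sup>2) * 1" using sum_pairs_squares_le[OF x] by (intro mult_left_mono) auto
      finally show "(\<Sum>e\<in>pairs n. (c e)\<^sup>2) \<le> 2 * s\<^sup>2" by simp
    qed (use q in simp)
    also have "q * (2 * s\<^sup>2) = real n / 2"
    proof -
      have "q * (2 * s\<^sup>2) = (real n * q) * real n / (2 * D\<^sup>2)" by (simp add: s_def power_divide power_mult_distrib power2_eq_square)
      thus ?thesis using D n q by simp
    qed
    moreover have "s * (t * D) = t * real n / 2" using D by (simp add: s_def)
    ultimately show ?thesis unfolding u_def exp_le_cancel_iff by linarith
  qed
  finally show ?thesis .
qed

lemma abs_light_pairs_tail:
  assumes x: "(\<Sum>i<n. (x i)\<^sup>2) \<le> 1"
  defines "D \<equiv> sqrt (real n * q)"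
  shows "pr
     {E. t * D < \<bar>light_form n D p x E\<bar>}
    \<le> 2 * exp (real n / 2 - t * real n / 2)"
proof -
  let ?L = "\<lambda>E. light_form n D p x E"
  have "pr {E. t * D < \<bar>?L E\<bar>} \<le>
      pr ({E. t * D \<le> 1 * ?L E} \<union> {E. t * D \<le> (-1) * ?L E})"
    by (intro measure_pmf.finite_measure_mono) auto
  also have "\<dots> \<le> pr {E. t * D \<le> 1 * ?L E} + pr {E. t * D \<le> (-1) * ?L E}"
    by (intro measure_Un_le) auto
  also have "\<dots> \<le> exp (real n / 2 - t * real n / 2) + exp (real n / 2 - t * real n / 2)"
    unfolding D_def by (intro add_mono light_pairs_tail x) simp_all
  finally show ?thesis by simp
qed

text \<open>The light part is a hypothesis. On heavy pairs no cancellation is used: edges and means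
  are bounded separately, the edges by \<open>heavy_pairs_bound\<close> at the absolute values of
  \<open>x\<close> with \<open>c = 20\<close>, the means by \<open>D\<close>.\<close>

lemma lattice_form_bound:
  assumes x: "(\<Sum>i<n. (x i)\<^sup>2) \<le> 1"
  defines "D \<equiv> sqrt (real n * q)"
  assumes light: "\<bar>light_form n D p x E\<bar> \<le> t * D"
    and deg: "\<And>i. i < n \<Longrightarrow> edge_sum (adj n E) {i} {..<n} \<le> exp 4 * (real n * q)"
    and disc: "discrepancy_property 20 n q (adj n E)"
  shows "\<bar>quad_form {..<n} (centered_adj n p E) x\<bar> \<le> (t + 1 + 8 * (6 * exp 4 + 328)) * D"
proof -
  have D: "D > 0" "D\<^sup>2 = real n * q" using n q by (auto simp: D_def)
  define y where "y = (\<lambda>i. \<bar>x i\<bar>)"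
  let ?hv = "\<lambda>i j. y i * y j > D / real n"
  have split: "quad_form {..<n} (centered_adj n p E) x =
      light_form n D p x E +
      (\<Sum>(i,j)\<in>pairs n. if ?hv i j then 2 * x i * x j * (of_bool (E (i,j)) - p (i,j)) else 0)"
    unfolding quadratic_form_centered_adj sum.distrib[symmetric]
    by (intro sum.cong refl) (auto simp: light_coeff_def y_def abs_mult not_le)
  have "\<bar>\<Sum>(i,j)\<in>pairs n. if ?hv i j then 2 * x i * x j * (of_bool (E (i,j)) - p (i,j)) else 0\<bar>
     \<le> (\<Sum>e\<in>pairs n. \<bar>case e of (i,j) \<Rightarrow> if ?hv i j then 2 * x i * x j * (of_bool (E (i,j)) - p (i,j)) else 0\<bar>)"
    by (rule sum_abs)
  also have "\<dots> \<le> (\<Sum>(i,j)\<in>pairs n. (if ?hv i j then 2 * (y i * y j) * of_bool (E (i,j)) else 0) +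
      real n / D * q * (2 * (x i)\<^sup>2 * (x j)\<^sup>2))"
  proof (intro sum_mono)
    fix e assume e: "e \<in> pairs n"
    obtain i j where ij: "e = (i, j)" by (cases e)
    have nn: "0 \<le> real n / D * q * (2 * (x i)\<^sup>2 * (x j)\<^sup>2)" using q D by simp
    have pe: "0 \<le> p (i,j)" "p (i,j) \<le> q" using p[OF e] ij by auto
    show "\<bar>case e of (i,j) \<Rightarrow> if ?hv i j then 2 * x i * x j * (of_bool (E (i,j)) - p (i,j)) else 0\<bar>
      \<le> (case e of (i,j) \<Rightarrow> (if ?hv i j then 2 * (y i * y j) * of_bool (E (i,j)) else 0) +
        real n / D * q * (2 * (x i)\<^sup>2 * (x j)\<^sup>2))"
    proof (cases "?hv i j")
      case False
      thus ?thesis using nn by (simp add: ij)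
    next
      case True
      have y0: "0 \<le> y i * y j" by (simp add: y_def)
      have "\<bar>of_bool (E (i,j)) - p (i,j)\<bar> \<le> of_bool (E (i,j)) + p (i,j)" using pe by (auto simp: of_bool_def)
      hence "2 * (y i * y j) * \<bar>of_bool (E (i,j)) - p (i,j)\<bar> \<le> 2 * (y i * y j) * (of_bool (E (i,j)) + p (i,j))"
        using y0 by (intro mult_left_mono) auto
      also have "\<dots> = 2 * (y i * y j) * of_bool (E (i,j)) + 2 * (y i * y j) * p (i,j)" by (simp add: algebra_simps)
      \<comment> \<open>On a heavy pair one further factor \<open>n / D * (y i * y j)\<close> is at
        least 1. It turns the product into a square, whose total over all pairs is controlled by the
        norm of \<open>x\<close>.\<close>
      also have "2 * (y i * y j) * p (i,j) \<le> 2 * (y i * y j * (real n / D * (y i * y j))) * q"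
      proof (rule mult_mono)
        have "1 \<le> real n / D * (y i * y j)" using True n D by (simp add: field_simps)
        hence "y i * y j * 1 \<le> y i * y j * (real n / D * (y i * y j))" using y0 by (intro mult_left_mono) auto
        thus "2 * (y i * y j) \<le> 2 * (y i * y j * (real n / D * (y i * y j)))" by simp
      qed (use pe y0 D in auto)
      also have "2 * (y i * y j * (real n / D * (y i * y j))) * q = real n / D * q * (2 * (x i)\<^sup>2 * (x j)\<^sup>2)"
      proof -
        have "y i * y i = (x i)\<^sup>2" "y j * y j = (x j)\<^sup>2" by (simp_all add: y_def power2_eq_square)
        moreover have "2 * (y i * y j * (real n / D * (y i * y j))) * q = real n / D * q * (2 * (y i * y i) * (y j * y j))"
          by (simp only: mult_ac)
        ultimately show ?thesis by simp
      qed
      finally show ?thesis using True by (simp add: ij abs_mult y_def mult.assoc)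
    qed
  qed
  also have "\<dots> = (\<Sum>(i,j)\<in>pairs n. if ?hv i j then 2 * (y i * y j) * of_bool (E (i,j)) else 0) +
      real n / D * q * (\<Sum>(i,j)\<in>pairs n. 2 * (x i)\<^sup>2 * (x j)\<^sup>2)"
    by (simp only: case_prod_unfold sum.distrib sum_distrib_left)
  also have "real n / D * q * (\<Sum>(i,j)\<in>pairs n. 2 * (x i)\<^sup>2 * (x j)\<^sup>2) \<le> real n / D * q * 1"
    using q D by (intro mult_left_mono sum_pairs_squares_le x) auto
  also have "real n / D * q * 1 = D" using D by (simp add: field_simps power2_eq_square)
  also have "(\<Sum>(i,j)\<in>pairs n. if ?hv i j then 2 * (y i * y j) * of_bool (E (i,j)) else 0) =
      (\<Sum>i<n. \<Sum>j<n. if ?hv i j then y i * y j * adj n E i j else 0)"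
  proof (subst sum_square_eq_sum_pairs, simp add: adj_diag, rule sum.cong[OF refl])
    fix e assume "e \<in> pairs n"
    then obtain i j where e: "e = (i, j)" "(i, j) \<in> pairs n" by (cases e) auto
    show "(case e of (i,j) \<Rightarrow> if ?hv i j then 2 * (y i * y j) * of_bool (E (i,j)) else 0) =
      (case e of (i,j) \<Rightarrow> (if ?hv i j then y i * y j * adj n E i j else 0) + (if ?hv j i then y j * y i * adj n E j i else 0))"
      using adj_pair[OF e(2), of E] unfolding e(1) prod.case mult.commute[of "y j" "y i"] by simp
  qed
  also have "\<dots> \<le> 8 * (6 * exp 4 + 16 * 20 + 8) * sqrt (real n * q)"
    unfolding D_def
  proof (rule heavy_pairs_bound[OF n q(1)])
    show "\<And>i. i < n \<Longrightarrow> (\<Sum>j<n. adj n E i j) \<le> exp 4 * (real n * q)" using deg by (simp add: edge_sum_def)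
    show "(\<Sum>i<n. (y i)\<^sup>2) \<le> 1" using x by (simp add: y_def)
  qed (use disc in \<open>auto simp: adj_nonneg adj_sym y_def\<close>)
  finally show ?thesis using light unfolding split D_def[symmetric] by (simp add: algebra_simps abs_le_iff)
qed

text \<open>Three failure events: a light sum above \<open>41 * D\<close> at some net point, a large
  degree, a violated discrepancy. The net has at most \<open>exp (18 * n)\<close> points and each
  fails with probability at most \<open>2 * exp (- 20 * n)\<close>, which is where 41 comes from;
  the 42 adds the means of heavy pairs. The leading factor 2 is the loss from the net to all
  vectors.\<close>

theorem centered_adj_concentration:
  assumes sparse: "q \<ge> ln (real n) / (2 * real n)"
  shows "pr
    {E. \<forall>x. \<bar>quad_form {..<n} (centered_adj n p E) x\<bar>
        \<le> 2 * ((42 + 8 * (6 * exp 4 + 328)) * sqrt (real n * q)) * inner_on {..<n} x x} \<ge> 1 - 1 / real n"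
proof (rule ccontr)
  assume neg: "\<not> ?thesis"
  \<comment> \<open>For \<open>n = 1\<close> the claimed probability is 0, so a counterexample has
    at least two nodes.\<close>
  hence n: "n \<ge> 2" using n by (cases "n = 1") auto
  define D where "D = sqrt (real n * q)"
  have lnn: "ln (real n) > 0" using n by simp
  have n1: "n \<ge> 1" using n by simp
  define T where "T = {z \<in> lattice_net n. inner_on {..<n} (lattice_point n z) (lattice_point n z) \<le> 1}"
  have fT: "finite T" unfolding T_def using finite_lattice_net by simp
  define B1 where "B1 = (\<lambda>z. {E. 41 * D < \<bar>light_form n D p (lattice_point n z) E\<bar>})"
  define B2 where "B2 = (\<lambda>i. {E. exp 4 * (real n * q) \<le> edge_sum (adj n E) {i} {..<n}})"
  define B3 where "B3 = {E. \<not> discrepancy_property 20 n q (adj n E)}"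
  define Good where "Good = {E. \<forall>x. \<bar>quad_form {..<n} (centered_adj n p E) x\<bar>
        \<le> 2 * ((42 + 8 * (6 * exp 4 + 328)) * sqrt (real n * q)) * inner_on {..<n} x x}"
  have sub: "- Good \<subseteq> (\<Union>z\<in>T. B1 z) \<union> ((\<Union>i\<in>{..<n}. B2 i) \<union> B3)"
  proof (rule subsetI, rule ccontr)
    fix E assume E: "E \<in> - Good" and nE: "E \<notin> (\<Union>z\<in>T. B1 z) \<union> ((\<Union>i\<in>{..<n}. B2 i) \<union> B3)"
    have "\<bar>quad_form {..<n} (centered_adj n p E) x\<bar>
        \<le> 2 * ((42 + 8 * (6 * exp 4 + 328)) * D) * inner_on {..<n} x x" for x
    proof (rule quadratic_form_le_on_lattice[OF n1])
      show "\<forall>i<n. \<forall>j<n. centered_adj n p E i j = centered_adj n p E j i" by (metis centered_adj_sym)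
      fix z assume z: "z \<in> lattice_net n" "inner_on {..<n} (lattice_point n z) (lattice_point n z) \<le> 1"
      hence "E \<notin> B1 z" using nE by (auto simp: T_def)
      hence l: "\<bar>light_form n D p (lattice_point n z) E\<bar> \<le> 41 * D"
        by (simp add: B1_def)
      have zz: "(\<Sum>i<n. (lattice_point n z i)\<^sup>2) \<le> 1" using z(2) by (simp add: inner_on_def power2_eq_square)
      have dg: "edge_sum (adj n E) {i} {..<n} \<le> exp 4 * (real n * q)" if "i < n" for i
      proof -
        have "E \<notin> B2 i" using nE that by blast
        thus ?thesis by (simp add: B2_def)
      qed
      have ds: "discrepancy_property 20 n q (adj n E)" using nE by (simp add: B3_def)
      have "\<bar>quad_form {..<n} (centered_adj n p E) (lattice_point n z)\<bar>
        \<le> (41 + 1 + 8 * (6 * exp 4 + 328)) * D"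
        unfolding D_def using lattice_form_bound[OF zz l[unfolded D_def] dg ds] by blast
      thus "\<bar>quad_form {..<n} (centered_adj n p E) (lattice_point n z)\<bar>
        \<le> (42 + 8 * (6 * exp 4 + 328)) * D" by simp
    qed
    thus False using E by (simp add: Good_def D_def)
  qed
  have b1: "pr (\<Union>z\<in>T. B1 z) \<le> 2 * exp (- 2 * real n)"
  proof -
    have "pr (\<Union>z\<in>T. B1 z) \<le> (\<Sum>z\<in>T. pr (B1 z))"
      using fT by (intro measure_pmf.finite_measure_subadditive_finite) auto
    also have "\<dots> \<le> (\<Sum>z\<in>T. 2 * exp (real n / 2 - 41 * real n / 2))"
    proof (intro sum_mono)
      fix z assume z: "z \<in> T"
      hence "(\<Sum>i<n. (lattice_point n z i)\<^sup>2) \<le> 1" by (simp add: T_def inner_on_def power2_eq_square)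
      thus "pr (B1 z) \<le> 2 * exp (real n / 2 - 41 * real n / 2)"
        unfolding B1_def D_def by (intro abs_light_pairs_tail) auto
    qed
    also have "\<dots> = real (card T) * (2 * exp (- 20 * real n))" by simp
    also have "\<dots> \<le> exp (18 * real n) * (2 * exp (- 20 * real n))"
    proof (intro mult_right_mono)
      have "real (card T) \<le> real (card (lattice_net n))"
        unfolding T_def by (intro of_nat_mono card_mono finite_lattice_net) auto
      also have "\<dots> \<le> 2 ^ (18 * n)" by (rule card_lattice_net)
      also have "\<dots> \<le> exp 1 ^ (18 * n)" using exp_ge_add_one_self[of 1] by (intro power_mono) auto
      also have "\<dots> = exp (18 * real n)" by (simp add: exp_of_nat_mult[symmetric])
      finally show "real (card T) \<le> exp (18 * real n)" .
    qed simp
    also have "\<dots> = 2 * (exp (18 * real n) * exp (- 20 * real n))" by simp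
    also have "exp (18 * real n) * exp (- 20 * real n) = exp (- 2 * real n)" by (simp add: exp_add[symmetric])
    finally show ?thesis .
  qed
  have e4: "exp (4::real) \<ge> 16"
  proof -
    have "(2::real) ^ 4 \<le> exp 1 ^ 4" using exp_ge_add_one_self[of 1] by (intro power_mono) auto
    thus ?thesis by (simp add: exp_of_nat_mult[symmetric])
  qed
  have b2: "pr (\<Union>i\<in>{..<n}. B2 i) \<le> 1 / real n ^ 7"
  proof -
    have "pr (\<Union>i\<in>{..<n}. B2 i) \<le> (\<Sum>i<n. pr (B2 i))"
      by (intro measure_pmf.finite_measure_subadditive_finite) auto
    also have "\<dots> \<le> (\<Sum>i<n. 1 / real n ^ 8)"
    proof (intro sum_mono)
      fix i assume i: "i \<in> {..<n}"
      have "pr (B2 i) \<le> exp (- (exp 4 * (real n * q)) *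
          ln ((exp 4 * (real n * q)) / (real (card {i}) * real (card {..<n}) * q)) / 4)"
        unfolding B2_def using i n1 by (intro edge_count_tail) auto
      also have "(exp 4 * (real n * q)) / (real (card {i}) * real (card {..<n}) * q) = exp 4"
        using n q by simp
      also have "exp (- (exp 4 * (real n * q)) * ln (exp 4) / 4) = exp (- (exp 4 * (real n * q)))" by simp
      \<comment> \<open>The density assumption enters here: \<open>n * q\<close> is at least
        \<open>ln n / 2\<close>, and \<open>exp 4\<close> is at least 16.\<close>
      also have "\<dots> \<le> exp (- (8 * ln (real n)))"
      proof -
        have "ln (real n) / 2 \<le> real n * q" using sparse n by (simp add: field_simps)
        hence "16 * (ln (real n) / 2) \<le> exp 4 * (real n * q)" using e4 lnn by (intro mult_mono) auto
        thus ?thesis by simp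
      qed
      also have "\<dots> = 1 / real n ^ 8"
      proof -
        have "exp (- (real 8 * ln (real n))) = 1 / real n ^ 8"
          unfolding exp_minus exp_of_nat_mult using n by (simp add: inverse_eq_divide)
        thus ?thesis by simp
      qed
      finally show "pr (B2 i) \<le> 1 / real n ^ 8" .
    qed
    also have "\<dots> = 1 / real n ^ 7" using n by (simp add: power_Suc eval_nat_numeral)
    finally show ?thesis .
  qed
  have b3: "pr B3 \<le> exp (-3) / (real n)\<^sup>2"
    unfolding B3_def by (rule discrepancy_failure_bound)
  have "pr (- Good) \<le> pr ((\<Union>z\<in>T. B1 z) \<union> ((\<Union>i\<in>{..<n}. B2 i) \<union> B3))"
    using sub by (intro measure_pmf.finite_measure_mono) auto
  also have "\<dots> \<le> pr (\<Union>z\<in>T. B1 z) + (pr (\<Union>i\<in>{..<n}. B2 i) + pr B3)"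
    by (intro order_trans[OF measure_Un_le] add_left_mono
        measure_Un_le) auto
  also have "\<dots> \<le> 1 / (4 * real n) + (1 / (4 * real n) + 1 / (4 * real n))"
  proof (intro add_mono)
    have "8 * real n \<le> 4 ^ n" using n
    proof (induction n rule: dec_induct)
      case (step m)
      have "8 * real (Suc m) \<le> 8 * real m + 3 * 4 ^ m"
      proof -
        have "(4::real) ^ 2 \<le> 4 ^ m" using step by (intro power_increasing) auto
        thus ?thesis by simp
      qed
      thus ?case using step.IH by simp
    qed simp
    also have "(4::real) ^ n \<le> (exp 1 ^ 2) ^ n"
      using power_mono[of 2 "exp 1 :: real" 2] exp_ge_add_one_self[of 1] by (intro power_mono) auto
    also have "\<dots> = exp (2 * real n)" by (simp add: exp_of_nat_mult[symmetric] power_mult[symmetric])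
    finally have "8 * real n \<le> exp (2 * real n)" .
    hence "2 * exp (- 2 * real n) \<le> 1 / (4 * real n)"
      using n by (simp add: exp_minus divide_simps)
    thus "pr (\<Union>z\<in>T. B1 z) \<le> 1 / (4 * real n)" using b1 by linarith
    have "4 * real n \<le> real n ^ 7"
    proof -
      have "2 ^ 6 \<le> real n ^ 6" using n by (intro power_mono) auto
      hence "4 * real n \<le> real n ^ 6 * real n" using n by (intro mult_right_mono) auto
      thus ?thesis by (simp add: eval_nat_numeral mult_ac)
    qed
    hence "1 / real n ^ 7 \<le> 1 / (4 * real n)" using n by (intro divide_left_mono) auto
    thus "pr (\<Union>i\<in>{..<n}. B2 i) \<le> 1 / (4 * real n)" using b2 by linarith
    have "exp (3::real) \<ge> 4" using exp_ge_add_one_self[of 3] by simp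
    hence "4 * real n * 1 \<le> exp 3 * real n * real n" using n by (intro mult_mono) auto
    hence "exp (-3) / (real n)\<^sup>2 \<le> 1 / (4 * real n)"
      using n by (simp add: exp_minus divide_simps power2_eq_square)
    thus "pr B3 \<le> 1 / (4 * real n)" using b3 by linarith
  qed
  also have "\<dots> \<le> 1 / real n" using n by (simp add: field_simps)
  finally have "pr (- Good) \<le> 1 / real n" .
  moreover have "pr (- Good) = 1 - pr Good"
    using measure_pmf.prob_compl[of Good "edge_pmf n p"] by (simp add: Compl_eq_Diff_UNIV)
  ultimately show False using neg by (simp add: Good_def)
qed

end

section \<open>From the embedding to the labels\<close>

text \<open>Fewer bad nodes than the smallest community leave every community a good representative.
  Good nodes with equal labels share a community, so the labels of the representatives are distinct
  and form a permutation of \<open>1..k\<close>; its inverse relabels all good nodes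
  correctly.\<close>

lemma misclass_le_card_bad:
  assumes n: "n \<ge> 1" and \<theta>: "\<forall>i<n. \<theta> i \<in> {1..k}" and bad: "bad \<subseteq> {..<n}"
    and sep: "\<And>i j. i < n \<Longrightarrow> j < n \<Longrightarrow> i \<notin> bad \<Longrightarrow> j \<notin> bad \<Longrightarrow> \<theta>h i = \<theta>h j \<Longrightarrow> \<theta> i = \<theta> j"
    and \<theta>h: "\<And>i. i < n \<Longrightarrow> i \<notin> bad \<Longrightarrow> \<theta>h i \<in> {1..k}"
    and small: "card bad < n_min n k \<theta>"
  shows "misclass n k \<theta> \<theta>h \<le> real (card bad) / real n"
proof -
  have fb: "finite bad" using bad finite_subset by blast
  have "\<exists>i<n. i \<notin> bad \<and> \<theta> i = j" if j: "j \<in> {1..k}" for j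
  proof (rule ccontr)
    assume "\<not> ?thesis"
    hence "comm n \<theta> j \<subseteq> bad" by (auto simp: comm_def)
    hence "n_j n \<theta> j \<le> card bad" unfolding n_j_def using fb by (rule card_mono[rotated])
    moreover have "n_min n k \<theta> \<le> n_j n \<theta> j" unfolding n_min_def using j by (intro Min_le) auto
    ultimately show False using small by simp
  qed
  then obtain r where r: "\<And>j. j \<in> {1..k} \<Longrightarrow> r j < n \<and> r j \<notin> bad \<and> \<theta> (r j) = j" by metis
  define g where "g = (\<lambda>j. \<theta>h (r j))"
  have inj: "inj_on g {1..k}"
  proof (rule inj_onI)
    fix a b assume ab: "a \<in> {1..k}" "b \<in> {1..k}" "g a = g b"
    hence "\<theta> (r a) = \<theta> (r b)" using r sep unfolding g_def by blast
    thus "a = b" using r ab by simp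
  qed
  have "g ` {1..k} \<subseteq> {1..k}" using r \<theta>h by (auto simp: g_def)
  hence im: "g ` {1..k} = {1..k}" using inj by (simp add: endo_inj_surj)
  hence bij: "bij_betw g {1..k} {1..k}" using inj by (simp add: bij_betw_def)
  define \<sigma> where "\<sigma> = (\<lambda>x. if x \<in> {1..k} then inv_into {1..k} g x else x)"
  have "bij_betw \<sigma> {1..k} {1..k}"
    using bij_betw_inv_into[OF bij] by (rule bij_betw_cong[THEN iffD1, rotated]) (simp add: \<sigma>_def)
  hence perm: "\<sigma> permutes {1..k}" by (intro bij_imp_permutes) (auto simp: \<sigma>_def)
  have ok: "\<sigma> (\<theta>h i) = \<theta> i" if i: "i < n" "i \<notin> bad" for i
  proof -
    have "\<theta>h i \<in> g ` {1..k}" using \<theta>h[OF i] im by simp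
    then obtain j where j: "j \<in> {1..k}" "\<theta>h i = g j" by blast
    hence "\<theta> i = \<theta> (r j)" using sep[OF i(1) _ i(2), of "r j"] r[OF j(1)] by (simp add: g_def)
    hence "\<theta> i = j" using r[OF j(1)] by simp
    moreover have "\<sigma> (g j) = j" using j \<theta>h[OF i] inj by (simp add: \<sigma>_def inv_into_f_f)
    ultimately show ?thesis using j by simp
  qed
  have "{i. i < n \<and> \<sigma> (\<theta>h i) \<noteq> \<theta> i} \<subseteq> bad" using ok by auto
  hence "card {i. i < n \<and> \<sigma> (\<theta>h i) \<noteq> \<theta> i} \<le> card bad" using fb by (rule card_mono[rotated])
  hence "real (card {i. i < n \<and> \<sigma> (\<theta>h i) \<noteq> \<theta> i}) / real n \<le> real (card bad) / real n"
    by (simp add: divide_right_mono)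
  moreover have "misclass n k \<theta> \<theta>h \<le> real (card {i. i < n \<and> \<sigma> (\<theta>h i) \<noteq> \<theta> i}) / real n"
    unfolding misclass_def using perm by (intro Min_le) (auto intro!: finite_imageI finite_permutations)
  ultimately show ?thesis by linarith
qed

lemma vnorm_eq_L2_set: "vnorm k x = L2_set x {1..k}"
  by (simp add: vnorm_def L2_set_def)

lemma L2_set_minus_commute: "L2_set (\<lambda>c. x c - y c) A = L2_set (\<lambda>c. y c - x c) A"
  by (simp add: L2_set_def power2_commute)

lemma L2_set_triangle_diff:
  "L2_set (\<lambda>c. x c - z c) A \<le> L2_set (\<lambda>c. x c - y c) A + L2_set (\<lambda>c. y c - z c) A"
  using L2_set_triangle_ineq[of "\<lambda>c. x c - y c" "\<lambda>c. y c - z c" A] by simp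

lemma L2_set_scale: "L2_set (\<lambda>c. a * x c) A = \<bar>a\<bar> * L2_set x A"
  by (simp add: L2_set_def power_mult_distrib sum_distrib_left[symmetric] real_sqrt_mult)

lemma L2_set_diff_ge: "L2_set x A - L2_set y A \<le> L2_set (\<lambda>c. x c - y c) A"
  using L2_set_triangle_ineq[of "\<lambda>c. x c - y c" y A] by simp

text \<open>The difference splits into the change of length, \<open>1 / norm u - 1 / norm h\<close>
  times \<open>u\<close>, and the scaled difference of \<open>u\<close> and \<open>h\<close>; each
  contributes one copy of the bound.\<close>

lemma normalized_rows_distance:
  assumes "L2_set u A > 0" "L2_set h A > 0"
  shows "L2_set (\<lambda>c. u c / L2_set u A - h c / L2_set h A) A \<le> 2 * L2_set (\<lambda>c. u c - h c) A / L2_set h A"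
proof -
  let ?a = "L2_set u A" and ?b = "L2_set h A" and ?d = "L2_set (\<lambda>c. u c - h c) A"
  have "(\<lambda>c. u c / ?a - h c / ?b) = (\<lambda>c. (1 / ?a - 1 / ?b) * u c + (1 / ?b) * (u c - h c))"
    by (simp add: left_diff_distrib right_diff_distrib diff_divide_distrib)
  hence "L2_set (\<lambda>c. u c / ?a - h c / ?b) A \<le>
      L2_set (\<lambda>c. (1 / ?a - 1 / ?b) * u c) A + L2_set (\<lambda>c. (1 / ?b) * (u c - h c)) A"
    by (simp only: L2_set_triangle_ineq)
  also have "\<dots> = \<bar>1 / ?a - 1 / ?b\<bar> * ?a + ?d / ?b" using assms by (simp only: L2_set_scale) simp
  also have "\<bar>1 / ?a - 1 / ?b\<bar> * ?a = \<bar>?b - ?a\<bar> / ?b"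
  proof -
    have "1 / ?a - 1 / ?b = (?b - ?a) / (?a * ?b)" using assms by (simp add: field_simps)
    thus ?thesis using assms by (simp add: abs_mult)
  qed
  also have "\<bar>?b - ?a\<bar> / ?b \<le> ?d / ?b"
    using L2_set_diff_ge[of u A h] L2_set_diff_ge[of h A u] L2_set_minus_commute[of u h A] assms
    by (intro divide_right_mono) (auto simp: abs_le_iff)
  finally show ?thesis by simp
qed

lemma finite_comm [simp]: "finite (comm n \<theta> j)" by (simp add: comm_def)

text \<open>The normalised restriction of \<open>\<psi>\<close> to a community. The span of these
  vectors contains the range of the signal matrix.\<close>

definition community_vec :: "nat \<Rightarrow> (nat \<Rightarrow> nat) \<Rightarrow> (nat \<Rightarrow> real) \<Rightarrow> nat \<Rightarrow> nat \<Rightarrow> real" where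
  "community_vec n \<theta> \<psi> j i = (if \<theta> i = j then \<psi> i / sqrt (nt_j n \<theta> \<psi> j) else 0)"

lemma sum_comm_eq: "(\<Sum>i\<in>comm n \<theta> j. h i) = (\<Sum>i<n. if \<theta> i = j then h i else (0::real))"
proof -
  have "(\<Sum>i<n. if \<theta> i = j then h i else 0) = (\<Sum>i\<in>{i \<in> {..<n}. \<theta> i = j}. h i)"
    by (rule sum.inter_filter[symmetric]) simp
  moreover have "{i \<in> {..<n}. \<theta> i = j} = comm n \<theta> j" by (auto simp: comm_def)
  ultimately show ?thesis by simp
qed

lemma L2_set_diagonal_le:
  assumes "\<And>i. i \<in> I \<Longrightarrow> \<bar>d i\<bar> \<le> M" "M \<ge> 0"
  shows "L2_set (\<lambda>i. d i * x i) I \<le> M * L2_set x I"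
proof -
  have "L2_set (\<lambda>i. d i * x i) I = L2_set (\<lambda>i. \<bar>d i * x i\<bar>) I" by (simp only: L2_set_def power2_abs)
  also have "\<dots> \<le> L2_set (\<lambda>i. M * \<bar>x i\<bar>) I"
    using assms(1) by (intro L2_set_mono) (auto simp: abs_mult intro: mult_right_mono)
  also have "\<dots> = M * L2_set (\<lambda>i. \<bar>x i\<bar>) I" using assms(2) by (simp add: L2_set_scale)
  also have "L2_set (\<lambda>i. \<bar>x i\<bar>) I = L2_set x I" by (simp only: L2_set_def power2_abs)
  finally show ?thesis .
qed

locale community_model =
  fixes n k :: nat and \<theta> :: "nat \<Rightarrow> nat" and \<psi> :: "nat \<Rightarrow> real"
  assumes \<theta>: "\<forall>i<n. \<theta> i \<in> {1..k}" and \<psi>: "\<forall>i<n. 0 < \<psi> i \<and> \<psi> i \<le> 1"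
    and ne: "\<forall>j\<in>{1..k}. comm n \<theta> j \<noteq> {}"
begin

abbreviation "nt \<equiv> nt_j n \<theta> \<psi>"
abbreviation "cvec \<equiv> community_vec n \<theta> \<psi>"

lemma sum_over_communities:
  "(\<Sum>i<n. h i) = (\<Sum>j\<in>{1..k}. \<Sum>i\<in>comm n \<theta> j. h i)"
proof -
  have "(\<Sum>j\<in>{1..k}. \<Sum>i\<in>{i \<in> {..<n}. \<theta> i = j}. h i) = (\<Sum>i<n. h i)"
    using \<theta> by (intro sum.group) auto
  moreover have "{i \<in> {..<n}. \<theta> i = j} = comm n \<theta> j" for j by (auto simp: comm_def)
  ultimately show ?thesis by simp
qed

text \<open>The right side sums the inverse squares of the coefficients
  \<open>\<psi> i / sqrt (nt (\<theta> i))\<close>, which set the row norms of the ideal embedding.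
  It is what Cauchy-Schwarz produces when errors of raw rows become errors of normalised
  rows.\<close>

lemma heterogeneity_sum:
  "(\<Sum>j\<in>{1..k}. (real (n_j n \<theta> j))\<^sup>2 * nu_j n \<theta> \<psi> j) = (\<Sum>i<n. nt (\<theta> i) / (\<psi> i)\<^sup>2)"
proof -
  have "(\<Sum>i<n. nt (\<theta> i) / (\<psi> i)\<^sup>2) = (\<Sum>j\<in>{1..k}. \<Sum>i\<in>comm n \<theta> j. nt (\<theta> i) / (\<psi> i)\<^sup>2)"
    by (rule sum_over_communities)
  also have "\<dots> = (\<Sum>j\<in>{1..k}. (real (n_j n \<theta> j))\<^sup>2 * nu_j n \<theta> \<psi> j)"
  proof (rule sum.cong[OF refl])
    fix j assume j: "j \<in> {1..k}"
    have "real (n_j n \<theta> j) \<noteq> 0" using ne j by (simp add: n_j_def)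
    hence "(real (n_j n \<theta> j))\<^sup>2 * nu_j n \<theta> \<psi> j = (\<Sum>i\<in>comm n \<theta> j. 1 / (\<psi> i)\<^sup>2) * nt j"
      by (simp add: nu_j_def nt_j_def)
    also have "\<dots> = (\<Sum>i\<in>comm n \<theta> j. nt j / (\<psi> i)\<^sup>2)" by (simp add: sum_distrib_right)
    also have "\<dots> = (\<Sum>i\<in>comm n \<theta> j. nt (\<theta> i) / (\<psi> i)\<^sup>2)"
      by (intro sum.cong) (auto simp: comm_def)
    finally show "(\<Sum>i\<in>comm n \<theta> j. nt (\<theta> i) / (\<psi> i)\<^sup>2) = (real (n_j n \<theta> j))\<^sup>2 * nu_j n \<theta> \<psi> j" by simp
  qed
  finally show ?thesis by simp
qed

lemma nt_j_pos: "j \<in> {1..k} \<Longrightarrow> nt j > 0"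
  unfolding nt_j_def using \<psi> ne by (intro sum_pos) (auto simp: comm_def)

lemma nt_min_pos: "k \<ge> 1 \<Longrightarrow> nt_min n k \<theta> \<psi> > 0"
  unfolding nt_min_def using nt_j_pos by (subst Min_gr_iff) auto

text \<open>Cauchy-Schwarz for \<open>1 / \<psi>\<close> against \<open>\<psi>\<close>:
  heterogeneity is never below 1. This lets the hypothesis of the theorem force a small subspace
  distance.\<close>

lemma n_j_square_le:
  assumes j: "j \<in> {1..k}"
  shows "(real (n_j n \<theta> j))\<^sup>2 \<le> (real (n_j n \<theta> j))\<^sup>2 * nu_j n \<theta> \<psi> j"
proof -
  let ?C = "comm n \<theta> j"
  have p: "0 < \<psi> i" if "i \<in> ?C" for i using \<psi> that by (auto simp: comm_def)
  have "real (n_j n \<theta> j) = (\<Sum>i\<in>?C. \<bar>1 / \<psi> i\<bar> * \<bar>\<psi> i\<bar>)" using p by (simp add: n_j_def less_imp_neq[symmetric])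
  also have "\<dots> \<le> L2_set (\<lambda>i. 1 / \<psi> i) ?C * L2_set \<psi> ?C" by (rule L2_set_mult_ineq)
  finally have "(real (n_j n \<theta> j))\<^sup>2 \<le> (L2_set (\<lambda>i. 1 / \<psi> i) ?C * L2_set \<psi> ?C)\<^sup>2" by (intro power_mono) auto
  also have "\<dots> = (\<Sum>i\<in>?C. 1 / (\<psi> i)\<^sup>2) * (\<Sum>i\<in>?C. (\<psi> i)\<^sup>2)"
    by (simp add: power_mult_distrib L2_set_def sum_nonneg power_one_over)
  also have "\<dots> = (real (n_j n \<theta> j))\<^sup>2 * nu_j n \<theta> \<psi> j"
    using ne j by (simp add: nu_j_def n_j_def)
  finally show ?thesis .
qed

text \<open>The rows of \<open>H\<close> serve as cluster directions: \<open>h1\<close> keeps them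
  apart, \<open>h3\<close> bounds their lengths, \<open>h2\<close> places the embedding near
  multiples of them. The constant 4 is twice the normalisation factor 2, since a misplaced row is at
  least 1/2 away from its centre. The additional 1/2 in \<open>2.5\<close> leaves room within the
  stated constant; the zero rows are absorbed by the same bound.\<close>

lemma clustering_error:
  fixes H :: "nat \<Rightarrow> nat \<Rightarrow> real" and U :: "nat \<Rightarrow> nat \<Rightarrow> real"
  assumes n: "n \<ge> 1" and \<gamma>: "\<gamma> \<ge> 0"
    and \<delta>: "\<delta> \<ge> 0" "\<delta>\<^sup>2 \<le> 1 / 2"
    and h1: "\<And>a. (1 - \<delta>\<^sup>2) * inner_on {1..k} a a \<le> (\<Sum>c\<in>{1..k}. (\<Sum>j\<in>{1..k}. a j * H j c)\<^sup>2)"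
    and h2: "(\<Sum>i<n. \<Sum>c\<in>{1..k}. (U i c - \<psi> i / sqrt (nt (\<theta> i)) * H (\<theta> i) c)\<^sup>2) \<le> real k * \<delta>\<^sup>2"
    and h3: "\<And>j. j \<in> {1..k} \<Longrightarrow> (\<Sum>c\<in>{1..k}. (H j c)\<^sup>2) \<le> 1"
  defines "Ip \<equiv> {i. i < n \<and> vnorm k (\<lambda>c. U i c) > 0}"
    and "V \<equiv> (\<lambda>i c. U i c / vnorm k (\<lambda>c'. U i c'))"
    and "N2 \<equiv> (\<Sum>j\<in>{1..k}. (real (n_j n \<theta> j))\<^sup>2 * nu_j n \<theta> \<psi> j)"
  assumes km: "approx_kmedians k \<gamma> Ip V l"
    and \<theta>h: "\<forall>i<n. \<theta>h i = (if i \<in> Ip then l i else 1)"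
    and small: "4 * (2.5 + \<gamma>) * sqrt (2 * \<delta>\<^sup>2 * real k * N2) < real (n_min n k \<theta>)"
  shows "misclass n k \<theta> \<theta>h \<le> 4 * (2.5 + \<gamma>) * sqrt (2 * \<delta>\<^sup>2 * real k * N2) / real n"
proof -
  let ?K = "{1..k}"
  define \<rho> where "\<rho> = 1 - \<delta>\<^sup>2"
  have \<rho>: "\<rho> \<ge> 1 / 2" using \<delta> by (simp add: \<rho>_def)
  define hn where "hn = (\<lambda>j. L2_set (H j) ?K)"
  have hn2: "(hn j)\<^sup>2 = (\<Sum>c\<in>?K. (H j c)\<^sup>2)" for j by (simp add: hn_def L2_set_def sum_nonneg)
  have comb: "(\<Sum>j\<in>?K. (if j = b then x else 0) * H j c) = x * H b c" if "b \<in> ?K" for b x c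
  proof -
    have "(\<Sum>j\<in>?K. (if j = b then x else 0) * H j c) = (\<Sum>j\<in>?K. if j = b then x * H j c else 0)"
      by (intro sum.cong) auto
    thus ?thesis using that by simp
  qed
  have hnl: "\<rho> \<le> (hn j)\<^sup>2" if j: "j \<in> ?K" for j
  proof -
    have "inner_on ?K (\<lambda>i. if i = j then 1 else 0) (\<lambda>i. if i = j then 1 else 0) = (\<Sum>i\<in>?K. if i = j then 1 else 0)"
      unfolding inner_on_def by (intro sum.cong) auto
    also have "\<dots> = 1" using j by simp
    finally show ?thesis
      using h1[of "\<lambda>i. if i = j then 1 else 0"] unfolding hn2 comb[OF j] \<rho>_def by simp
  qed
  have hn0: "hn j > 0" if j: "j \<in> ?K" for j
  proof -
    have "(hn j)\<^sup>2 > 0" using hnl[OF j] \<rho> by linarith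
    thus ?thesis using L2_set_nonneg[of "H j" ?K] unfolding hn_def by (simp add: less_le)
  qed
  have hn1: "hn j \<le> 1" if j: "j \<in> ?K" for j
    using h3[OF j] unfolding hn2[symmetric] using hn0[OF j] by (simp add: power_le_one_iff abs_square_le_1)
  define C where "C = (\<lambda>j c. H j c / hn j)"
  have sep: "1 \<le> L2_set (\<lambda>c. C a c - C b c) ?K" if ab: "a \<in> ?K" "b \<in> ?K" "a \<noteq> b" for a b
  proof -
    \<comment> \<open>Coefficients that produce the difference of two normalised rows. Both entries
      have modulus at least 1 because \<open>hn \<le> 1\<close>, so the squared norm is at least 2,
      which offsets \<open>\<rho> \<ge> 1 / 2\<close>.\<close>
    define \<alpha> where "\<alpha> = (\<lambda>j. (if j = a then 1 / hn a else 0) + (if j = b then - 1 / hn b else 0))"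
    have "(\<Sum>j\<in>?K. \<alpha> j * H j c) = C a c - C b c" for c
      unfolding \<alpha>_def distrib_right sum.distrib comb[OF ab(1)] comb[OF ab(2)] by (simp add: C_def)
    moreover have "(L2_set (\<lambda>c. C a c - C b c) ?K)\<^sup>2 = (\<Sum>c\<in>?K. (C a c - C b c)\<^sup>2)"
      by (simp add: L2_set_def sum_nonneg)
    ultimately have "\<rho> * inner_on ?K \<alpha> \<alpha> \<le> (L2_set (\<lambda>c. C a c - C b c) ?K)\<^sup>2"
      using h1[of \<alpha>] by (simp only: \<rho>_def)
    moreover have "inner_on ?K \<alpha> \<alpha> \<ge> 2"
    proof -
      have "inner_on ?K \<alpha> \<alpha> = (\<Sum>j\<in>?K. (if j = a then (1 / hn a)\<^sup>2 else 0) + (if j = b then (1 / hn b)\<^sup>2 else 0))"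
        unfolding inner_on_def by (intro sum.cong) (use ab(3) in \<open>auto simp: \<alpha>_def power2_eq_square\<close>)
      also have "\<dots> = (1 / hn a)\<^sup>2 + (1 / hn b)\<^sup>2" using ab by (simp add: sum.distrib)
      finally have "inner_on ?K \<alpha> \<alpha> = (1 / hn a)\<^sup>2 + (1 / hn b)\<^sup>2" .
      moreover have "1 \<le> (1 / hn j)\<^sup>2" if "j \<in> ?K" for j
        using hn0[OF that] hn1[OF that] by (intro one_le_power) (simp add: le_divide_eq)
      ultimately show ?thesis using ab by (smt (verit))
    qed
    hence "(1 / 2) * 2 \<le> \<rho> * inner_on ?K \<alpha> \<alpha>" using \<rho> by (intro mult_mono) auto
    ultimately have "1 \<le> (L2_set (\<lambda>c. C a c - C b c) ?K)\<^sup>2" by linarith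
    thus ?thesis using power2_le_imp_le[of 1 "L2_set (\<lambda>c. C a c - C b c) ?K"] by simp
  qed
  define a where "a = (\<lambda>i. \<psi> i / sqrt (nt (\<theta> i)))"
  have a0: "a i > 0" if "i < n" for i
    unfolding a_def using that \<psi> \<theta> nt_j_pos by (intro divide_pos_pos) auto
  define dev where "dev = (\<lambda>i. L2_set (\<lambda>c. U i c - a i * H (\<theta> i) c) ?K)"
  \<comment> \<open>The relative deviation of a row: twice this bounds the error after
    normalisation, and for a zero row it is exactly 1.\<close>
  define w where "w = (\<lambda>i. dev i / (a i * hn (\<theta> i)))"
  have w0: "w i \<ge> 0" if "i < n" for i
    unfolding w_def dev_def using a0[OF that] hn0[of "\<theta> i"] \<theta> that by (intro divide_nonneg_nonneg) auto
  define S where "S = (\<Sum>i<n. w i)"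
  have N2_0: "N2 \<ge> 0"
    unfolding N2_def nu_j_def by (intro sum_nonneg mult_nonneg_nonneg divide_nonneg_nonneg) (auto intro!: sum_nonneg)
  have S: "S \<le> sqrt (2 * \<delta>\<^sup>2 * real k * N2)"
  proof -
    have "S \<le> (\<Sum>i<n. sqrt 2 * (\<bar>dev i\<bar> * \<bar>1 / a i\<bar>))"
      unfolding S_def
    proof (intro sum_mono)
      fix i assume i: "i \<in> {..<n}"
      hence ti: "\<theta> i \<in> ?K" using \<theta> by auto
      have "(1 / hn (\<theta> i))\<^sup>2 \<le> 2"
      proof -
        have "1 / 2 \<le> (hn (\<theta> i))\<^sup>2" using hnl[OF ti] \<rho> by linarith
        thus ?thesis using hn0[OF ti] by (simp add: power_divide divide_le_eq)
      qed
      hence "1 / hn (\<theta> i) \<le> sqrt 2" by (rule real_le_rsqrt)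
      hence "(dev i / a i) * (1 / hn (\<theta> i)) \<le> (dev i / a i) * sqrt 2"
        using a0[of i] i by (intro mult_left_mono) (auto simp: dev_def)
      thus "w i \<le> sqrt 2 * (\<bar>dev i\<bar> * \<bar>1 / a i\<bar>)" using a0[of i] i by (simp add: w_def dev_def mult.commute)
    qed
    also have "\<dots> = sqrt 2 * (\<Sum>i<n. \<bar>dev i\<bar> * \<bar>1 / a i\<bar>)" by (simp only: sum_distrib_left)
    \<comment> \<open>Cauchy-Schwarz separates the total deviation of the embedding from the inverse
      row norms, whose sum of squares is \<open>N2\<close>.\<close>
    also have "\<dots> \<le> sqrt 2 * (L2_set dev {..<n} * L2_set (\<lambda>i. 1 / a i) {..<n})"
      by (intro mult_left_mono L2_set_mult_ineq) simp
    also have "L2_set dev {..<n} \<le> sqrt (real k * \<delta>\<^sup>2)"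
    proof -
      have "(dev i)\<^sup>2 = (\<Sum>c\<in>?K. (U i c - \<psi> i / sqrt (nt (\<theta> i)) * H (\<theta> i) c)\<^sup>2)" for i
        by (simp add: dev_def L2_set_def sum_nonneg a_def)
      thus ?thesis unfolding L2_set_def[of dev] using h2 by simp
    qed
    also have "L2_set (\<lambda>i. 1 / a i) {..<n} = sqrt N2"
    proof -
      have "(1 / a i)\<^sup>2 = nt (\<theta> i) / (\<psi> i)\<^sup>2" if "i < n" for i
      proof -
        have "nt (\<theta> i) > 0" using nt_j_pos \<theta> that by auto
        thus ?thesis using that \<psi> by (simp add: a_def power_divide)
      qed
      thus ?thesis unfolding N2_def heterogeneity_sum L2_set_def by simp
    qed
    finally have "S \<le> sqrt 2 * (sqrt (real k * \<delta>\<^sup>2) * sqrt N2)" by (simp add: N2_0 mult_right_mono)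
    thus ?thesis by (simp add: real_sqrt_mult mult_ac)
  qed
  have dV: "vnorm k (\<lambda>c. C (\<theta> i) c - V i c) \<le> 2 * w i" if i: "i \<in> Ip" for i
  proof -
    have i': "i < n" "L2_set (\<lambda>c. U i c) ?K > 0" using i by (auto simp: Ip_def vnorm_eq_L2_set)
    hence ti: "\<theta> i \<in> ?K" using \<theta> by auto
    let ?h = "\<lambda>c. a i * H (\<theta> i) c"
    have lh: "L2_set ?h ?K = a i * hn (\<theta> i)" using a0[OF i'(1)] by (simp add: L2_set_scale hn_def)
    have "L2_set (\<lambda>c. U i c / L2_set (U i) ?K - ?h c / L2_set ?h ?K) ?K \<le> 2 * dev i / L2_set ?h ?K"
      unfolding dev_def using i'(2) a0[OF i'(1)] hn0[OF ti] lh by (intro normalized_rows_distance) auto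
    moreover have "(\<lambda>c. U i c / L2_set (U i) ?K - ?h c / L2_set ?h ?K) = (\<lambda>c. V i c - C (\<theta> i) c)"
      unfolding lh using a0[OF i'(1)] by (simp add: V_def C_def vnorm_eq_L2_set)
    ultimately show ?thesis
      unfolding vnorm_eq_L2_set L2_set_minus_commute[of "C (\<theta> i)"] w_def lh by simp
  qed
  have w1: "w i = 1" if i: "i < n" "i \<notin> Ip" for i
  proof -
    have "\<not> 0 < L2_set (\<lambda>c. U i c) ?K" using i by (simp add: Ip_def vnorm_eq_L2_set)
    hence "L2_set (\<lambda>c. U i c) ?K = 0" using L2_set_nonneg[of "U i" ?K] by linarith
    hence z: "\<forall>c\<in>?K. U i c = 0" by (simp add: L2_set_eq_0_iff)
    have "dev i = L2_set (\<lambda>c. (- a i) * H (\<theta> i) c) ?K"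
      unfolding dev_def by (intro L2_set_cong) (use z in auto)
    also have "\<dots> = a i * hn (\<theta> i)" using a0[OF i(1)] by (simp only: L2_set_scale hn_def abs_minus_cancel abs_of_pos)
    finally show ?thesis using a0[OF i(1)] hn0[of "\<theta> i"] \<theta> i by (simp add: w_def)
  qed
  have fIp: "finite Ip" and Ipn: "Ip \<subseteq> {..<n}" by (auto simp: Ip_def)
  define Sp where "Sp = (\<Sum>i\<in>Ip. w i)"
  have Ssplit: "S = Sp + real (card ({..<n} - Ip))"
  proof -
    have "S = (\<Sum>i\<in>{..<n} - Ip. w i) + Sp" unfolding S_def Sp_def using Ipn by (intro sum.subset_diff) auto
    moreover have "(\<Sum>i\<in>{..<n} - Ip. w i) = (\<Sum>i\<in>{..<n} - Ip. 1)" using w1 by (intro sum.cong) auto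
    ultimately show ?thesis by simp
  qed
  have Sp0: "Sp \<ge> 0" unfolding Sp_def using w0 Ipn by (intro sum_nonneg) auto
  let ?costs = "{kmed_cost k Ip V l' X' | l' X'. \<forall>i\<in>Ip. l' i \<in> {1..k}}"
  \<comment> \<open>The true labels with centres \<open>C\<close> are a competitor in the
    minimisation.\<close>
  have "Inf ?costs \<le> kmed_cost k Ip V \<theta> C"
  proof (rule cInf_lower)
    show "kmed_cost k Ip V \<theta> C \<in> ?costs" using \<theta> Ipn by auto
    show "bdd_below ?costs"
      by (rule bdd_belowI[of _ 0]) (auto simp: kmed_cost_def vnorm_def intro!: sum_nonneg)
  qed
  also have "\<dots> \<le> 2 * Sp"
    unfolding kmed_cost_def Sp_def sum_distrib_left by (intro sum_mono dV)
  finally have opt: "Inf ?costs \<le> 2 * Sp" .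
  obtain X where X: "kmed_cost k Ip V l X \<le> (1 + \<gamma>) * Inf ?costs" and l: "\<forall>i\<in>Ip. l i \<in> {1..k}"
    using km unfolding approx_kmedians_def by blast
  have "kmed_cost k Ip V l X \<le> (1 + \<gamma>) * (2 * Sp)"
    using X mult_left_mono[OF opt, of "1 + \<gamma>"] \<gamma> by linarith
  moreover define e where "e = (\<lambda>i. L2_set (\<lambda>c. X (l i) c - C (\<theta> i) c) ?K)"
  have "(\<Sum>i\<in>Ip. e i) \<le> (\<Sum>i\<in>Ip. vnorm k (\<lambda>c. X (l i) c - V i c) + 2 * w i)"
  proof (intro sum_mono)
    fix i assume i: "i \<in> Ip"
    show "e i \<le> vnorm k (\<lambda>c. X (l i) c - V i c) + 2 * w i"
      using dV[OF i] L2_set_triangle_diff[of "X (l i)" "C (\<theta> i)" ?K "V i"]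
        L2_set_minus_commute[of "V i" "C (\<theta> i)" ?K]
      by (simp add: e_def vnorm_eq_L2_set)
  qed
  hence "(\<Sum>i\<in>Ip. e i) \<le> kmed_cost k Ip V l X + 2 * Sp"
    by (simp add: sum.distrib kmed_cost_def Sp_def sum_distrib_left)
  ultimately have eS: "(\<Sum>i\<in>Ip. e i) \<le> (2 + \<gamma>) * 2 * Sp" by (simp add: algebra_simps)
  \<comment> \<open>Half the separation of the centres: two nodes closer than this to their own
    centres cannot share a label unless they share a community.\<close>
  define far where "far = {i \<in> Ip. e i \<ge> 1 / 2}"
  have "real (card far) * (1 / 2) \<le> (\<Sum>i\<in>far. e i)"
    using sum_bounded_below[of far "1/2" e] by (simp add: far_def)
  also have "\<dots> \<le> (\<Sum>i\<in>Ip. e i)" using fIp by (intro sum_mono2) (auto simp: far_def e_def)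
  finally have "real (card far) \<le> 2 * ((2 + \<gamma>) * 2 * Sp)" using eS by linarith
  hence cf: "real (card far) \<le> 4 * (2 + \<gamma>) * Sp" by (simp add: algebra_simps)
  define bad where "bad = far \<union> ({..<n} - Ip)"
  have "real (card bad) \<le> real (card far) + real (card ({..<n} - Ip))"
    unfolding bad_def by (metis card_Un_le of_nat_add of_nat_le_iff)
  also have "\<dots> \<le> 4 * (2.5 + \<gamma>) * Sp + 4 * (2.5 + \<gamma>) * real (card ({..<n} - Ip))"
  proof (intro add_mono)
    show "real (card far) \<le> 4 * (2.5 + \<gamma>) * Sp"
      using cf mult_right_mono[OF _ Sp0, of "4 * (2 + \<gamma>)" "4 * (2.5 + \<gamma>)"] by simp
    show "real (card ({..<n} - Ip)) \<le> 4 * (2.5 + \<gamma>) * real (card ({..<n} - Ip))"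
      using mult_right_mono[of 1 "4 * (2.5 + \<gamma>)" "real (card ({..<n} - Ip))"] \<gamma> by simp
  qed
  also have "\<dots> = 4 * (2.5 + \<gamma>) * S" by (simp add: Ssplit algebra_simps)
  also have "\<dots> \<le> 4 * (2.5 + \<gamma>) * sqrt (2 * \<delta>\<^sup>2 * real k * N2)"
    using S \<gamma> by (intro mult_left_mono) auto
  finally have cb: "real (card bad) \<le> 4 * (2.5 + \<gamma>) * sqrt (2 * \<delta>\<^sup>2 * real k * N2)" .
  have good: "i \<in> Ip \<and> e i < 1 / 2 \<and> \<theta>h i = l i" if "i < n" "i \<notin> bad" for i
    using that \<theta>h by (auto simp: bad_def far_def)
  have "misclass n k \<theta> \<theta>h \<le> real (card bad) / real n"
  proof (rule misclass_le_card_bad[OF n \<theta>])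
    show "bad \<subseteq> {..<n}" using Ipn by (auto simp: bad_def far_def)
    show "card bad < n_min n k \<theta>" using cb small by linarith
    show "\<theta>h i \<in> {1..k}" if "i < n" "i \<notin> bad" for i using good[OF that] l by simp
    fix i j assume ij: "i < n" "j < n" "i \<notin> bad" "j \<notin> bad" "\<theta>h i = \<theta>h j"
    show "\<theta> i = \<theta> j"
    proof (rule ccontr)
      assume "\<theta> i \<noteq> \<theta> j"
      hence "1 \<le> L2_set (\<lambda>c. C (\<theta> i) c - C (\<theta> j) c) ?K" using \<theta> ij by (intro sep) auto
      also have "\<dots> \<le> L2_set (\<lambda>c. C (\<theta> i) c - X (l i) c) ?K + L2_set (\<lambda>c. X (l i) c - C (\<theta> j) c) ?K"
        by (rule L2_set_triangle_diff)
      also have "\<dots> = e i + e j"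
        using good[OF ij(1,3)] good[OF ij(2,4)] ij(5) L2_set_minus_commute[of "C (\<theta> i)" "X (l i)" ?K]
        by (simp add: e_def)
      finally show False using good[OF ij(1,3)] good[OF ij(2,4)] by linarith
    qed
  qed
  also have "\<dots> \<le> 4 * (2.5 + \<gamma>) * sqrt (2 * \<delta>\<^sup>2 * real k * N2) / real n"
    using cb by (intro divide_right_mono) auto
  finally show ?thesis .
qed

section \<open>The signal matrix in the basis of community vectors\<close>

lemma community_vec_orthonormal:
  "orthonormal_on {..<n} {1..k} cvec"
proof (intro ballI)
  fix a b assume ab: "a \<in> {1..k}" "b \<in> {1..k}"
  show "inner_on {..<n} (cvec a) (cvec b) = (if a = b then 1 else 0)"
  proof (cases "a = b")
    case False
    thus ?thesis unfolding inner_on_def by (auto simp: community_vec_def intro!: sum.neutral)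
  next
    case True
    have p: "nt a > 0" using nt_j_pos ab by blast
    have "inner_on {..<n} (cvec a) (cvec a) =
       (\<Sum>i<n. if \<theta> i = a then (\<psi> i)\<^sup>2 / nt a else 0)"
      unfolding inner_on_def using p by (intro sum.cong) (auto simp: community_vec_def power2_eq_square)
    also have "\<dots> = (\<Sum>i\<in>comm n \<theta> a. (\<psi> i)\<^sup>2 / nt a)" by (rule sum_comm_eq[symmetric])
    also have "\<dots> = 1" using p by (simp add: nt_j_def sum_divide_distrib[symmetric])
    finally show ?thesis using True by simp
  qed
qed

text \<open>The matrix sees \<open>x\<close> only through its \<open>k\<close> inner products with
  the community vectors, so it annihilates their orthogonal complement; the weights
  \<open>sqrt (nt b)\<close> undo the normalisation.\<close>

lemma app_signal_matrix:
  "app_on {..<n} (\<lambda>i j. \<tau> * (\<psi> i * \<psi> j * B (\<theta> i) (\<theta> j))) x i = \<tau> * \<psi> i *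
    app_on {1..k} B (\<lambda>b. sqrt (nt b) * inner_on {..<n} (cvec b) x) (\<theta> i)"
proof -
  have z: "sqrt (nt b) * inner_on {..<n} (cvec b) x = (\<Sum>l\<in>comm n \<theta> b. \<psi> l * x l)"
    if b: "b \<in> {1..k}" for b
  proof -
    have "nt b > 0" using nt_j_pos b by blast
    hence "sqrt (nt b) * inner_on {..<n} (cvec b) x = (\<Sum>l<n. if \<theta> l = b then \<psi> l * x l else 0)"
      unfolding inner_on_def sum_distrib_left by (intro sum.cong) (auto simp: community_vec_def)
    thus ?thesis by (simp add: sum_comm_eq)
  qed
  have "app_on {..<n} (\<lambda>i j. \<tau> * (\<psi> i * \<psi> j * B (\<theta> i) (\<theta> j))) x i =
      (\<Sum>b\<in>{1..k}. \<Sum>l\<in>comm n \<theta> b. \<tau> * (\<psi> i * \<psi> l * B (\<theta> i) (\<theta> l)) * x l)"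
    unfolding app_on_def by (rule sum_over_communities)
  also have "\<dots> = (\<Sum>b\<in>{1..k}. \<tau> * \<psi> i * (B (\<theta> i) b * (\<Sum>l\<in>comm n \<theta> b. \<psi> l * x l)))"
    unfolding sum_distrib_left by (intro sum.cong refl) (auto simp: comm_def)
  also have "\<dots> = \<tau> * \<psi> i * app_on {1..k} B (\<lambda>b. sqrt (nt b) * inner_on {..<n} (cvec b) x) (\<theta> i)"
    unfolding app_on_def sum_distrib_left[symmetric] by (simp add: z)
  finally show ?thesis .
qed

text \<open>Each side of the factorisation contributes a weight \<open>sqrt (nt j)\<close>, at least
  \<open>sqrt nt_min\<close>, and \<open>B\<close> in between expands by at least
  \<open>lambda_B\<close>; together they give the factor \<open>nt_min * lambda_B\<close>.\<close>

lemma signal_matrix_gap: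
  assumes k: "k \<ge> 1" and sym: "\<forall>a\<in>{1..k}. \<forall>b\<in>{1..k}. B a b = B b a" and lam: "lambda_B k B > 0" and \<tau>: "\<tau> \<ge> 0"
  shows "\<tau> * nt_min n k \<theta> \<psi> * lambda_B k B * L2_set (\<lambda>j. inner_on {..<n} (cvec j) x) {1..k}
    \<le> L2_set (app_on {..<n} (\<lambda>i j. \<tau> * (\<psi> i * \<psi> j * B (\<theta> i) (\<theta> j))) x) {..<n}"
proof -
  let ?K = "{1..k}"
  let ?m = "nt_min n k \<theta> \<psi>"
  let ?v = "\<lambda>j. inner_on {..<n} (cvec j) x"
  define z where "z = (\<lambda>b. sqrt (nt b) * ?v b)"
  have mle: "?m \<le> nt j" if "j \<in> ?K" for j
    unfolding nt_min_def using that by (intro Min_le) auto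
  have m0: "?m > 0" using k by (rule nt_min_pos)
  have zz: "inner_on ?K z z = (\<Sum>j\<in>?K. z j * z j)" by (simp add: inner_on_def)
  have "(?m * lambda_B k B)\<^sup>2 * (\<Sum>j\<in>?K. (?v j)\<^sup>2) = ?m * (lambda_B k B)\<^sup>2 * (\<Sum>j\<in>?K. ?m * (?v j)\<^sup>2)"
    by (simp add: sum_distrib_left power_mult_distrib power2_eq_square mult_ac)
  also have "\<dots> \<le> ?m * (lambda_B k B)\<^sup>2 * inner_on ?K z z"
    unfolding zz
  proof (intro mult_left_mono sum_mono)
    fix j assume j: "j \<in> ?K"
    have "?m * (?v j)\<^sup>2 \<le> nt j * (?v j)\<^sup>2" using mle[OF j] by (intro mult_right_mono) auto
    also have "\<dots> = (z j)\<^sup>2" using mle[OF j] m0 by (simp add: z_def power_mult_distrib)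
    finally show "?m * (?v j)\<^sup>2 \<le> z j * z j" by (simp add: power2_eq_square)
  qed (use m0 in auto)
  also have "\<dots> = ?m * ((lambda_B k B)\<^sup>2 * inner_on ?K z z)" by simp
  also have "\<dots> \<le> ?m * inner_on ?K (app_on ?K B z) (app_on ?K B z)"
    using m0 lambda_B_lower_bound[OF sym] lam by (intro mult_left_mono) auto
  also have "\<dots> \<le> (\<Sum>j\<in>?K. nt j * (app_on ?K B z j)\<^sup>2)"
    unfolding inner_on_def sum_distrib_left
    by (intro sum_mono) (use mle in \<open>simp add: power2_eq_square mult_right_mono\<close>)
  also have "\<dots> = (\<Sum>j\<in>?K. \<Sum>i\<in>comm n \<theta> j. (\<psi> i * app_on ?K B z (\<theta> i))\<^sup>2)"
    unfolding nt_j_def sum_distrib_right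
    by (intro sum.cong refl) (auto simp: comm_def power_mult_distrib)
  also have "\<dots> = (\<Sum>i<n. (\<psi> i * app_on ?K B z (\<theta> i))\<^sup>2)"
    by (rule sum_over_communities[symmetric])
  finally have "sqrt ((?m * lambda_B k B)\<^sup>2 * (\<Sum>j\<in>?K. (?v j)\<^sup>2)) \<le> L2_set (\<lambda>i. \<psi> i * app_on ?K B z (\<theta> i)) {..<n}"
    unfolding L2_set_def by (rule real_sqrt_le_mono)
  hence "?m * lambda_B k B * L2_set ?v ?K \<le> L2_set (\<lambda>i. \<psi> i * app_on ?K B z (\<theta> i)) {..<n}"
    using m0 lam by (simp add: real_sqrt_mult L2_set_def)
  hence "\<tau> * (?m * lambda_B k B * L2_set ?v ?K) \<le> \<tau> * L2_set (\<lambda>i. \<psi> i * app_on ?K B z (\<theta> i)) {..<n}"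
    using \<tau> by (rule mult_left_mono)
  also have "\<dots> = L2_set (\<lambda>i. \<tau> * (\<psi> i * app_on ?K B z (\<theta> i))) {..<n}" using \<tau> by (simp add: L2_set_scale)
  also have "\<dots> = L2_set (app_on {..<n} (\<lambda>i j. \<tau> * (\<psi> i * \<psi> j * B (\<theta> i) (\<theta> j))) x) {..<n}"
    unfolding app_signal_matrix z_def by (simp only: mult.assoc)
  finally show ?thesis by (simp add: mult.assoc)
qed

lemma algB_misclass_bound:
  assumes n: "n \<ge> 1" and k: "k \<ge> 1" and sym: "\<forall>a\<in>{1..k}. \<forall>b\<in>{1..k}. B a b = B b a"
    and lam: "lambda_B k B > 0" and \<gamma>: "\<gamma> \<ge> 0" and \<tau>: "\<tau> > 0"
    and Msym: "\<forall>i<n. \<forall>j<n. M i j = M j i"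
    and \<Delta>: "\<And>x. L2_set (\<lambda>i. app_on {..<n} M x i -
        app_on {..<n} (\<lambda>i j. \<tau> * (\<psi> i * \<psi> j * B (\<theta> i) (\<theta> j))) x i) {..<n} \<le> \<Delta> * L2_set x {..<n}" "\<Delta> \<ge> 0"
  defines "\<delta> \<equiv> 2 * \<Delta> / (\<tau> * nt_min n k \<theta> \<psi> * lambda_B k B)"
    and "N2 \<equiv> (\<Sum>j\<in>{1..k}. (real (n_j n \<theta> j))\<^sup>2 * nu_j n \<theta> \<psi> j)"
  assumes \<delta>: "\<delta>\<^sup>2 \<le> 1 / 2" and top: "top_k_eigvecs n k M U"
    and km: "approx_kmedians k \<gamma> {i. i < n \<and> vnorm k (\<lambda>c. U i c) > 0} (\<lambda>i c. U i c / vnorm k (\<lambda>c'. U i c')) l"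
    and \<theta>h: "\<forall>i<n. \<theta>h i = (if i \<in> {i. i < n \<and> vnorm k (\<lambda>c. U i c) > 0} then l i else 1)"
    and small: "4 * (2.5 + \<gamma>) * sqrt (2 * \<delta>\<^sup>2 * real k * N2) < real (n_min n k \<theta>)"
  shows "misclass n k \<theta> \<theta>h \<le> 4 * (2.5 + \<gamma>) * sqrt (2 * \<delta>\<^sup>2 * real k * N2) / real n"
proof -
  let ?I = "{..<n}" and ?K = "{1..k}"
  let ?u = "cvec"
  let ?P = "\<lambda>i j. \<tau> * (\<psi> i * \<psi> j * B (\<theta> i) (\<theta> j))"
  have m0: "nt_min n k \<theta> \<psi> > 0" using k by (rule nt_min_pos)
  have g0: "\<tau> * nt_min n k \<theta> \<psi> * lambda_B k B > 0" using \<tau> m0 lam by simp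
  have \<delta>0: "\<delta> \<ge> 0" unfolding \<delta>_def using g0 \<Delta>(2) by simp
  have orthU: "orthonormal_on ?I ?K (\<lambda>c i. U i c)"
    using top unfolding top_k_eigvecs_def inner_on_def by (elim exE conjE)
  note orthu = community_vec_orthonormal
  have near: "L2_set (\<lambda>j. inner_on ?I (?u j) w) ?K \<le> \<delta> * L2_set w ?I"
    if w: "orth_to ?I ?K (\<lambda>c i. U i c) w" for w
  proof -
    have "\<tau> * nt_min n k \<theta> \<psi> * lambda_B k B * L2_set (\<lambda>j. inner_on ?I (?u j) w) ?K \<le> 2 * \<Delta> * L2_set w ?I"
    proof (rule davis_kahan_complement[OF top Msym _ _ _ w])
      fix x assume x: "\<forall>j\<in>?K. inner_on ?I (?u j) x = 0"
      hence "app_on ?K B (\<lambda>b. sqrt (nt b) * inner_on ?I (?u b) x) a = 0" for a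
        by (simp add: app_on_def)
      thus "\<forall>i\<in>?I. app_on ?I ?P x i = 0" by (simp add: app_signal_matrix)
    next
      show "\<tau> * nt_min n k \<theta> \<psi> * lambda_B k B * L2_set (\<lambda>j. inner_on ?I (?u j) x) ?K \<le> L2_set (app_on ?I ?P x) ?I" for x
        using signal_matrix_gap[OF k sym lam] \<tau> by simp
    qed (rule \<Delta>(1))
    thus ?thesis using g0 by (simp add: \<delta>_def pos_le_divide_eq mult_ac)
  qed
  define H where "H = (\<lambda>j c. inner_on ?I (?u j) (\<lambda>i. U i c))"
  \<comment> \<open>Community vectors have disjoint supports, so each projected row is a positive
    multiple of a single row of \<open>H\<close>: the degree parameter changes its length and not
    its direction.\<close>
  have uH: "(\<Sum>j\<in>?K. ?u j i * H j c) = \<psi> i / sqrt (nt (\<theta> i)) * H (\<theta> i) c" if i: "i < n" for i c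
  proof -
    have "(\<Sum>j\<in>?K. ?u j i * H j c) = (\<Sum>j\<in>?K. if j = \<theta> i then \<psi> i / sqrt (nt (\<theta> i)) * H (\<theta> i) c else 0)"
      by (intro sum.cong) (auto simp: community_vec_def)
    thus ?thesis using \<theta> i by simp
  qed
  show ?thesis
    unfolding N2_def
  proof (rule clustering_error[where H=H and U=U and l=l and \<gamma>=\<gamma>, OF n \<gamma> \<delta>0 \<delta> _ _ _ km \<theta>h small[unfolded N2_def]])
    show "(1 - \<delta>\<^sup>2) * inner_on ?K a a \<le> (\<Sum>c\<in>?K. (\<Sum>j\<in>?K. a j * H j c)\<^sup>2)" for a
      unfolding H_def
      by (rule almost_orthogonal_coefficients[where U="\<lambda>c i. U i c", OF orthU orthu _ near]) auto
    have "(\<Sum>i<n. \<Sum>c\<in>?K. (U i c - \<psi> i / sqrt (nt (\<theta> i)) * H (\<theta> i) c)\<^sup>2) =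
        (\<Sum>i<n. \<Sum>c\<in>?K. (U i c - (\<Sum>j\<in>?K. ?u j i * H j c))\<^sup>2)"
      by (intro sum.cong refl) (simp only: uH lessThan_iff)
    also have "\<dots> \<le> real (card ?K) * \<delta>\<^sup>2"
      unfolding H_def
      by (rule subspace_distance_bound[where U="\<lambda>c i. U i c", OF orthU orthu _ near]) auto
    finally show "(\<Sum>i<n. \<Sum>c\<in>?K. (U i c - \<psi> i / sqrt (nt (\<theta> i)) * H (\<theta> i) c)\<^sup>2) \<le> real k * \<delta>\<^sup>2" by simp
    show "(\<Sum>c\<in>?K. (H j c)\<^sup>2) \<le> 1" if j: "j \<in> ?K" for j
      using bessel_inequality[where U="\<lambda>c i. U i c", OF orthU, of "?u j"] orthu j by (simp add: H_def)
  qed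
qed

end

section \<open>Edge flips of the block model\<close>

lemma bernoulli_xor:
  assumes r: "0 \<le> r" "r \<le> 1" and f: "0 \<le> f" "f \<le> 1"
  shows "bind_pmf (bernoulli_pmf r) (\<lambda>b. bind_pmf (bernoulli_pmf f) (\<lambda>c. return_pmf (b \<noteq> c)))
     = bernoulli_pmf (r * (1 - f) + (1 - r) * f)"
proof (rule pmf_eqI)
  fix x :: bool
  have "0 \<le> r * (1 - f) + (1 - r) * f" using r f by simp
  moreover have "r * (1 - f) + (1 - r) * f \<le> r * 1 + (1 - r) * 1"
    using r f by (intro add_mono mult_left_mono) auto
  ultimately show "pmf (bind_pmf (bernoulli_pmf r) (\<lambda>b. bind_pmf (bernoulli_pmf f) (\<lambda>c. return_pmf (b \<noteq> c)))) x
     = pmf (bernoulli_pmf (r * (1 - f) + (1 - r) * f)) x"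
    using r f by (cases x) (simp_all add: pmf_bind algebra_simps)
qed

lemma sym_of_cong: "(\<And>e. e \<in> pairs n \<Longrightarrow> E e = F e) \<Longrightarrow> sym_of n E = sym_of n F"
  by (intro ext) (auto simp: sym_of_def pairs_def)

text \<open>The value 0 at \<open>\<infinity>\<close> makes the graph without flips an instance of
  the same formulas.\<close>

definition flip_prob :: "ereal \<Rightarrow> real" where
  "flip_prob \<epsilon> = (if \<epsilon> = \<infinity> then 0 else 1 / (1 + exp (real_of_ereal \<epsilon>)))"

lemma flip_prob_bounds:
  assumes "\<epsilon> > 0"
  shows "0 \<le> flip_prob \<epsilon>" "flip_prob \<epsilon> < 1 / 2"
proof -
  show "0 \<le> flip_prob \<epsilon>" by (simp add: flip_prob_def add_nonneg_nonneg)
  have "exp (real_of_ereal \<epsilon>) > 1" if "\<epsilon> \<noteq> \<infinity>" using assms that by (cases \<epsilon>) auto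
  thus "flip_prob \<epsilon> < 1 / 2" by (auto simp: flip_prob_def divide_simps add_pos_pos)
qed

text \<open>Edges and flips are both independent over pairs, so their composition acts
  coordinatewise: \<open>Pi_pmf_bind\<close> commutes it with the product, and each coordinate is
  the exclusive or of two Bernoulli variables.\<close>

lemma edge_flip_dcbm:
  assumes r: "\<And>i j. (i, j) \<in> pairs n \<Longrightarrow> 0 \<le> \<psi> i * \<psi> j * B (\<theta> i) (\<theta> j) \<and> \<psi> i * \<psi> j * B (\<theta> i) (\<theta> j) \<le> 1"
    and \<epsilon>: "\<epsilon> > 0"
  shows "bind_pmf (dcbm_pmf n \<theta> \<psi> B) (edge_flip n \<epsilon>) = map_pmf (sym_of n) (Pi_pmf (pairs n) False
     (\<lambda>e. bernoulli_pmf (case e of (i,j) \<Rightarrow>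
        (1 - 2 * flip_prob \<epsilon>) * (\<psi> i * \<psi> j * B (\<theta> i) (\<theta> j)) + flip_prob \<epsilon>)))"
proof -
  let ?r = "\<lambda>(i,j). \<psi> i * \<psi> j * B (\<theta> i) (\<theta> j)"
  let ?f = "flip_prob \<epsilon>"
  let ?PE = "Pi_pmf (pairs n) False (\<lambda>(i,j). bernoulli_pmf (\<psi> i * \<psi> j * B (\<theta> i) (\<theta> j)))"
  let ?Q = "\<lambda>e. bernoulli_pmf (case e of (i,j) \<Rightarrow> (1 - 2 * ?f) * (\<psi> i * \<psi> j * B (\<theta> i) (\<theta> j)) + ?f)"
  show ?thesis
  proof (cases "\<epsilon> = \<infinity>")
    case True
    hence "edge_flip n \<epsilon> = return_pmf" by (intro ext) (simp add: edge_flip_def)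
    thus ?thesis using True by (simp add: dcbm_pmf_def bind_return_pmf' flip_prob_def case_prod_unfold)
  next
    case False
    let ?PF = "Pi_pmf (pairs n) False (\<lambda>_. bernoulli_pmf ?f)"
    have flip: "edge_flip n \<epsilon> (sym_of n E) = map_pmf (sym_of n) (Pi_pmf (pairs n) False
        (\<lambda>e. bind_pmf (bernoulli_pmf ?f) (\<lambda>c. return_pmf (E e \<noteq> c))))" for E
    proof -
      have "edge_flip n \<epsilon> (sym_of n E) = map_pmf (\<lambda>F. sym_of n (\<lambda>(i,j). sym_of n E i j \<noteq> F (i,j))) ?PF"
        using False by (simp add: edge_flip_def flip_prob_def)
      \<comment> \<open>Outside \<open>pairs n\<close> the value becomes \<open>False\<close>, the
        default of \<open>Pi_pmf\<close>; \<open>sym_of\<close> does not read these entries.\<close>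
      also have "\<dots> = map_pmf (\<lambda>F. sym_of n (\<lambda>e. if e \<in> pairs n then E e \<noteq> F e else False)) ?PF"
        by (intro arg_cong[where f="\<lambda>g. map_pmf g ?PF"] ext sym_of_cong) (auto simp: pairs_def sym_of_def)
      also have "\<dots> = map_pmf (sym_of n) (bind_pmf ?PF (\<lambda>F. return_pmf (\<lambda>e. if e \<in> pairs n then E e \<noteq> F e else False)))"
        by (simp add: map_pmf_def bind_assoc_pmf bind_return_pmf)
      also have "bind_pmf ?PF (\<lambda>F. return_pmf (\<lambda>e. if e \<in> pairs n then E e \<noteq> F e else False)) =
         Pi_pmf (pairs n) False (\<lambda>e. bind_pmf (bernoulli_pmf ?f) (\<lambda>c. return_pmf (E e \<noteq> c)))"
        by (simp add: Pi_pmf_bind[where d'=False])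
      finally show ?thesis .
    qed
    have "bind_pmf (dcbm_pmf n \<theta> \<psi> B) (edge_flip n \<epsilon>) = bind_pmf ?PE (\<lambda>E. edge_flip n \<epsilon> (sym_of n E))"
      by (simp add: dcbm_pmf_def bind_map_pmf)
    also have "\<dots> = map_pmf (sym_of n) (bind_pmf ?PE (\<lambda>E. Pi_pmf (pairs n) False
        (\<lambda>e. bind_pmf (bernoulli_pmf ?f) (\<lambda>c. return_pmf (E e \<noteq> c)))))"
      by (simp only: flip map_bind_pmf)
    also have "bind_pmf ?PE (\<lambda>E. Pi_pmf (pairs n) False (\<lambda>e. bind_pmf (bernoulli_pmf ?f) (\<lambda>c. return_pmf (E e \<noteq> c))))
       = Pi_pmf (pairs n) False (\<lambda>e. bind_pmf (case e of (i,j) \<Rightarrow> bernoulli_pmf (\<psi> i * \<psi> j * B (\<theta> i) (\<theta> j)))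
           (\<lambda>b. bind_pmf (bernoulli_pmf ?f) (\<lambda>c. return_pmf (b \<noteq> c))))"
      by (rule Pi_pmf_bind[symmetric]) simp
    also have "\<dots> = Pi_pmf (pairs n) False ?Q"
    proof (rule Pi_pmf_cong)
      fix e assume "e \<in> pairs n"
      then obtain i j where e: "e = (i,j)" "(i,j) \<in> pairs n" by (cases e) auto
      show "bind_pmf (case e of (i,j) \<Rightarrow> bernoulli_pmf (\<psi> i * \<psi> j * B (\<theta> i) (\<theta> j)))
           (\<lambda>b. bind_pmf (bernoulli_pmf ?f) (\<lambda>c. return_pmf (b \<noteq> c))) = ?Q e"
        unfolding e(1) prod.case using r[OF e(2)] flip_prob_bounds[OF \<epsilon>]
        by (subst bernoulli_xor) (auto simp: algebra_simps)
    qed simp_all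
    finally show ?thesis .
  qed
qed

lemma entries_eq_image:
  "{B a b | a b. a \<in> S \<and> b \<in> S} = (\<lambda>(a, b). B a b) ` (S \<times> S)"
  by fastforce

lemma maxB_ge:
  assumes "a \<in> {1..k}" "b \<in> {1..k}"
  shows "B a b \<le> maxB k B"
proof -
  have "finite {B a b | a b. a \<in> {1..k} \<and> b \<in> {1..k}}" unfolding entries_eq_image by simp
  thus ?thesis unfolding maxB_def using assms by (intro Max_ge) auto
qed

lemma maxB_le:
  assumes "k \<ge> 1" "\<forall>a\<in>{1..k}. \<forall>b\<in>{1..k}. B a b \<le> M"
  shows "maxB k B \<le> M"
  unfolding maxB_def entries_eq_image using assms by (intro Max.boundedI) auto

text \<open>\<open>\<tau>\<^sup>2 g\<^sub>\<epsilon>(B)\<close> with \<open>\<tau> = 1 - 2 flip_prob \<epsilon> = (e\<^sup>\<epsilon> - 1) / (e\<^sup>\<epsilon> + 1)\<close> is the largest possible edge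
  probability after flipping.\<close>

lemma g_eps_flip:
  assumes "\<epsilon> > 0"
  shows "(1 - 2 * flip_prob \<epsilon>)\<^sup>2 * g_eps \<epsilon> k B = (1 - 2 * flip_prob \<epsilon>) * maxB k B + flip_prob \<epsilon>"
proof (cases "\<epsilon> = \<infinity>")
  case True
  thus ?thesis by (simp add: flip_prob_def g_eps_def)
next
  case False
  define e where "e = exp (real_of_ereal \<epsilon>)"
  have e: "e > 1" unfolding e_def using assms False by (cases \<epsilon>) auto
  have t: "1 - 2 * flip_prob \<epsilon> = (e - 1) / (e + 1)" and f: "flip_prob \<epsilon> = 1 / (e + 1)"
    using False e by (simp_all add: flip_prob_def e_def[symmetric] field_simps)
  have "((e - 1) / (e + 1))\<^sup>2 * ((e + 1) / (e - 1) * (maxB k B + 1 / (e - 1)))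
      = (e - 1) / (e + 1) * (maxB k B + 1 / (e - 1))"
    using e by (simp add: power2_eq_square)
  also have "\<dots> = (e - 1) / (e + 1) * maxB k B + 1 / (e + 1)"
    using e by (simp add: distrib_left)
  finally have "((e - 1) / (e + 1))\<^sup>2 * ((e + 1) / (e - 1) * (maxB k B + 1 / (e - 1)))
      = (e - 1) / (e + 1) * maxB k B + 1 / (e + 1)" .
  moreover have "g_eps \<epsilon> k B = (e + 1) / (e - 1) * (maxB k B + 1 / (e - 1))"
    using False by (simp only: g_eps_def e_def Let_def if_False)
  ultimately show ?thesis unfolding t unfolding f by (simp only:)
qed

lemma debiased_adj_eq:
  "(if sym_of n E i j then 1 else 0) - (if \<epsilon> = \<infinity> then 0 else (if i = j then 0 else 1 / (exp (real_of_ereal \<epsilon>) + 1)))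
    = adj n E i j - (if i = j then 0 else flip_prob \<epsilon>)"
  by (auto simp: adj_def flip_prob_def add.commute)

text \<open>The constant 12 is 4 from the clustering bound, times 2 from the two uses of
  \<open>\<Delta>\<close> in the subspace distance, times 3/2 as an upper bound for
  \<open>sqrt 2\<close>. The signal-to-noise hypothesis acts twice: it keeps the number of bad nodes
  below \<open>n_min\<close>, and through \<open>n_min \<le> sqrt N2\<close> it makes
  \<open>\<delta>\<close> small.\<close>

theorem theorem3:
  "\<exists>c2::real. c2 > 0 \<and>
   (\<forall>(n::nat) (k::nat) (\<theta>::nat \<Rightarrow> nat) (\<psi>::nat \<Rightarrow> real) (B::nat \<Rightarrow> nat \<Rightarrow> real) (\<epsilon>::ereal) (\<gamma>::real).
      1 \<le> k \<longrightarrow>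
      (\<forall>i<n. \<theta> i \<in> {1..k}) \<longrightarrow>
      (\<forall>j\<in>{1..k}. comm n \<theta> j \<noteq> {}) \<longrightarrow>
      (\<forall>i<n. 0 < \<psi> i \<and> \<psi> i \<le> 1) \<longrightarrow>
      (\<forall>j\<in>{1..k}. Max (\<psi> ` comm n \<theta> j) = 1) \<longrightarrow>
      (\<forall>a\<in>{1..k}. \<forall>b\<in>{1..k}. 0 < B a b \<and> B a b \<le> 1 \<and> B a b = B b a) \<longrightarrow>
      full_rank_on {1..k} B \<longrightarrow>
      lambda_B k B > 0 \<longrightarrow>
      maxB k B \<ge> ln (real n) / real n \<longrightarrow>
      \<epsilon> > 0 \<longrightarrow> \<gamma> \<ge> 0 \<longrightarrow>
      (2.5 + \<gamma>) * sqrt (real k * real n * g_eps \<epsilon> k B) / (nt_min n k \<theta> \<psi> * lambda_B k B)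
        < (1 / c2) * real (n_min n k \<theta>)
            / sqrt (\<Sum>j\<in>{1..k}. (real (n_j n \<theta> j))\<^sup>2 * nu_j n \<theta> \<psi> j) \<longrightarrow>
      measure_pmf.prob (bind_pmf (dcbm_pmf n \<theta> \<psi> B) (edge_flip n \<epsilon>))
        {A. \<forall>\<theta>h. algB_output n k \<gamma> \<epsilon> A \<theta>h \<longrightarrow>
              misclass n k \<theta> \<theta>h \<le> c2 * (2.5 + \<gamma>) / (nt_min n k \<theta> \<psi> * lambda_B k B) *
                sqrt (real k / real n * (\<Sum>j\<in>{1..k}. (real (n_j n \<theta> j))\<^sup>2 * nu_j n \<theta> \<psi> j)
                      * g_eps \<epsilon> k B)}
        \<ge> 1 - 1 / real n)"
proof -
  \<comment> \<open>The concentration constant, plus 1 for the diagonal of the signal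
    matrix.\<close>
  define K1 :: real where "K1 = 2 * (42 + 8 * (6 * exp 4 + 328)) + 1"
  have K1: "K1 > 0" unfolding K1_def by (intro add_nonneg_pos) (auto intro!: add_nonneg_nonneg)
  show ?thesis
  proof (rule exI[of _ "12 * K1"], intro conjI allI impI)
    show "12 * K1 > 0" using K1 by simp
    fix n k :: nat and \<theta> :: "nat \<Rightarrow> nat" and \<psi> :: "nat \<Rightarrow> real" and B :: "nat \<Rightarrow> nat \<Rightarrow> real"
      and \<epsilon> :: ereal and \<gamma> :: real
    assume k: "1 \<le> k" and \<theta>: "\<forall>i<n. \<theta> i \<in> {1..k}" and ne: "\<forall>j\<in>{1..k}. comm n \<theta> j \<noteq> {}"
      and \<psi>: "\<forall>i<n. 0 < \<psi> i \<and> \<psi> i \<le> 1"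
      and B: "\<forall>a\<in>{1..k}. \<forall>b\<in>{1..k}. 0 < B a b \<and> B a b \<le> 1 \<and> B a b = B b a"
      and lam: "lambda_B k B > 0" and mB: "maxB k B \<ge> ln (real n) / real n"
      and \<epsilon>: "\<epsilon> > 0" and \<gamma>: "\<gamma> \<ge> 0"
      and cond: "(2.5 + \<gamma>) * sqrt (real k * real n * g_eps \<epsilon> k B) / (nt_min n k \<theta> \<psi> * lambda_B k B)
        < (1 / (12 * K1)) * real (n_min n k \<theta>)
            / sqrt (\<Sum>j\<in>{1..k}. (real (n_j n \<theta> j))\<^sup>2 * nu_j n \<theta> \<psi> j)"
    interpret community_model n k \<theta> \<psi> by unfold_locales (fact \<theta> \<psi> ne)+
    define N2 where "N2 = (\<Sum>j\<in>{1..k}. (real (n_j n \<theta> j))\<^sup>2 * nu_j n \<theta> \<psi> j)"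
    define m where "m = nt_min n k \<theta> \<psi>"
    define g where "g = g_eps \<epsilon> k B"
    let ?bound = "12 * K1 * (2.5 + \<gamma>) / (nt_min n k \<theta> \<psi> * lambda_B k B) *
        sqrt (real k / real n * (\<Sum>j\<in>{1..k}. (real (n_j n \<theta> j))\<^sup>2 * nu_j n \<theta> \<psi> j) * g_eps \<epsilon> k B)"
    let ?good = "{A. \<forall>\<theta>h. algB_output n k \<gamma> \<epsilon> A \<theta>h \<longrightarrow> misclass n k \<theta> \<theta>h \<le> ?bound}"
    have "comm n \<theta> 1 \<noteq> {}" using ne k by auto
    hence n1: "n \<ge> 1" by (auto simp: comm_def)
    define f where "f = flip_prob \<epsilon>"
    define \<tau> where "\<tau> = 1 - 2 * f"
    have f: "0 \<le> f" "f < 1 / 2" using flip_prob_bounds[OF \<epsilon>] by (auto simp: f_def)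
    have \<tau>: "0 < \<tau>" "\<tau> \<le> 1" using f by (auto simp: \<tau>_def)
    have mB1: "maxB k B \<le> 1" using B k by (intro maxB_le) auto
    have k1: "1 \<in> {1..k}" using k by simp
    have "0 < B 1 1" using B k1 by blast
    hence mB0: "maxB k B > 0" using maxB_ge[OF k1 k1, of B] by linarith
    have r: "0 \<le> \<psi> i * \<psi> j * B (\<theta> i) (\<theta> j) \<and> \<psi> i * \<psi> j * B (\<theta> i) (\<theta> j) \<le> maxB k B"
      if ij: "i < n" "j < n" for i j
    proof -
      have t: "\<theta> i \<in> {1..k}" "\<theta> j \<in> {1..k}" using \<theta> ij by auto
      have p: "0 < \<psi> i" "\<psi> i \<le> 1" "0 < \<psi> j" "\<psi> j \<le> 1" using \<psi> ij by auto
      have b: "0 < B (\<theta> i) (\<theta> j)" using B t by blast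
      have "\<psi> i * \<psi> j \<le> 1 * 1" using p by (intro mult_mono) auto
      hence "\<psi> i * \<psi> j * B (\<theta> i) (\<theta> j) \<le> 1 * maxB k B"
        using p b maxB_ge[OF t, of B] by (intro mult_mono) auto
      thus ?thesis using p b by simp
    qed
    define q where "q = \<tau> * maxB k B + f"
    define p where "p = (\<lambda>(i,j). \<tau> * (\<psi> i * \<psi> j * B (\<theta> i) (\<theta> j)) + f)"
    have pq: "0 \<le> p e \<and> p e \<le> q" if ep: "e \<in> pairs n" for e
    proof -
      obtain i j where e: "e = (i,j)" "i < n" "j < n" using ep by (cases e) (auto simp: pairs_def)
      show ?thesis using r[OF e(2,3)] \<tau> f by (auto simp: e(1) p_def q_def)
    qed
    have q1: "q \<le> 1"
    proof -
      have "q \<le> \<tau> * 1 + f" unfolding q_def using \<tau> mB1 by (intro add_right_mono mult_left_mono) auto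
      thus ?thesis using f by (simp add: \<tau>_def)
    qed
    \<comment> \<open>Flipping at most halves the density bound: \<open>maxB \<le> 1\<close> gives
      \<open>q \<ge> (\<tau> + f) * maxB\<close>, and \<open>\<tau> + f = 1 - f\<close>.\<close>
    have qm: "maxB k B / 2 \<le> q"
    proof -
      have "f * maxB k B \<le> f * 1" using f mB1 by (intro mult_left_mono) auto
      moreover have "1 / 2 * maxB k B \<le> (\<tau> + f) * maxB k B"
        using f mB0 by (intro mult_right_mono) (auto simp: \<tau>_def)
      ultimately show ?thesis by (simp add: q_def distrib_right)
    qed
    have q2: "q \<ge> ln (real n) / (2 * real n)" using qm mB by simp
    have q0: "q > 0" using qm mB0 by linarith
    have qg: "q = \<tau>\<^sup>2 * g" using g_eps_flip[OF \<epsilon>, of k B] by (simp add: q_def \<tau>_def f_def g_def)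
    have g0: "g > 0" using q0 \<tau> unfolding qg by (simp add: zero_less_mult_iff)
    have sq: "sqrt (real n * q) = \<tau> * sqrt (real n * g)"
      using \<tau> unfolding qg by (simp add: real_sqrt_mult)
    have m0: "m > 0" unfolding m_def using k by (rule nt_min_pos)
    have nuge: "(real (n_j n \<theta> j))\<^sup>2 \<le> (real (n_j n \<theta> j))\<^sup>2 * nu_j n \<theta> \<psi> j" if "j \<in> {1..k}" for j
      using that by (rule n_j_square_le)
    have N2: "(real (n_min n k \<theta>))\<^sup>2 \<le> N2"
    proof -
      have "n_min n k \<theta> \<le> n_j n \<theta> 1" unfolding n_min_def using k by (intro Min_le) auto
      hence "(real (n_min n k \<theta>))\<^sup>2 \<le> (real (n_j n \<theta> 1))\<^sup>2" by (intro power_mono) auto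
      also have "\<dots> \<le> (real (n_j n \<theta> 1))\<^sup>2 * nu_j n \<theta> \<psi> 1" using nuge[of 1] k by simp
      also have "\<dots> \<le> N2"
        unfolding N2_def using k nuge by (intro member_le_sum) (auto intro: order_trans[OF zero_le_power2])
      finally show ?thesis .
    qed
    have nm0: "n_min n k \<theta> > 0"
      unfolding n_min_def using k ne by (subst Min_gr_iff) (auto simp: n_j_def card_gt_0_iff)
    have N20: "N2 > 0" using N2 nm0 by (meson less_le_trans of_nat_0_less_iff zero_less_power)
    have sN: "real (n_min n k \<theta>) \<le> sqrt N2" using N2 by (rule real_le_rsqrt)
    define Y where "Y = (2.5 + \<gamma>) * sqrt (real k * real n * g) / (m * lambda_B k B)"
    have Y0: "Y \<ge> 0" unfolding Y_def using \<gamma> g0 m0 lam by simp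
    have cY: "12 * K1 * (Y * sqrt N2) < real (n_min n k \<theta>)"
    proof -
      have "Y < real (n_min n k \<theta>) / (12 * K1 * sqrt N2)"
        using cond by (simp add: Y_def m_def g_def N2_def)
      thus ?thesis using K1 N20 by (simp add: less_divide_eq mult_ac)
    qed
    define \<Delta> where "\<Delta> = K1 * sqrt (real n * q)"
    have \<Delta>0: "\<Delta> \<ge> 0" using K1 q0 by (simp add: \<Delta>_def)
    define \<delta> where "\<delta> = 2 * \<Delta> / (\<tau> * nt_min n k \<theta> \<psi> * lambda_B k B)"
    have \<delta>': "\<delta> = 2 * K1 * sqrt (real n * g) / (m * lambda_B k B)"
      unfolding \<delta>_def \<Delta>_def sq m_def[symmetric] using \<tau> by simp
    have \<delta>0: "\<delta> \<ge> 0" unfolding \<delta>' using K1 g0 m0 lam by simp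
    have kY: "(2.5 + \<gamma>) * (\<delta> * sqrt (real k)) = 2 * K1 * Y"
      unfolding \<delta>' Y_def by (simp add: real_sqrt_mult)
    have \<delta>1: "\<delta>\<^sup>2 \<le> 1 / 2"
    proof -
      have "2.5 * (\<delta> * 1) \<le> (2.5 + \<gamma>) * (\<delta> * sqrt (real k))"
        using \<gamma> \<delta>0 k by (intro mult_mono) auto
      also have "\<dots> = 2 * K1 * Y" by (rule kY)
      finally have 1: "15 * \<delta> \<le> 12 * K1 * Y" by simp
      have "12 * K1 * Y * sqrt N2 < 1 * sqrt N2" using cY sN by (simp add: mult_ac)
      hence "12 * K1 * Y < 1" using N20 by (simp only: mult_less_cancel_right) auto
      hence "\<delta> \<le> 1 / 2" using 1 by linarith
      hence "\<delta>\<^sup>2 \<le> (1 / 2)\<^sup>2" using \<delta>0 by (intro power_mono) auto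
      thus ?thesis by (simp add: power2_eq_square)
    qed
    define R where "R = 4 * (2.5 + \<gamma>) * sqrt (2 * \<delta>\<^sup>2 * real k * N2)"
    have R: "R \<le> 12 * K1 * (Y * sqrt N2)"
    proof -
      have "R = 4 * sqrt 2 * ((2.5 + \<gamma>) * (\<delta> * sqrt (real k))) * sqrt N2"
        using \<delta>0 by (simp add: R_def real_sqrt_mult)
      also have "\<dots> = sqrt 2 * (8 * K1 * (Y * sqrt N2))" unfolding kY by simp
      also have "\<dots> \<le> (3 / 2) * (8 * K1 * (Y * sqrt N2))"
      proof (rule mult_right_mono)
        show "sqrt 2 \<le> (3 / 2 :: real)" by (rule real_le_lsqrt) (auto simp: power2_eq_square)
      qed (use K1 Y0 N20 in simp)
      finally show ?thesis by simp
    qed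
    have Rb: "R / real n \<le> ?bound"
    proof -
      have "R / real n \<le> 12 * K1 * (Y * sqrt N2) / real n" using R by (intro divide_right_mono) auto
      also have "\<dots> = 12 * K1 * (2.5 + \<gamma>) / (m * lambda_B k B) * (sqrt (real k * real n * g) * sqrt N2 / real n)"
        by (simp add: Y_def)
      also have "sqrt (real k * real n * g) * sqrt N2 / real n = sqrt (real k / real n * N2 * g)"
      proof -
        have "sqrt (real k * real n * g) * sqrt N2 / real n = sqrt (real k * real n * g * N2) / sqrt ((real n)\<^sup>2)"
          by (simp add: real_sqrt_mult)
        also have "\<dots> = sqrt (real k * real n * g * N2 / (real n)\<^sup>2)" by (simp only: real_sqrt_divide)
        also have "real k * real n * g * N2 / (real n)\<^sup>2 = real k / real n * N2 * g"
          using n1 by (simp add: power2_eq_square)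
        finally show ?thesis .
      qed
      finally show ?thesis by (simp only: m_def g_def N2_def)
    qed
    let ?M = "edge_pmf n p"
    define Conc where "Conc = {E. \<forall>x. \<bar>quad_form {..<n} (centered_adj n p E) x\<bar>
      \<le> 2 * ((42 + 8 * (6 * exp 4 + 328)) * sqrt (real n * q)) * inner_on {..<n} x x}"
    have conc: "measure_pmf.prob ?M Conc \<ge> 1 - 1 / real n"
      unfolding Conc_def by (rule bounded_edges.centered_adj_concentration[OF _ q2]) (unfold_locales; fact n1 pq q0 q1)
    have law: "bind_pmf (dcbm_pmf n \<theta> \<psi> B) (edge_flip n \<epsilon>) = map_pmf (sym_of n) ?M"
    proof -
      have "0 \<le> \<psi> i * \<psi> j * B (\<theta> i) (\<theta> j) \<and> \<psi> i * \<psi> j * B (\<theta> i) (\<theta> j) \<le> 1" if "(i, j) \<in> pairs n" for i j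
        using r[of i j] mB1 that by (auto simp: pairs_def)
      from edge_flip_dcbm[where \<psi>=\<psi> and B=B and \<theta>=\<theta>, OF this \<epsilon>] show ?thesis by (simp add: p_def \<tau>_def f_def)
    qed
    have "misclass n k \<theta> \<theta>h \<le> ?bound" if E: "E \<in> Conc" and out: "algB_output n k \<gamma> \<epsilon> (sym_of n E) \<theta>h" for E \<theta>h
    proof -
      define M where "M = (\<lambda>i j. adj n E i j - (if i = j then 0 else f))"
      obtain U l where
        top: "top_k_eigvecs n k M U" and
        km: "approx_kmedians k \<gamma> {i. i < n \<and> vnorm k (\<lambda>c. U i c) > 0} (\<lambda>i c. U i c / vnorm k (\<lambda>c'. U i c')) l" and
        \<theta>h: "\<forall>i<n. \<theta>h i = (if i \<in> {i. i < n \<and> vnorm k (\<lambda>c. U i c) > 0} then l i else 1)"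
        using out unfolding algB_output_def Let_def debiased_adj_eq f_def[symmetric] M_def[symmetric]
        by (elim exE conjE)
      let ?P = "\<lambda>i j. \<tau> * (\<psi> i * \<psi> j * B (\<theta> i) (\<theta> j))"
      let ?W = "centered_adj n p E"
      have Wn: "L2_set (app_on {..<n} ?W x) {..<n} \<le> (K1 - 1) * sqrt (real n * q) * L2_set x {..<n}" for x
      proof (rule operator_norm_le_quadratic_form)
        show "\<forall>i\<in>{..<n}. \<forall>j\<in>{..<n}. ?W i j = ?W j i" by (metis centered_adj_sym)
        show "\<bar>quad_form {..<n} ?W x\<bar> \<le> (K1 - 1) * sqrt (real n * q) * inner_on {..<n} x x" for x
          using E unfolding K1_def add_diff_cancel_right' by (simp only: Conc_def mem_Collect_eq mult.assoc)
      qed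
      have MP: "M i j - ?P i j = ?W i j - (if i = j then ?P i i else 0)" if "i < n" "j < n" for i j
      proof -
        have "B (\<theta> i) (\<theta> j) = B (\<theta> j) (\<theta> i)" using B \<theta> that by blast
        thus ?thesis by (auto simp: M_def centered_adj_def p_def algebra_simps)
      qed
      have diff: "L2_set (\<lambda>i. app_on {..<n} M x i - app_on {..<n} ?P x i) {..<n} \<le> \<Delta> * L2_set x {..<n}" for x
      proof -
        have "app_on {..<n} M x i - app_on {..<n} ?P x i = app_on {..<n} ?W x i + (- ?P i i) * x i" if i: "i < n" for i
        proof -
          have "app_on {..<n} M x i - app_on {..<n} ?P x i = (\<Sum>j<n. (M i j - ?P i j) * x j)"
            by (simp add: app_on_def sum_subtractf left_diff_distrib)
          also have "\<dots> = (\<Sum>j<n. ?W i j * x j - (if j = i then ?P i i * x i else 0))"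
            using MP i by (intro sum.cong) (auto simp: left_diff_distrib)
          also have "\<dots> = app_on {..<n} ?W x i + (- ?P i i) * x i"
            using i by (simp add: app_on_def sum_subtractf)
          finally show ?thesis .
        qed
        hence "L2_set (\<lambda>i. app_on {..<n} M x i - app_on {..<n} ?P x i) {..<n}
            = L2_set (\<lambda>i. app_on {..<n} ?W x i + (- ?P i i) * x i) {..<n}"
          by (intro L2_set_cong) auto
        also have "\<dots> \<le> L2_set (app_on {..<n} ?W x) {..<n} + L2_set (\<lambda>i. (- ?P i i) * x i) {..<n}"
          by (rule L2_set_triangle_ineq)
        \<comment> \<open>The missing loops cost at most \<open>q\<close> in operator norm, and
          \<open>q \<le> sqrt (n * q)\<close> because \<open>q \<le> 1 \<le> n\<close>.\<close>
        also have "\<dots> \<le> (K1 - 1) * sqrt (real n * q) * L2_set x {..<n} + sqrt (real n * q) * L2_set x {..<n}"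
        proof (intro add_mono Wn L2_set_diagonal_le)
          fix i assume "i \<in> {..<n}"
          hence i: "i < n" by simp
          have "\<bar>- ?P i i\<bar> = ?P i i" using r[OF i i] \<tau> by simp
          also have "\<dots> \<le> \<tau> * maxB k B" using r[OF i i] \<tau> by (intro mult_left_mono) auto
          also have "\<dots> \<le> q" using f by (simp add: q_def)
          also have "\<dots> \<le> sqrt (real n * q)"
          proof (rule real_le_rsqrt)
            have "q * q \<le> 1 * q" using q0 q1 by (intro mult_right_mono) auto
            also have "\<dots> \<le> real n * q" using q0 n1 by (intro mult_right_mono) auto
            finally show "q\<^sup>2 \<le> real n * q" by (simp add: power2_eq_square)
          qed
          finally show "\<bar>- ?P i i\<bar> \<le> sqrt (real n * q)" .
        qed (use q0 in simp)
        also have "\<dots> = \<Delta> * L2_set x {..<n}" by (simp add: \<Delta>_def algebra_simps)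
        finally show ?thesis .
      qed
      have Msym: "\<forall>i<n. \<forall>j<n. M i j = M j i" by (simp add: M_def adj_sym)
      have Bsym: "\<forall>a\<in>{1..k}. \<forall>b\<in>{1..k}. B a b = B b a" using B by blast
      have "misclass n k \<theta> \<theta>h \<le> R / real n"
        unfolding R_def \<delta>_def N2_def
        by (rule algB_misclass_bound[OF n1 k Bsym lam \<gamma> \<tau>(1) Msym diff \<Delta>0 _ top km \<theta>h])
          (use \<delta>1 R cY in \<open>auto simp: R_def \<delta>_def N2_def\<close>)
      thus ?thesis using Rb by linarith
    qed
    hence "Conc \<subseteq> sym_of n -` ?good" by blast
    hence "measure_pmf.prob ?M Conc \<le> measure_pmf.prob ?M (sym_of n -` ?good)"
      by (intro measure_pmf.finite_measure_mono) auto
    also have "\<dots> = measure_pmf.prob (map_pmf (sym_of n) ?M) ?good" by (simp only: measure_map_pmf)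
    finally show "measure_pmf.prob (bind_pmf (dcbm_pmf n \<theta> \<psi> B) (edge_flip n \<epsilon>)) ?good \<ge> 1 - 1 / real n"
      using conc unfolding law by linarith
  qed
qed

end
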